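(* For every positive integer $r\le 31$ the following statements hold, where $n$ denotes a nonnegative integer for which all indices of the determinants involved are nonnegative. (1) If $r=2t+1$ is odd, then \begin{align*} &H_{(2t+1)n}(F(x,2t+1))=H_{(2t+1)n+1}(F(x,2t+1))=(-1)^{tn},\\ &H_{(2t+1)n+t+1}(F(x,2t+1))=0,\\ &H_{(2t+1)n+t}(F(x,2t+1))=-H_{(2t+1)n+t+2}(F(x,2t+1))=(-1)^{tn+\binom t2}\big((2t+1)(n+1)\big)^{t-1},\\ &H_{(2t+1)n-1}(F(x,2t+1))+H_{(2t+1)n+2}(F(x,2t+1))=(-1)^{tn+1}(t-1)(2t+1). \end{align*} (2) If $r=2t$ is even, then \begin{align*} &H_{tn}(F(x,2t))=H_{tn+1}(F(x,2t))=(-1)^{n\binom t2}(n+1)^{t-1},\\ &H_{2tn-1}(F(x,2t))+H_{2tn+2}(F(x,2t))=-t(2t-3)(2n+1)^{t-1}. \end{align*} (3) If $r=2t+1$ is odd, then for $1\le j\le t$, $(-1)^{tn}H_{rn+j}(F(x,r))$ and $(-1)^{tn}H_{rn+r+1-j}(F(x,r))$ are both polynomials in $n$ of degree $(j-1)(r-2j)$. (4) If $r=2t$ is even, then for $1\le j\le t$, $(-1)^{n\binom t2}H_{tn+j}(F(x,r))$ and $(-1)^{n\binom t2}H_{tn+t-j+1}(F(x,r))$ are both polynomials in $n$ of degree $(2j-1)(t-j)$.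
   Context: For a power series $A(x)=\sum_{n\ge 0}a_nx^n$, the Hankel determinants are $H_n(A(x))=\det(a_{i+j})_{0\le i,j\le n-1}$ for $n\ge 1$, with $H_0(A(x))=1$. Let $C(x)=\sum_{n\ge0}C_nx^n$ with $C_n=\frac1{n+1}\binom{2n}{n}$ be the Catalan generating function (the unique power series with $C(x)=1+xC(x)^2$), and let $F(x,r)=C(x)^r=\sum_{n\ge 0}\frac{r}{2n+r}\binom{2n+r}{n}x^n$ for positive integers $r$.
   Formalization: False cases are removed: for r=1 only the first line of (1) is claimed; for r=2 the second line of (2) is dropped; in (4) the range of j is 1≤j, 2j≤t+1 instead of 1≤j≤t, since j→t+1−j swaps the two sequences but changes the stated degree. *)

theory Defs
  imports
    "HOL-Computational_Algebra.Formal_Power_Series"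
    "HOL-Computational_Algebra.Polynomial"
    "Jordan_Normal_Form.Determinant"
begin

definition catalan_fps :: "rat fps" where
  "catalan_fps = Abs_fps (\<lambda>n. of_nat (2 * n choose n) / of_nat (n + 1))"

definition catalan_power :: "nat \<Rightarrow> rat fps" where
  "catalan_power r = catalan_fps ^ r"

definition hankel :: "nat \<Rightarrow> 'a::comm_ring_1 fps \<Rightarrow> 'a" where
  "hankel n A = det (mat n n (\<lambda>(i, j). fps_nth A (i + j)))"

lemma hankel_0: "hankel 0 A = 1"
  by (simp add: hankel_def det_def)

(* The conjunct p \<noteq> 0 matters only for d = 0, since degree 0 = 0 in the library. *)
definition polynomial_of_degree :: "nat \<Rightarrow> (nat \<Rightarrow> rat) \<Rightarrow> bool" where
  "polynomial_of_degree d f \<longleftrightarrow>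
     (\<exists>p :: rat poly. p \<noteq> 0 \<and> degree p = d \<and> (\<forall>n. f n = poly p (of_nat n)))"

(* Ranges of validity of the Hankel determinant formulas for catalan_power r:
   - All Hankel determinants of catalan_power 1 and catalan_power 2 with n \<ge> 0 equal 1, so the
     zero, the sign-opposite pair and the sum formula for odd r = 2 * t + 1 need t \<ge> 1, and the
     sum formula for even r = 2 * t needs t \<ge> 2.
   - For r = 2 * t the index pair {j, t - j + 1} is unchanged under j \<mapsto> t + 1 - j while
     (2 * j - 1) * (t - j) is not, so that degree can hold only for one half of the range;
     it is the half 2 * j \<le> t + 1, whose index pairs already cover all residues modulo t. *)

end

theory Submission
  imports Defs
begin

text \<open>
  Put y = w + 1/w - 2 and let V_m and S_m be the polynomials in y with
  V_m = (w^(m+1/2) + w^(-m-1/2)) / (w^(1/2) + w^(-1/2)) and S_m = (w^m - w^(-m)) / (w - 1/w). Let L be the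
  linear functional whose moments L(y^n) are the signed Catalan numbers (-1)^n C_n. Since
  L(y^n V_m) has the generating function x^m C(-x)^(2m+1) (moment_fps_cheb_V), the V_m are
  orthonormal for L, and up to signs the coefficients of C^(2t+1) are the moments L(y^n y^t V_t); likewise those of
  C^(2t) are the moments L(y^n y^t S_t) (moment_fps_cheb_S). So the Hankel determinants in question belong to the
  functional L multiplied by a polynomial q = y^t v with v = V_t or v = S_t. Christoffel's formula
  (hankel_christoffel) expresses the determinant of order n by the residues modulo q of the window
  V_n, ..., V_(n+d-1), where d is the degree of q. From now on the size of the determinant is independent of n.

  The roots of v satisfy w^(2t+1) = -1 or w^(2t) = 1, respectively. Hence, modulo v, the sequence V_m is
  periodic up to sign and has centres of symmetry. Folding the window at these centres,
  V_(N+i) + V_(N-i) = V_N T_i and V_(N+i) - V_(N-1-i) = y S_N W_i, turns t of its members into multiples of v.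
  The determinant then factors into one modulo v, which is a sign, and one modulo y^t
  (residue_det_eval). The latter consists of shifted coefficients of two polynomials with indices
  linear in n and is called sylvester_det; the results are hankel_odd_lower, hankel_odd_upper
  and hankel_even_shift. When one of the two polynomials does not occur, this is a power of a constant
  coefficient; this gives the closed forms. When one polynomial occurs in a single row, linearity in that row
  and the product formulas S_(N+i+1) - S_(N-i) = V_N W_i and S_(M+i) + S_(M-i) = S_M T_i give the sum rules.

  For the degrees, the coefficients of y^i in V_m and S_m are the binomial coefficients of m + i over 2i and
  2i + 1, so they are polynomials in m of these degrees. Hence the determinant is a polynomial in n whose
  degree is at most the claimed one (has_leading_term_sylvester). Its coefficient there is the same
  determinant for the series cosh (\<rho> \<surd>y) and sinh (\<rho> \<surd>y) / \<surd>y, up to a nonzero factor. That it is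
  nonzero means that certain Hankel matrices of coefficients of the quotient of these series, or of its
  inverse, are nonsingular. They are definite: their entries are the inner products of the polynomials in x that arise from
  expanding solutions of the boundary value problem u'' = y u on [0, \<rho>] in powers of y
  (tanh_hankel_nonsingular and coth_hankel_nonsingular).
\<close>

section \<open>Determinants of lists of polynomials\<close>

text \<open>
  A multilinear alternating function of a list of polynomials that only sees the coefficients below
  the length of the list. All determinants of the proof are written in this form, because column
  operations then become operations on lists of polynomials.
\<close>

definition coeff_det :: "'a::field poly list \<Rightarrow> 'a" where
  "coeff_det ps = det (mat (length ps) (length ps) (\<lambda>(i, j). coeff (ps ! i) j))"

lemma mat_as_mat_of_rows:
  "mat n n (\<lambda>(i, j). f i j) = mat\<^sub>r n n (\<lambda>i. vec n (f i))"
  by (rule eq_matI) auto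

lemma coeff_det_rows:
  "coeff_det ps = det (mat\<^sub>r (length ps) (length ps) (\<lambda>i. vec (length ps) (coeff (ps ! i))))"
  unfolding coeff_det_def by (subst mat_as_mat_of_rows[symmetric]) simp

lemma coeff_det_Nil [simp]: "coeff_det [] = 1"
  by (simp add: coeff_det_def)

lemma coeff_det_add:
  "coeff_det (xs @ (p + q) # ys) = coeff_det (xs @ p # ys) + coeff_det (xs @ q # ys)"
proof -
  define n where "n = length xs + Suc (length ys)"
  define k where "k = length xs"
  define c where "c i = vec n (coeff ((xs @ 0 # ys) ! i))" for i
  define a where "a (i::nat) = vec n (coeff p)" for i
  define b where "b (i::nat) = vec n (coeff q)" for i
  have *: "coeff_det (xs @ r # ys) =
      det (mat\<^sub>r n n (\<lambda>i. if i = k then vec n (coeff r) else c i))" for r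
    unfolding coeff_det_rows
    by (auto intro!: arg_cong[where f = det] eq_matI simp: n_def k_def c_def
        nth_append nth_Cons split: nat.splits)
  have "det (mat\<^sub>r n n (\<lambda>i. if i = k then a i + b i else c i)) =
    det(mat\<^sub>r n n (\<lambda> i. if i = k then a i else c i)) +
    det(mat\<^sub>r n n (\<lambda> i. if i = k then b i else c i))"
    by (rule det_row_add) (auto simp: a_def b_def c_def k_def n_def)
  moreover have "a i + b i = vec n (coeff (p + q))" for i
    by (auto simp: a_def b_def)
  ultimately show ?thesis unfolding * by (simp only: a_def b_def)
qed

lemma coeff_det_smult:
  "coeff_det (xs @ smult c p # ys) = c * coeff_det (xs @ p # ys)"
proof -
  let ?n = "length xs + Suc (length ys)"
  let ?M = "mat ?n ?n (\<lambda>(i, j). coeff ((xs @ p # ys) ! i) j)"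
  have "mat ?n ?n (\<lambda>(i, j). coeff ((xs @ smult c p # ys) ! i) j) = multrow (length xs) c ?M"
    by (rule eq_matI) (auto simp: nth_append nth_Cons split: nat.splits)
  then show ?thesis
    unfolding coeff_det_def by (simp add: det_multrow[where n = ?n])
qed

lemma coeff_det_zero: "coeff_det (xs @ 0 # ys) = 0"
  using coeff_det_smult[of xs 0 0 ys] by simp

lemma coeff_det_repeat:
  assumes "p \<in> set xs \<or> p \<in> set ys"
  shows "coeff_det (xs @ p # ys) = 0"
proof -
  let ?l = "xs @ p # ys"
  obtain j where j: "j < length ?l" "j \<noteq> length xs" "?l ! j = p"
  proof (cases "p \<in> set xs")
    case True
    then obtain j where "j < length xs" "xs ! j = p" by (auto simp: in_set_conv_nth)
    then show ?thesis using that[of j] by (auto simp: nth_append)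
  next
    case False
    then obtain j where "j < length ys" "ys ! j = p" using assms by (auto simp: in_set_conv_nth)
    then show ?thesis using that[of "Suc (length xs + j)"] by (auto simp: nth_append)
  qed
  show ?thesis
    unfolding coeff_det_def
  proof (rule det_identical_rows[of _ "length ?l" j "length xs"])
    show "row (mat (length ?l) (length ?l) (\<lambda>(i, j). coeff (?l ! i) j)) j =
        row (mat (length ?l) (length ?l) (\<lambda>(i, j). coeff (?l ! i) j)) (length xs)"
      using j by (intro eq_vecI) auto
  qed (use j in auto)
qed

lemma coeff_det_dependent:
  assumes "\<And>i. i \<in> I \<Longrightarrow> f i \<in> set xs \<union> set ys"
  shows "coeff_det (xs @ (\<Sum>i\<in>I. smult (c i) (f i)) # ys) = 0"
  using assms
proof (induction I rule: infinite_finite_induct)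
  case (insert i I)
  then show ?case
    by (simp add: coeff_det_add coeff_det_smult coeff_det_repeat)
qed (simp_all add: coeff_det_zero)

lemma coeff_det_add_dependent:
  assumes "\<And>i. i \<in> I \<Longrightarrow> f i \<in> set xs \<union> set ys"
  shows "coeff_det (xs @ (p + (\<Sum>i\<in>I. smult (c i) (f i))) # ys) = coeff_det (xs @ p # ys)"
  unfolding coeff_det_add by (subst coeff_det_dependent) (use assms in auto)

text \<open>
  The new members of the middle block differ from the old ones by multiples of members of the
  outer blocks, so that the replacements can be carried out one after the other.
\<close>

lemma coeff_det_replace:
  assumes "length ys = length ys'"
    and "\<And>i. i < length ys \<Longrightarrow> ys' ! i = ys ! i \<or>
      (\<exists>c. \<exists>e \<in> set xs \<union> set zs. ys' ! i = ys ! i + smult c e)"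
  shows "coeff_det (xs @ ys' @ zs) = coeff_det (xs @ ys @ zs)"
  using assms
proof (induction ys ys' arbitrary: xs rule: list_induct2)
  case (Cons y ys y' ys')
  have "coeff_det (xs @ (y' # ys') @ zs) = coeff_det ((xs @ [y']) @ ys' @ zs)"
    by simp
  also have "\<dots> = coeff_det ((xs @ [y']) @ ys @ zs)"
    by (rule Cons.IH) (use Cons.prems[of "Suc i" for i] in fastforce)
  also have "\<dots> = coeff_det (xs @ y' # (ys @ zs))"
    by simp
  also have "\<dots> = coeff_det (xs @ y # (ys @ zs))"
  proof -
    consider "y' = y" | c e where "e \<in> set xs \<union> set zs" "y' = y + smult c e"
      using Cons.prems[of 0] by auto
    then show ?thesis
    proof cases
      case 2
      then show ?thesis
        by (auto simp: coeff_det_add coeff_det_smult coeff_det_repeat)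
    qed simp
  qed
  finally show ?case by simp
qed simp

lemma coeff_det_swap: "coeff_det (xs @ p # q # ys) = - coeff_det (xs @ q # p # ys)"
proof -
  \<comment> \<open>Expand a determinant in which p + q occurs twice.\<close>
  have "0 = coeff_det (xs @ (p + q) # (p + q) # ys)"
    by (simp add: coeff_det_repeat)
  then have "coeff_det (xs @ p # (p + q) # ys) + coeff_det (xs @ q # (p + q) # ys) = 0"
    by (simp only: coeff_det_add)
  moreover have "coeff_det (xs @ r # (p + q) # ys) =
      coeff_det (xs @ r # p # ys) + coeff_det (xs @ r # q # ys)" for r
    using coeff_det_add[of "xs @ [r]" p q ys] by simp
  moreover have "coeff_det (xs @ p # p # ys) = 0" "coeff_det (xs @ q # q # ys) = 0"
    by (simp_all add: coeff_det_repeat)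
  ultimately show ?thesis
    by (simp add: eq_neg_iff_add_eq_0)
qed

lemma coeff_det_move: "coeff_det (xs @ p # ys @ zs) = (-1) ^ length ys * coeff_det (xs @ ys @ p # zs)"
proof (induction ys arbitrary: xs)
  case (Cons y ys)
  have "coeff_det (xs @ p # (y # ys) @ zs) = - coeff_det (xs @ y # p # ys @ zs)"
    using coeff_det_swap[of xs p y "ys @ zs"] by simp
  also have "coeff_det (xs @ y # p # ys @ zs) = coeff_det ((xs @ [y]) @ p # ys @ zs)" by simp
  finally show ?case by (simp only: Cons.IH) simp
qed simp

lemma coeff_det_swap_blocks:
  "coeff_det (xs @ ys @ zs @ ws) = (-1) ^ (length ys * length zs) * coeff_det (xs @ zs @ ys @ ws)"
proof (induction ys arbitrary: xs)
  case (Cons y ys)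
  have "coeff_det (xs @ (y # ys) @ zs @ ws) = coeff_det ((xs @ [y]) @ ys @ zs @ ws)" by simp
  also have "\<dots> = (-1) ^ (length ys * length zs) * coeff_det (xs @ y # zs @ ys @ ws)"
    by (simp only: Cons.IH) simp
  also have "\<dots> = (-1) ^ (length ys * length zs) * ((-1) ^ length zs * coeff_det (xs @ zs @ y # ys @ ws))"
    by (simp only: coeff_det_move)
  finally show ?case by (simp add: power_add algebra_simps)
qed simp

lemma coeff_det_rev:
  "coeff_det (xs @ rev ys @ zs) = (-1) ^ (length ys choose 2) * coeff_det (xs @ ys @ zs)"
proof (induction ys arbitrary: xs zs)
  case (Cons y ys)
  have "coeff_det (xs @ rev (y # ys) @ zs) = coeff_det (xs @ rev ys @ (y # zs))" by simp
  also have "\<dots> = (-1) ^ (length ys choose 2) * coeff_det (xs @ ys @ y # zs)"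
    by (rule Cons.IH)
  also have "coeff_det (xs @ ys @ y # zs) = (-1) ^ length ys * coeff_det (xs @ y # ys @ zs)"
    by (simp add: coeff_det_move flip: power_add)
  finally show ?case by (simp add: numeral_2_eq_2 power_add algebra_simps)
qed (simp add: numeral_2_eq_2)

lemma coeff_det_smult_map:
  "coeff_det (xs @ map (smult c) ys @ zs) = c ^ length ys * coeff_det (xs @ ys @ zs)"
proof (induction ys arbitrary: xs)
  case (Cons y ys)
  have "coeff_det (xs @ map (smult c) (y # ys) @ zs) = c * coeff_det ((xs @ [y]) @ map (smult c) ys @ zs)"
    by (simp add: coeff_det_smult)
  then show ?case by (simp only: Cons.IH) simp
qed simp

lemma det_unitriangular_lower:
  assumes "\<And>i j. i < j \<Longrightarrow> j < n \<Longrightarrow> f i j = 0" and "\<And>i. i < n \<Longrightarrow> f i i = 1"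
  shows "det (mat n n (\<lambda>(i, j). f i j)) = (1 :: 'a :: comm_ring_1)"
proof -
  have "det (mat n n (\<lambda>(i, j). f i j)) = prod_list (diag_mat (mat n n (\<lambda>(i, j). f i j)))"
    by (rule det_lower_triangular[where n = n]) (use assms in auto)
  also have "diag_mat (mat n n (\<lambda>(i, j). f i j)) = map (\<lambda>_. 1) [0..<n]"
    by (auto simp: diag_mat_def assms)
  also have "prod_list (map (\<lambda>_. 1 :: 'a) [0..<n]) = 1"
    by (induction n) auto
  finally show ?thesis .
qed

lemma coeff_det_monic:
  assumes "\<And>i. i < n \<Longrightarrow> degree (f i) = i \<and> coeff (f i) i = 1"
  shows "coeff_det (map f [0..<n]) = 1"
proof -
  have "coeff_det (map f [0..<n]) = det (mat n n (\<lambda>(i, j). coeff (f i) j))"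
    by (auto simp: coeff_det_def intro!: arg_cong[where f = det] eq_matI)
  also have "\<dots> = 1"
    by (rule det_unitriangular_lower) (use assms in \<open>auto intro!: coeff_eq_0\<close>)
  finally show ?thesis .
qed

lemma coeff_det_mult_matrix:
  assumes "length ps = m" and "length bs = m"
    and "\<And>i j. i < m \<Longrightarrow> j < m \<Longrightarrow> coeff (ps ! i) j = (\<Sum>k<m. T i k * coeff (bs ! k) j)"
  shows "coeff_det ps = det (mat m m (\<lambda>(i, j). T i j)) * coeff_det bs"
proof -
  have "mat m m (\<lambda>(i, j). coeff (ps ! i) j) =
      mat m m (\<lambda>(i, j). T i j) * mat m m (\<lambda>(i, j). coeff (bs ! i) j)"
    by (rule eq_matI) (auto simp: assms scalar_prod_def lessThan_atLeast0 intro!: sum.cong)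
  then show ?thesis
    unfolding coeff_det_def by (simp add: assms det_mult[of _ m])
qed

text \<open>
  Multiplication by f acts on truncated coefficient vectors by a triangular Toeplitz matrix whose
  diagonal is the constant coefficient of f.
\<close>

lemma coeff_det_mult_poly:
  "coeff_det (map ((*) f) ps) = coeff f 0 ^ length ps * coeff_det ps"
proof -
  define m where "m = length ps"
  let ?P = "mat m m (\<lambda>(i, j). coeff (ps ! i) j)"
  let ?F = "mat m m (\<lambda>(i, j). if i \<le> j then coeff f (j - i) else 0)"
  have F: "det ?F = coeff f 0 ^ m"
  proof -
    have "det ?F = prod_list (diag_mat ?F)"
      by (rule det_upper_triangular[of _ m]) auto
    also have "diag_mat ?F = map (\<lambda>_. coeff f 0) [0..<m]"
      by (auto simp: diag_mat_def)
    also have "prod_list \<dots> = coeff f 0 ^ m"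
      by (induction m) auto
    finally show ?thesis .
  qed
  have "mat m m (\<lambda>(i, j). coeff (map ((*) f) ps ! i) j) = ?P * ?F"
  proof (rule eq_matI)
    fix i j assume "i < dim_row (?P * ?F)" "j < dim_col (?P * ?F)"
    then have ij: "i < m" "j < m" by auto
    have "coeff (f * ps ! i) j = (\<Sum>k\<le>j. coeff (ps ! i) k * coeff f (j - k))"
      by (subst mult.commute) (rule coeff_mult)
    also have "\<dots> = (\<Sum>k\<in>{0..<m}. coeff (ps ! i) k * (if k \<le> j then coeff f (j - k) else 0))"
      by (rule sum.mono_neutral_cong_left) (use ij in auto)
    finally show "mat m m (\<lambda>(i, j). coeff (map ((*) f) ps ! i) j) $$ (i, j) = (?P * ?F) $$ (i, j)"
      using ij by (simp add: scalar_prod_def m_def)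
  qed auto
  then show ?thesis
    unfolding coeff_det_def using F by (simp add: det_mult[of _ m] flip: m_def)
qed

lemma det_block_lower_left_zero:
  fixes T :: "nat \<Rightarrow> nat \<Rightarrow> 'a :: idom"
  assumes "\<And>i j. e \<le> i \<Longrightarrow> i < e + m \<Longrightarrow> j < e \<Longrightarrow> T i j = 0"
  shows "det (mat (e + m) (e + m) (\<lambda>(i, j). T i j)) =
    det (mat e e (\<lambda>(i, j). T i j)) * det (mat m m (\<lambda>(i, j). T (e + i) (e + j)))"
proof -
  have "mat (e + m) (e + m) (\<lambda>(i, j). T i j) =
      four_block_mat (mat e e (\<lambda>(i, j). T i j)) (mat e m (\<lambda>(i, j). T i (e + j)))
        (0\<^sub>m m e) (mat m m (\<lambda>(i, j). T (e + i) (e + j)))"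
    by (rule eq_matI) (use assms in auto)
  then show ?thesis
    by (simp add: det_four_block_mat_lower_left_zero[of _ e _ m])
qed

lemma poly_eq_sum_monom:
  fixes p :: "'a :: comm_ring_1 poly"
  assumes "\<And>j. n \<le> j \<Longrightarrow> coeff p j = 0"
  shows "p = (\<Sum>k<n. smult (coeff p k) (monom 1 k))"
proof (rule poly_eqI)
  fix j
  show "coeff p j = coeff (\<Sum>k<n. smult (coeff p k) (monom 1 k)) j"
    using assms[of j] by (cases "j < n") (auto simp: coeff_sum if_distrib[of "(*) _"] cong: if_cong)
qed

text \<open>
  For monic v the polynomials 1, y, ..., y^(e-1), v, v y, v y^2, ... form a basis that is
  unitriangular over the monomials. In this basis the members r + v g have their remainders r in the
  first e coordinates, where multiples of v have zeros.
\<close>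

lemma coeff_det_split:
  assumes v: "degree v = e" "coeff v e = 1"
    and len: "length rs = e" "length gs = e" "length ks = m"
    and rs: "\<And>i. i < e \<Longrightarrow> degree (rs ! i) < e"
    and gs: "\<And>i j. i < e \<Longrightarrow> m \<le> j \<Longrightarrow> coeff (gs ! i) j = 0"
    and ks: "\<And>i j. i < m \<Longrightarrow> m \<le> j \<Longrightarrow> coeff (ks ! i) j = 0"
  shows "coeff_det (map2 (\<lambda>r g. r + v * g) rs gs @ map ((*) v) ks) = coeff_det rs * coeff_det ks"
proof -
  define b where "b k = (if k < e then monom 1 k else v * monom 1 (k - e))" for k :: nat
  define T where "T i k = (if i < e then if k < e then coeff (rs ! i) k else coeff (gs ! i) (k - e)
      else if k < e then 0 else coeff (ks ! (i - e)) (k - e))" for i k :: nat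
  let ?ps = "map2 (\<lambda>r g. r + v * g) rs gs @ map ((*) v) ks"
  have v0: "v \<noteq> 0" using v by auto
  have vmul: "v * g = (\<Sum>k=e..<e + m. smult (coeff g (k - e)) (b k))"
    if "\<And>j. m \<le> j \<Longrightarrow> coeff g j = 0" for g
  proof -
    have "v * g = v * (\<Sum>k<m. smult (coeff g k) (monom 1 k))"
      by (rule arg_cong[where f = "(*) v"], rule poly_eq_sum_monom, rule that)
    also have "\<dots> = (\<Sum>k<m. smult (coeff g k) (b (k + e)))"
      by (simp add: sum_distrib_left b_def)
    also have "\<dots> = (\<Sum>k=e..<e + m. smult (coeff g (k - e)) (b k))"
      using sum.shift_bounds_nat_ivl[of "\<lambda>k. smult (coeff g (k - e)) (b k)" 0 e m]
      by (simp add: lessThan_atLeast0 add.commute)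
    finally show ?thesis .
  qed
  have split: "(\<Sum>k<e + m. h k) = (\<Sum>k<e. h k) + (\<Sum>k=e..<e + m. h k)" for h :: "nat \<Rightarrow> 'a poly"
    by (simp add: lessThan_atLeast0 sum.atLeastLessThan_concat)
  have row: "?ps ! i = (\<Sum>k<e + m. smult (T i k) (b k))" if i: "i < e + m" for i
  proof (cases "i < e")
    case True
    have "rs ! i = (\<Sum>k<e. smult (coeff (rs ! i) k) (monom 1 k))"
      by (rule poly_eq_sum_monom) (use rs[OF True] in \<open>auto intro!: coeff_eq_0\<close>)
    also have "\<dots> = (\<Sum>k<e. smult (T i k) (b k))"
      using True by (auto simp: T_def b_def)
    finally have 1: "rs ! i = (\<Sum>k<e. smult (T i k) (b k))" .
    have "v * gs ! i = (\<Sum>k=e..<e + m. smult (T i k) (b k))"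
      by (subst vmul) (use gs[OF True] True in \<open>auto simp: T_def\<close>)
    with 1 show ?thesis
      using True len by (simp add: split nth_append)
  next
    case False
    have "v * ks ! (i - e) = (\<Sum>k=e..<e + m. smult (T i k) (b k))"
      by (subst vmul) (use ks False i in \<open>auto simp: T_def\<close>)
    moreover have "(\<Sum>k<e. smult (T i k) (b k)) = 0"
      using False by (auto simp: T_def)
    ultimately show ?thesis
      using False len i by (simp add: split nth_append)
  qed
  have deg: "degree (b k) = k \<and> coeff (b k) k = 1" for k
    using v v0 coeff_mult_degree_sum[of v "monom 1 (k - e)"]
    by (auto simp: b_def degree_monom_eq degree_mult_eq monom_eq_0_iff)
  have "coeff_det ?ps = det (mat (e + m) (e + m) (\<lambda>(i, j). T i j)) * coeff_det (map b [0..<e + m])"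
    by (rule coeff_det_mult_matrix) (use len in \<open>auto simp: row coeff_sum\<close>)
  also have "coeff_det (map b [0..<e + m]) = 1"
    by (rule coeff_det_monic) (rule deg)
  also have "det (mat (e + m) (e + m) (\<lambda>(i, j). T i j)) =
      det (mat e e (\<lambda>(i, j). T i j)) * det (mat m m (\<lambda>(i, j). T (e + i) (e + j)))"
    by (rule det_block_lower_left_zero) (auto simp: T_def)
  also have "mat e e (\<lambda>(i, j). T i j) = mat (length rs) (length rs) (\<lambda>(i, j). coeff (rs ! i) j)"
    by (rule eq_matI) (auto simp: T_def len)
  also have "mat m m (\<lambda>(i, j). T (e + i) (e + j)) = mat (length ks) (length ks) (\<lambda>(i, j). coeff (ks ! i) j)"
    by (rule eq_matI) (auto simp: T_def len)
  finally show ?thesis by (simp add: coeff_det_def)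
qed

section \<open>Determinants modulo a polynomial\<close>

lemma poly_mod_mult:
  fixes p v w :: "'a::field poly"
  assumes "v \<noteq> 0" "w \<noteq> 0"
  shows "p mod (w * v) = p mod v + v * (p div v mod w)"
proof -
  have "p = w * v * (p div v div w) + (p mod v + v * (p div v mod w))"
  proof -
    have "p = v * (p div v) + p mod v" by simp
    also have "p div v = w * (p div v div w) + p div v mod w" by simp
    finally show ?thesis by (simp only: algebra_simps)
  qed
  from arg_cong[OF this, of "\<lambda>p. p mod (w * v)"]
  have "p mod (w * v) = (w * v * (p div v div w) + (p mod v + v * (p div v mod w))) mod (w * v)" .
  also have "\<dots> = (p mod v + v * (p div v mod w)) mod (w * v)"
    by (rule mod_mult_self4)
  also have "\<dots> = p mod v + v * (p div v mod w)"
  proof (cases "p mod v + v * (p div v mod w) = 0")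
    case False
    have "degree (p mod v) < degree v \<or> p mod v = 0"
      using degree_mod_less[OF assms(1), of p] by auto
    moreover have "degree (v * (p div v mod w)) < degree (w * v) \<or> p div v mod w = 0"
      using degree_mod_less[OF assms(2), of "p div v"] assms
      by (cases "p div v mod w = 0") (auto simp: degree_mult_eq)
    moreover have "degree v \<le> degree (w * v)"
      using assms by (simp add: degree_mult_eq)
    ultimately have "degree (p mod v + v * (p div v mod w)) < degree (w * v)"
      using False by (auto intro: degree_add_less)
    then show ?thesis by (rule mod_poly_less)
  qed simp
  finally show ?thesis .
qed

lemma coeff_mod_monom:
  fixes p :: "'a::field poly"
  assumes "j < t"
  shows "coeff (p mod monom 1 t) j = coeff p j"
proof -
  have "coeff p j = coeff (monom 1 t * (p div monom 1 t) + p mod monom 1 t) j"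
    by simp
  then show ?thesis
    unfolding coeff_add coeff_monom_mult using assms by simp
qed

lemma coeff_det_cong:
  assumes "length ps = length qs"
    and "\<And>i j. i < length qs \<Longrightarrow> j < length qs \<Longrightarrow> coeff (ps ! i) j = coeff (qs ! i) j"
  shows "coeff_det ps = coeff_det qs"
  unfolding coeff_det_def by (intro arg_cong[where f = det] eq_matI) (auto simp: assms)

lemma coeff_mod_eq_0:
  fixes p v :: "'a::field poly"
  assumes "degree v = e" "v \<noteq> 0" "e \<le> j"
  shows "coeff (p mod v) j = 0"
  using degree_mod_less[OF assms(2), of p] assms by (auto intro: coeff_eq_0)

text \<open>
  As in the Chinese remainder theorem: modulo y^t v, a multiple of v is known as soon as its quotient by v
  is known modulo y^t, and these multiples do not interfere with the residues modulo v of the other members.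
\<close>

lemma coeff_det_mod_split:
  fixes v :: "'a::field poly"
  assumes v: "degree v = e" "coeff v e = 1" and len: "length es = e" "length ks = t"
  shows "coeff_det (map (\<lambda>p. p mod (monom 1 t * v)) (es @ map ((*) v) ks)) =
    coeff_det (map (\<lambda>p. p mod v) es) * coeff_det ks"
proof -
  have v0: "v \<noteq> 0" using v by auto
  let ?m = "monom (1::'a) t"
  have es: "map (\<lambda>p. p mod (?m * v)) es =
      map2 (\<lambda>r g. r + v * g) (map (\<lambda>p. p mod v) es) (map (\<lambda>p. p div v mod ?m) es)"
    by (rule nth_equalityI) (simp_all add: poly_mod_mult v0)
  have ks: "map (\<lambda>p. p mod (?m * v)) (map ((*) v) ks) = map ((*) v) (map (\<lambda>p. p mod ?m) ks)"
    by (simp add: mult.commute[of ?m] flip: mult_mod_right)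
  have "coeff_det (map (\<lambda>p. p mod (?m * v)) (es @ map ((*) v) ks)) =
      coeff_det (map (\<lambda>p. p mod v) es) * coeff_det (map (\<lambda>p. p mod ?m) ks)"
    unfolding map_append es ks
  proof (rule coeff_det_split[OF v])
    show "degree (map (\<lambda>p. p mod v) es ! i) < e" if "i < e" for i
      using degree_mod_less[OF v0, of "es ! i"] that len v by auto
  qed (auto simp: len degree_monom_eq monom_eq_0_iff intro!: coeff_mod_eq_0)
  also have "coeff_det (map (\<lambda>p. p mod ?m) ks) = coeff_det ks"
    by (rule coeff_det_cong) (auto simp: len coeff_mod_monom)
  finally show ?thesis .
qed

lemma degree_eq_div_add:
  fixes q w :: "'a::field poly"
  assumes "q \<noteq> 0" "w div q \<noteq> 0"
  shows "degree w = degree q + degree (w div q)"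
proof -
  have "degree (q * (w div q)) = degree q + degree (w div q)"
    using assms by (simp add: degree_mult_eq)
  moreover have "degree (w mod q) < degree q \<or> w mod q = 0"
    using degree_mod_less[OF assms(1), of w] by auto
  ultimately have "degree (q * (w div q) + w mod q) = degree q + degree (w div q)"
    by (metis add.right_neutral degree_add_eq_left trans_less_add1)
  then show ?thesis by simp
qed

abbreviation shifts :: "'a::field poly \<Rightarrow> nat \<Rightarrow> 'a poly list" where
  "shifts f a \<equiv> map (\<lambda>k. f * monom 1 k) [0..<a]"

text \<open>
  The multiples q y^k account for the part of the space that is divisible by q, and the
  determinant of the remaining d = degree q polynomials may be taken modulo q.
\<close>

lemma coeff_det_multiples:
  fixes q :: "'a::field poly"
  assumes q: "degree q = d" "coeff q d = 1" and len: "length ws = d"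
    and ws: "\<And>w. w \<in> set ws \<Longrightarrow> degree w < n + d"
  shows "coeff_det (shifts q n @ ws) =
    (-1) ^ (n * d) * coeff_det (map (\<lambda>p. p mod q) ws)"
proof -
  have q0: "q \<noteq> 0" using q by auto
  let ?ks = "map (\<lambda>k. monom (1::'a) k) [0..<n]"
  have "coeff_det (shifts q n @ ws) =
      (-1) ^ (n * d) * coeff_det (ws @ shifts q n)"
    using coeff_det_swap_blocks[of "[]" "shifts q n" ws "[]"] len by simp
  also have "ws @ shifts q n =
      map2 (\<lambda>r g. r + q * g) (map (\<lambda>p. p mod q) ws) (map (\<lambda>p. p div q) ws) @ map ((*) q) ?ks"
    by (auto intro!: nth_equalityI)
  also have "coeff_det \<dots> = coeff_det (map (\<lambda>p. p mod q) ws) * coeff_det ?ks"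
  proof (rule coeff_det_split[OF q])
    show "degree (map (\<lambda>p. p mod q) ws ! i) < d" if "i < d" for i
      using degree_mod_less[OF q0, of "ws ! i"] that len q by auto
  next
    fix i j assume i: "i < d" and "n \<le> j"
    then have "degree (ws ! i div q) < n \<or> ws ! i div q = 0"
      using ws[of "ws ! i"] len q degree_eq_div_add[OF q0, of "ws ! i"] by force
    then show "coeff (map (\<lambda>p. p div q) ws ! i) j = 0"
      using i len \<open>n \<le> j\<close> by (auto intro: coeff_eq_0)
  qed (auto simp: len)
  also have "coeff_det ?ks = 1"
    by (rule coeff_det_monic) (simp add: degree_monom_eq)
  finally show ?thesis by simp
qed

lemma coeff_det_pCons:
  "coeff_det (g # map (pCons 0) hs) = coeff g 0 * coeff_det hs"
proof -
  let ?T = "\<lambda>i j. coeff ((g # map (pCons 0) hs) ! i) j"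
  have "coeff_det (g # map (pCons 0) hs) = det (mat (1 + length hs) (1 + length hs) (\<lambda>(i, j). ?T i j))"
    by (simp add: coeff_det_def)
  also have "\<dots> = det (mat 1 1 (\<lambda>(i, j). ?T i j)) * 
      det (mat (length hs) (length hs) (\<lambda>(i, j). ?T (1 + i) (1 + j)))"
    by (rule det_block_lower_left_zero) (auto simp: nth_Cons split: nat.splits)
  also have "det (mat 1 1 (\<lambda>(i, j). ?T i j)) = coeff g 0"
    by (subst det_single) auto
  also have "mat (length hs) (length hs) (\<lambda>(i, j). ?T (1 + i) (1 + j)) =
      mat (length hs) (length hs) (\<lambda>(i, j). coeff (hs ! i) j)"
    by (rule eq_matI) auto
  finally show ?thesis by (simp add: coeff_det_def)
qed

lemma coeff_det_monic_multiples:
  assumes "\<And>i. i < a \<Longrightarrow> degree (m i) = i \<and> coeff (m i) i = 1"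
  shows "coeff_det (xs @ map (\<lambda>i. f * m i) [0..<a] @ zs) =
    coeff_det (xs @ shifts f a @ zs)"
  using assms
proof (induction a arbitrary: zs)
  case (Suc a)
  let ?xs = "xs @ shifts f a"
  have "m a = monom 1 a + (\<Sum>k<a. smult (coeff (m a) k) (monom 1 k))"
    using poly_eq_sum_monom[of "Suc a" "m a"] Suc.prems[of a] by (simp add: coeff_eq_0 add.commute)
  from arg_cong[OF this, of "(*) f"]
  have m: "f * m a = f * monom 1 a + (\<Sum>k<a. smult (coeff (m a) k) (f * monom 1 k))"
    by (simp only: distrib_left sum_distrib_left mult_smult_right)
  have "coeff_det (xs @ map (\<lambda>i. f * m i) [0..<Suc a] @ zs) =
      coeff_det (xs @ map (\<lambda>i. f * m i) [0..<a] @ (f * m a # zs))"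
    by simp
  also have "\<dots> = coeff_det (xs @ shifts f a @ (f * m a # zs))"
    by (rule Suc.IH) (use Suc.prems in auto)
  also have "\<dots> = coeff_det (?xs @ f * m a # zs)"
    by simp
  also have "\<dots> = coeff_det (?xs @ f * monom 1 a # zs)"
    unfolding m by (rule coeff_det_add_dependent) auto
  finally show ?case by simp
qed simp

section \<open>Minors of Sylvester type\<close>

text \<open>
  The leading (a + b)-square minor of a Sylvester matrix: the coefficients are listed from the lowest
  degree upwards and cut off at y^(a + b), so f and g may be of any degree.
\<close>

definition sylvester_det :: "'a::field poly \<Rightarrow> 'a poly \<Rightarrow> nat \<Rightarrow> nat \<Rightarrow> 'a" where
  "sylvester_det f g a b =
    coeff_det (shifts f a @ shifts g b)"

lemma sylvester_det_one_add:
  "sylvester_det f (g + h) a 1 = sylvester_det f g a 1 + sylvester_det f h a 1"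
  using coeff_det_add[of "shifts f a" g h "[]"]
  by (simp add: sylvester_det_def monom_0)

text \<open>
  Dividing all rows by f leaves the monomials 1, ..., y^(a-1) and h.
\<close>

lemma sylvester_det_one_multiple:
  "sylvester_det f (f * h) a 1 = coeff f 0 ^ Suc a * coeff h a"
proof -
  let ?l = "map (monom 1) [0..<a] @ [h]"
  have "sylvester_det f (f * h) a 1 = coeff_det (map ((*) f) ?l)"
    by (simp add: sylvester_det_def monom_0 comp_def)
  also have "\<dots> = coeff f 0 ^ Suc a * coeff_det ?l"
    by (simp only: coeff_det_mult_poly) simp
  also have "coeff_det ?l = coeff_det (map (monom 1) [0..<a] @ [monom (coeff h a) a])"
  proof -
    have "coeff_det (map (monom 1) [0..<a] @ [h]) = coeff_det (map (monom 1) [0..<a] @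
        (monom (coeff h a) a + (\<Sum>k<a. smult (coeff h k) (monom 1 k))) # [])"
      by (rule coeff_det_cong)
        (auto simp: nth_append coeff_sum less_Suc_eq if_distrib[of "(*) _"] cong: if_cong)
    also have "\<dots> = coeff_det (map (monom 1) [0..<a] @ monom (coeff h a) a # [])"
      by (rule coeff_det_add_dependent) auto
    finally show ?thesis by simp
  qed
  also have "\<dots> = coeff h a * coeff_det (map (monom 1) [0..<Suc a])"
    using coeff_det_smult[of "map (monom 1) [0..<a]" "coeff h a" "monom 1 a" "[]"]
    by (simp add: smult_monom)
  also have "coeff_det (map (monom (1::'a)) [0..<Suc a]) = 1"
    by (rule coeff_det_monic) (simp add: degree_monom_eq)
  finally show ?thesis by simp
qed

lemma sylvester_det_swap: "sylvester_det f g a b = (-1) ^ (a * b) * sylvester_det g f b a"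
  using coeff_det_swap_blocks[of "[]" "shifts f a" "shifts g b" "[]"]
  by (simp add: sylvester_det_def)

lemma sylvester_det_add_left:
  assumes "b \<le> a"
  shows "sylvester_det f (g + smult c f) a b = sylvester_det f g a b"
proof -
  have "coeff_det (shifts f a @ shifts (g + smult c f) b @ []) =
      coeff_det (shifts f a @ shifts g b @ [])"
    by (rule coeff_det_replace) (use assms in \<open>auto simp: algebra_simps intro!: exI[of _ c]\<close>)
  then show ?thesis by (simp add: sylvester_det_def)
qed

lemma sylvester_det_difference:
  assumes "b \<le> a"
  shows "sylvester_det f g a b = (-1) ^ (a * b) * sylvester_det (g - f) f b a"
  using sylvester_det_add_left[OF assms, of f "g - f" 1] sylvester_det_swap[of f "g - f" a b] by simp

lemma sylvester_det_zero_right: "sylvester_det f g a 0 = coeff f 0 ^ a"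
proof -
  have "sylvester_det f g a 0 = coeff_det (map ((*) f) (map (monom 1) [0..<a]))"
    by (simp add: sylvester_det_def comp_def)
  also have "\<dots> = coeff f 0 ^ a * coeff_det (map (monom 1) [0..<a])"
    by (simp only: coeff_det_mult_poly) simp
  also have "coeff_det (map (monom (1::'a)) [0..<a]) = 1"
    by (rule coeff_det_monic) (simp add: degree_monom_eq)
  finally show ?thesis by simp
qed

section \<open>Chebyshev polynomials with integer index\<close>

text \<open>
  The recurrence of the sequences w^k and w^(-k) when y = w + 1/w - 2. Letting the index
  range over all integers makes reflections of the index available, and every product
  formula below follows by comparing two solutions at two consecutive indices.
\<close>

definition cheb_recurrence :: "(int \<Rightarrow> rat poly) \<Rightarrow> bool" where
  "cheb_recurrence f \<longleftrightarrow> (\<forall>k. f (k + 1) = [:2, 1:] * f k - f (k - 1))"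

lemma cheb_recurrence_unique:
  assumes f: "cheb_recurrence f" and g: "cheb_recurrence g"
    and base: "f k0 = g k0" "f (k0 - 1) = g (k0 - 1)"
  shows "f k = g k"
proof -
  have fr: "f (k + 1) = [:2, 1:] * f k - f (k - 1)" and gr: "g (k + 1) = [:2, 1:] * g k - g (k - 1)" for k
    using f g unfolding cheb_recurrence_def by blast+
  have "f k = g k \<and> f (k - 1) = g (k - 1)"
  proof (induction k rule: int_induct[of _ k0])
    case base
    then show ?case using assms by simp
  next
    case (step1 k)
    then show ?case using fr[of k] gr[of k] by simp
  next
    case (step2 k)
    have "f (k - 1 - 1) = [:2, 1:] * f (k - 1) - f k"
      using fr[of "k - 1"] by (simp add: algebra_simps)
    moreover have "g (k - 1 - 1) = [:2, 1:] * g (k - 1) - g k"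
      using gr[of "k - 1"] by (simp add: algebra_simps)
    ultimately show ?case using step2 by simp
  qed
  then show ?thesis ..
qed

fun cheb_nat :: "nat \<Rightarrow> rat poly" where
  "cheb_nat 0 = 0"
| "cheb_nat (Suc 0) = 1"
| "cheb_nat (Suc (Suc m)) = [:2, 1:] * cheb_nat (Suc m) - cheb_nat m"

text \<open>
  With y = w + 1/w - 2 the four families are
  S_k = (w^k - w^(-k)) / (w - 1/w),
  V_k = (w^(k+1/2) + w^(-k-1/2)) / (w^(1/2) + w^(-1/2)),
  W_k = (w^(k+1/2) - w^(-k-1/2)) / (w^(1/2) - w^(-1/2)) and
  T_k = w^k + w^(-k). These are the Chebyshev polynomials of the second (with the index shifted by
  one), third, fourth and first kind (doubled) in the variable 1 + y/2.
\<close>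

definition cheb_S :: "int \<Rightarrow> rat poly" where
  "cheb_S k = (if k \<ge> 0 then cheb_nat (nat k) else - cheb_nat (nat (- k)))"

definition cheb_V :: "int \<Rightarrow> rat poly" where
  "cheb_V k = cheb_S (k + 1) - cheb_S k"

definition cheb_W :: "int \<Rightarrow> rat poly" where
  "cheb_W k = cheb_S (k + 1) + cheb_S k"

definition cheb_T :: "int \<Rightarrow> rat poly" where
  "cheb_T k = cheb_S (k + 1) - cheb_S (k - 1)"

lemma cheb_S_simps [simp]: "cheb_S 0 = 0" "cheb_S 1 = 1" "cheb_S (-1) = -1"
  by (simp_all add: cheb_S_def)

lemma cheb_S_uminus: "cheb_S (- k) = - cheb_S k"
  by (simp add: cheb_S_def)

lemma cheb_S_rec: "cheb_S (k + 1) = [:2, 1:] * cheb_S k - cheb_S (k - 1)"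
proof -
  consider "k = 0" | m where "k = int (Suc m)" | m where "k = - int (Suc m)"
    by (metis int_cases3 Suc_pred of_nat_0_less_iff)
  then show ?thesis
  proof cases
    case (2 m)
    have [simp]: "cheb_S (2 + int m) = cheb_nat (Suc (Suc m))" "cheb_S (1 + int m) = cheb_nat (Suc m)"
      "cheb_S (int m) = cheb_nat m"
      by (simp_all add: cheb_S_def nat_add_distrib)
    show ?thesis using 2 by (simp add: add.assoc[symmetric])
  next
    case (3 m)
    have a: "cheb_S (- int m) = - cheb_nat m" by (auto simp: cheb_S_def)
    have b: "cheb_S (- int (Suc m)) = - cheb_nat (Suc m)" by (simp add: cheb_S_def nat_add_distrib)
    have c: "cheb_S (- int (Suc (Suc m))) = - cheb_nat (Suc (Suc m))"
      by (simp add: cheb_S_def nat_add_distrib)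
    have "k + 1 = - int m" "k - 1 = - int (Suc (Suc m))" using 3 by auto
    then show ?thesis by (simp only: 3 a b c) (simp add: algebra_simps)
  qed simp
qed

lemma cheb_recurrence_S: "cheb_recurrence cheb_S"
  unfolding cheb_recurrence_def using cheb_S_rec by blast

lemma cheb_recurrence_shift: "cheb_recurrence f \<Longrightarrow> cheb_recurrence (\<lambda>k. f (N + k))"
  unfolding cheb_recurrence_def by (simp only: add.assoc[symmetric] add_diff_eq) blast

lemma cheb_recurrence_reflect:
  assumes "cheb_recurrence f"
  shows "cheb_recurrence (\<lambda>k. f (N - k))"
  unfolding cheb_recurrence_def
proof
  fix k
  show "f (N - (k + 1)) = [:2, 1:] * f (N - k) - f (N - (k - 1))"
    using assms[unfolded cheb_recurrence_def, rule_format, of "N - k"] by (simp add: algebra_simps)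
qed

lemma cheb_recurrence_add: "cheb_recurrence f \<Longrightarrow> cheb_recurrence g \<Longrightarrow> cheb_recurrence (\<lambda>k. f k + g k)"
  unfolding cheb_recurrence_def by (simp only: distrib_left) simp

lemma cheb_recurrence_mult: "cheb_recurrence f \<Longrightarrow> cheb_recurrence (\<lambda>k. p * f k)"
  unfolding cheb_recurrence_def by (simp only: right_diff_distrib mult.left_commute) simp

lemma cheb_recurrence_diff: "cheb_recurrence f \<Longrightarrow> cheb_recurrence g \<Longrightarrow> cheb_recurrence (\<lambda>k. f k - g k)"
  using cheb_recurrence_add[OF _ cheb_recurrence_mult[of g "-1"], of f] by simp

lemma cheb_recurrence_V: "cheb_recurrence cheb_V"
  using cheb_recurrence_diff[OF cheb_recurrence_shift[OF cheb_recurrence_S, of 1] cheb_recurrence_S]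
  by (simp add: cheb_V_def[abs_def] add.commute)

lemma cheb_recurrence_W: "cheb_recurrence cheb_W"
  using cheb_recurrence_add[OF cheb_recurrence_shift[OF cheb_recurrence_S, of 1] cheb_recurrence_S]
  by (simp add: cheb_W_def[abs_def] add.commute)

lemma cheb_recurrence_T: "cheb_recurrence cheb_T"
  using cheb_recurrence_diff[OF cheb_recurrence_shift[OF cheb_recurrence_S, of 1]
      cheb_recurrence_shift[OF cheb_recurrence_S, of "-1"]]
  by (simp add: cheb_T_def[abs_def] add.commute)

lemma cheb_V_reflect: "cheb_V (- 1 - k) = cheb_V k"
  using cheb_S_uminus[of k] cheb_S_uminus[of "k + 1"] by (simp add: cheb_V_def algebra_simps)

lemma cheb_initial_values: "cheb_V 0 = 1" "cheb_V (-1) = 1" "cheb_W 0 = 1" "cheb_W (-1) = -1"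
  "cheb_T 0 = 2" "cheb_T (-1) = [:2, 1:]"
  using cheb_S_rec[of 1] cheb_S_uminus[of 2]
  by (simp_all add: cheb_V_def cheb_W_def cheb_T_def)

lemma cheb_V_T: "cheb_V (N + i) + cheb_V (N - i) = cheb_V N * cheb_T i"
proof (rule cheb_recurrence_unique[of "\<lambda>i. cheb_V (N + i) + cheb_V (N - i)"
      "\<lambda>i. cheb_V N * cheb_T i" 0])
  show "cheb_V (N + (0 - 1)) + cheb_V (N - (0 - 1)) = cheb_V N * cheb_T (0 - 1)"
    using cheb_recurrence_V[unfolded cheb_recurrence_def, rule_format, of N]
    by (simp add: cheb_initial_values mult.commute)
qed (auto intro!: cheb_recurrence_add cheb_recurrence_shift cheb_recurrence_reflect
    cheb_recurrence_mult cheb_recurrence_V cheb_recurrence_T simp: cheb_initial_values)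

lemma cheb_S_T: "cheb_S (N + i) + cheb_S (N - i) = cheb_S N * cheb_T i"
proof (rule cheb_recurrence_unique[of "\<lambda>i. cheb_S (N + i) + cheb_S (N - i)"
      "\<lambda>i. cheb_S N * cheb_T i" 0])
  show "cheb_S (N + (0 - 1)) + cheb_S (N - (0 - 1)) = cheb_S N * cheb_T (0 - 1)"
    using cheb_S_rec[of N] by (simp add: cheb_initial_values mult.commute)
qed (auto intro!: cheb_recurrence_add cheb_recurrence_shift cheb_recurrence_reflect
    cheb_recurrence_mult cheb_recurrence_S cheb_recurrence_T simp: cheb_initial_values)

lemma numeral_mult_poly: "2 * p = smult 2 (p :: rat poly)"
  by (simp add: numeral_poly)

lemma cheb_V_W: "cheb_V (M + i) - cheb_V (M - 1 - i) = pCons 0 (cheb_S M * cheb_W i)"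
proof -
  have "cheb_V (M + i) - cheb_V (M - 1 - i) = ([:0, 1:] * cheb_S M) * cheb_W i"
  proof (rule cheb_recurrence_unique[of "\<lambda>i. cheb_V (M + i) - cheb_V (M - 1 - i)"
        "\<lambda>i. ([:0, 1:] * cheb_S M) * cheb_W i" 0])
    show "cheb_V (M + 0) - cheb_V (M - 1 - 0) = ([:0, 1:] * cheb_S M) * cheb_W 0"
      unfolding cheb_V_def using cheb_S_rec[of M] by (simp add: cheb_initial_values numeral_mult_poly)
    show "cheb_V (M + (0 - 1)) - cheb_V (M - 1 - (0 - 1)) = ([:0, 1:] * cheb_S M) * cheb_W (0 - 1)"
      unfolding cheb_V_def using cheb_S_rec[of M] by (simp add: cheb_initial_values numeral_mult_poly)
  qed (intro cheb_recurrence_diff cheb_recurrence_shift cheb_recurrence_reflect cheb_recurrence_mult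
      cheb_recurrence_V cheb_recurrence_W)+
  then show ?thesis by simp
qed

lemma cheb_S_W: "cheb_S (N + 1 + i) - cheb_S (N - i) = cheb_V N * cheb_W i"
proof (rule cheb_recurrence_unique[of "\<lambda>i. cheb_S (N + 1 + i) - cheb_S (N - i)"
      "\<lambda>i. cheb_V N * cheb_W i" 0])
  show "cheb_S (N + 1 + 0) - cheb_S (N - 0) = cheb_V N * cheb_W 0"
    "cheb_S (N + 1 + (0 - 1)) - cheb_S (N - (0 - 1)) = cheb_V N * cheb_W (0 - 1)"
    by (simp_all add: cheb_initial_values cheb_V_def)
qed (intro cheb_recurrence_diff cheb_recurrence_shift cheb_recurrence_reflect cheb_recurrence_mult
      cheb_recurrence_S cheb_recurrence_W)+

lemma cheb_S_nat: "cheb_S (int m) = cheb_nat m"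
  by (simp add: cheb_S_def)

lemma coeff_cheb_nat: "coeff (cheb_nat m) i = of_nat ((m + i) choose (2 * i + 1))"
proof (induction m arbitrary: i rule: cheb_nat.induct)
  case 2
  show ?case by (cases i) (simp_all add: binomial_eq_0 del: binomial_Suc_Suc)
next
  case (3 m)
  show ?case
  proof (cases i)
    case 0
    then show ?thesis by (simp add: 3)
  next
    case (Suc j)
    have c: "coeff (cheb_nat (Suc (Suc m))) i =
        2 * of_nat ((Suc m + i) choose (2 * i + 1)) + of_nat ((Suc m + j) choose (2 * j + 1)) -
        of_nat ((m + i) choose (2 * i + 1))"
      by (simp add: 3 Suc)
    have "((Suc (Suc m) + i) choose (2 * i + 1)) + ((m + i) choose (2 * i + 1)) =
        2 * ((Suc m + i) choose (2 * i + 1)) + ((Suc m + j) choose (2 * j + 1))"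
      using binomial_Suc_Suc[of "m + j + 2" "2 * j + 2"] binomial_Suc_Suc[of "m + j + 1" "2 * j + 2"]
        binomial_Suc_Suc[of "m + j + 1" "2 * j + 1"]
      by (simp add: Suc del: binomial_Suc_Suc)
    then have "of_nat ((Suc (Suc m) + i) choose (2 * i + 1)) + of_nat ((m + i) choose (2 * i + 1)) =
        (2 * of_nat ((Suc m + i) choose (2 * i + 1)) + of_nat ((Suc m + j) choose (2 * j + 1)) :: rat)"
      by (metis of_nat_add of_nat_mult of_nat_numeral)
    then have "2 * of_nat ((Suc m + i) choose (2 * i + 1)) + of_nat ((Suc m + j) choose (2 * j + 1)) -
        of_nat ((m + i) choose (2 * i + 1)) = (of_nat ((Suc (Suc m) + i) choose (2 * i + 1)) :: rat)"
      by (simp only: algebra_simps)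
    with c show ?thesis by simp
  qed
qed simp

lemma coeff_cheb_S: "coeff (cheb_S (int m)) i = of_nat ((m + i) choose (2 * i + 1))"
  by (simp add: cheb_S_nat coeff_cheb_nat)

lemma coeff_cheb_V: "coeff (cheb_V (int m)) i = of_nat ((m + i) choose (2 * i))"
proof -
  have "cheb_V (int m) = cheb_S (int (Suc m)) - cheb_S (int m)"
    by (simp add: cheb_V_def add.commute)
  then show ?thesis
    by (simp only: coeff_diff coeff_cheb_S) simp
qed

lemma monicI_coeff:
  assumes "\<And>j. i < j \<Longrightarrow> coeff p j = 0" "coeff p i = 1"
  shows "degree p = i \<and> coeff p i = (1 :: 'a :: comm_ring_1)"
  using assms by (metis degree_le le_antisym le_degree one_neq_zero)

lemma cheb_S_monic: "degree (cheb_S (int (Suc m))) = m \<and> coeff (cheb_S (int (Suc m))) m = 1"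
  by (rule monicI_coeff; simp only: coeff_cheb_S) (simp_all add: binomial_eq_0 mult_2 del: binomial_Suc_Suc)

lemma cheb_V_monic: "degree (cheb_V (int m)) = m \<and> coeff (cheb_V (int m)) m = 1"
  by (rule monicI_coeff; simp only: coeff_cheb_V) (simp_all add: binomial_eq_0 mult_2 del: binomial_Suc_Suc)

lemma coeff_cheb_W: "coeff (cheb_W (int m)) i =
    of_nat ((Suc m + i) choose (2 * i + 1)) + of_nat ((m + i) choose (2 * i + 1))"
proof -
  have "cheb_W (int m) = cheb_S (int (Suc m)) + cheb_S (int m)"
    by (simp add: cheb_W_def add.commute)
  then show ?thesis
    by (simp only: coeff_add coeff_cheb_S)
qed

lemma coeff_cheb_T: "coeff (cheb_T (int (Suc m))) i =
    of_nat ((Suc (Suc m) + i) choose (2 * i + 1)) - of_nat ((m + i) choose (2 * i + 1))"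
proof -
  have "cheb_T (int (Suc m)) = cheb_S (int (Suc (Suc m))) - cheb_S (int m)"
    by (simp add: cheb_T_def add.commute)
  then show ?thesis
    by (simp only: coeff_diff coeff_cheb_S)
qed

lemma cheb_W_monic: "degree (cheb_W (int m)) = m \<and> coeff (cheb_W (int m)) m = 1"
  by (rule monicI_coeff; simp only: coeff_cheb_W) (simp_all add: binomial_eq_0 mult_2 del: binomial_Suc_Suc)

lemma cheb_T_monic: "degree (cheb_T (int (Suc m))) = Suc m \<and> coeff (cheb_T (int (Suc m))) (Suc m) = 1"
  by (rule monicI_coeff; simp only: coeff_cheb_T) (simp_all add: binomial_eq_0 mult_2 del: binomial_Suc_Suc)

lemma of_nat_choose_two: "of_nat (n choose 2) = (of_nat n * (of_nat n - 1) / 2 :: rat)"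
  by (induction n) (auto simp: numeral_2_eq_2 field_simps)

lemma choose_codegree_two: "of_nat ((n + 2) choose n) = ((of_nat n + 2) * (of_nat n + 1) / 2 :: rat)"
  using binomial_symmetric[of n "n + 2"]
  by (simp add: of_nat_choose_two field_simps del: binomial_Suc_Suc)

text \<open>
  The coefficient two below the leading one; it is the constant in the sum rule for odd powers.
\<close>

lemma coeff_cheb_W_second:
  "coeff (cheb_W (int (t + 2))) t = (of_nat t + 1) * (2 * of_nat t + 5)"
proof -
  have e: "Suc (t + 2) + t = (2 * t + 1) + 2" "t + 2 + t = Suc (2 * t + 1)" by simp_all
  have "coeff (cheb_W (int (t + 2))) t =
      of_nat ((2 * t + 1 + 2) choose (2 * t + 1)) + of_nat (Suc (2 * t + 1) choose (2 * t + 1))"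
    unfolding coeff_cheb_W e ..
  moreover have "Suc (2 * t + 1) choose (2 * t + 1) = Suc (2 * t + 1)"
    by (rule binomial_Suc_n)
  ultimately have "coeff (cheb_W (int (t + 2))) t =
      (2 * of_nat t + 1 + 2) * (2 * of_nat t + 1 + 1) / 2 + (2 * of_nat t + 2)"
    using choose_codegree_two[of "2 * t + 1"] by (simp del: binomial_Suc_Suc)
  then show ?thesis by (simp add: field_simps)
qed

text \<open>
  The corresponding constant for even powers.
\<close>

lemma coeff_cheb_T_second:
  "coeff (cheb_T (int (t + 2))) t = (of_nat t + 2) * (2 * of_nat t + 1)"
proof -
  have "coeff (cheb_T (int (Suc (t + 1)))) t =
      of_nat ((2 * t + 1 + 2) choose (2 * t + 1)) - of_nat ((2 * t + 1) choose (2 * t + 1))"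
    unfolding coeff_cheb_T by (simp add: mult_2 del: binomial_Suc_Suc)
  also have "\<dots> = (of_nat t + 2) * (2 * of_nat t + 1)"
    unfolding choose_codegree_two by (simp add: field_simps)
  finally show ?thesis by simp
qed

no_notation vec_index (infixl "$" 100)
unbundle fps_syntax


section \<open>The Catalan series and its moment functional\<close>

lemma catalan_rec:
  "of_nat (n + 2) * fps_nth catalan_fps (Suc n) = of_nat (4 * n + 2) * fps_nth catalan_fps n"
proof -
  have "(2 * Suc n choose Suc n) * (Suc n * Suc n) = (2 * n choose n) * ((2 * n + 1) * (2 * n + 2))"
  proof -
    have 1: "Suc n * (Suc (2 * n + 1) choose Suc n) = Suc (2 * n + 1) * ((2 * n + 1) choose n)"
      by (rule Suc_times_binomial)
    have "(2 * n + 1 - n) * (Suc (2 * n) choose n) = Suc (2 * n) * (2 * n choose n)"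
      using Suc_times_binomial_eq[of "2 * n" n] binomial_symmetric[of n "2 * n + 1"]
      by (simp add: binomial_symmetric[of n "2 * n"] algebra_simps)
    then have 2: "Suc n * ((2 * n + 1) choose n) = (2 * n + 1) * (2 * n choose n)"
      by simp
    have "(2 * Suc n choose Suc n) * (Suc n * Suc n) = Suc n * (Suc n * (Suc (2 * n + 1) choose Suc n))"
    proof -
      have "2 * Suc n = Suc (2 * n + 1)" by simp
      then show ?thesis by (simp only: mult_ac)
    qed
    also have "\<dots> = Suc (2 * n + 1) * (Suc n * ((2 * n + 1) choose n))"
      unfolding 1 by (simp only: mult.left_commute)
    also have "\<dots> = (2 * n choose n) * ((2 * n + 1) * (2 * n + 2))"
    proof -
      have "Suc (2 * n + 1) = 2 * n + 2" by simp
      then show ?thesis unfolding 2 by (simp only: mult_ac)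
    qed
    finally show ?thesis .
  qed
  then have "Suc n * ((2 * Suc n choose Suc n) * Suc n) = Suc n * ((2 * n choose n) * (4 * n + 2))"
    by (simp add: algebra_simps del: binomial_Suc_Suc)
  then have "(2 * Suc n choose Suc n) * Suc n = (2 * n choose n) * (4 * n + 2)"
    by (simp only: mult_cancel1) simp
  from arg_cong[OF this, of "of_nat :: nat \<Rightarrow> rat"]
  have "of_nat (2 * Suc n choose Suc n) * of_nat (n + 1) = (of_nat (2 * n choose n) * of_nat (4 * n + 2) :: rat)"
    by (simp only: of_nat_mult Suc_eq_plus1)
  moreover have "x' / 1 = b * (x / a)" if "x' * a = x * b" "a \<noteq> 0" for x x' a b :: rat
    using that by (simp add: field_simps)
  ultimately have "of_nat (2 * Suc n choose Suc n) / 1 =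
      of_nat (4 * n + 2) * (of_nat (2 * n choose n) / of_nat (n + 1) :: rat)"
    by (metis of_nat_eq_0_iff add_is_0 one_neq_zero)
  moreover have "fps_nth catalan_fps n = of_nat (2 * n choose n) / of_nat (n + 1)"
    "fps_nth catalan_fps (Suc n) = of_nat (2 * Suc n choose Suc n) / of_nat (n + 2)"
    by (simp_all add: catalan_fps_def)
  ultimately show ?thesis by simp
qed

text \<open>
  The recurrence (n+2) C_(n+1) = (4n+2) C_n as a differential equation.
\<close>

lemma catalan_ode:
  "fps_X * fps_deriv catalan_fps = 4 * fps_X ^ 2 * fps_deriv catalan_fps + 1 - (1 - 2 * fps_X) * catalan_fps"
proof -
  have "fps_X * fps_deriv catalan_fps = fps_const 4 * (fps_X * (fps_X * fps_deriv catalan_fps)) +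
      1 - catalan_fps + fps_const 2 * (fps_X * catalan_fps)"
  proof (rule fps_ext)
    fix n
    show "(fps_X * fps_deriv catalan_fps) $ n = (fps_const 4 * (fps_X * (fps_X * fps_deriv catalan_fps)) +
        1 - catalan_fps + fps_const 2 * (fps_X * catalan_fps)) $ n"
    proof (cases n)
      case 0
      then show ?thesis by (simp add: catalan_fps_def)
    next
      case (Suc m)
      then show ?thesis
        using catalan_rec[of m] by (cases m) (simp_all, simp add: algebra_simps)
    qed
  qed
  then show ?thesis
    by (simp add: numeral_fps_const algebra_simps power2_eq_square)
qed

text \<open>
  The defect F = 1 + x C^2 - C satisfies the homogeneous equation x (1 - 4x) F' = - F, by the
  differential equation for C. Its only power series solution is zero, as n + 1 never vanishes.
\<close>

lemma catalan_quadratic: "catalan_fps = 1 + fps_X * catalan_fps ^ 2"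
proof -
  define C where "C = catalan_fps"
  define F where "F = 1 + fps_X * C ^ 2 - C"
  have ode: "fps_X * fps_deriv C = 4 * fps_X ^ 2 * fps_deriv C + 1 - (1 - 2 * fps_X) * C"
    unfolding C_def by (rule catalan_ode)
  have "fps_deriv F = C ^ 2 + 2 * fps_X * C * fps_deriv C - fps_deriv C"
    by (simp add: F_def power2_eq_square algebra_simps)
  then have fd: "fps_deriv F = C ^ 2 + 2 * fps_X * C * fps_deriv C - fps_deriv C" .
  have "fps_X * fps_deriv F - 4 * fps_X ^ 2 * fps_deriv F =
      fps_X * C ^ 2 - 4 * fps_X ^ 2 * C ^ 2 +
      (2 * fps_X * C - 1) * (fps_X * fps_deriv C - 4 * fps_X ^ 2 * fps_deriv C)"
    unfolding fd by (simp add: algebra_simps power2_eq_square)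
  also have "fps_X * fps_deriv C - 4 * fps_X ^ 2 * fps_deriv C = 1 - (1 - 2 * fps_X) * C"
    using ode by (simp add: algebra_simps)
  also have "fps_X * C ^ 2 - 4 * fps_X ^ 2 * C ^ 2 + (2 * fps_X * C - 1) * (1 - (1 - 2 * fps_X) * C) = - F"
    by (simp add: F_def algebra_simps power2_eq_square)
  finally have F: "fps_X * fps_deriv F = 4 * (fps_X * (fps_X * fps_deriv F)) - F"
    by (simp add: algebra_simps power2_eq_square)
  have "F $ n = 0" for n
  proof (induction n)
    case 0
    then show ?case using arg_cong[OF F, of "\<lambda>f. f $ 0"] by (simp add: fps_numeral_fps_const)
  next
    case (Suc n)
    have "of_nat (Suc n) * F $ Suc n = - F $ Suc n"
      using arg_cong[OF F, of "\<lambda>f. f $ Suc n"] Suc by (cases n) (simp_all add: fps_numeral_fps_const)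
    then have "of_nat (n + 2) * F $ Suc n = 0" by (simp add: algebra_simps)
    then show ?case by (simp del: of_nat_add)
  qed
  then have "F = 0" by (intro fps_ext) simp
  then show ?thesis by (simp add: F_def C_def)
qed

text \<open>
  The series c(x) = C(-x). The sign change does not affect the Hankel determinants of powers of
  C, and it makes all coefficients of the Chebyshev polynomials used here nonnegative.
\<close>

definition signed_catalan :: "rat fps" where
  "signed_catalan = Abs_fps (\<lambda>n. (-1) ^ n * catalan_fps $ n)"

lemma signed_catalan_power: "(signed_catalan ^ r) $ n = (-1) ^ n * (catalan_fps ^ r) $ n"
proof (induction r arbitrary: n)
  case (Suc r)
  have s: "signed_catalan $ i = (-1) ^ i * catalan_fps $ i" for i
    by (simp add: signed_catalan_def)
  have "(signed_catalan ^ Suc r) $ n =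
      (\<Sum>i=0..n. (-1) ^ i * catalan_fps $ i * ((-1) ^ (n - i) * (catalan_fps ^ r) $ (n - i)))"
    by (simp add: fps_mult_nth Suc s)
  also have "\<dots> = (\<Sum>i=0..n. (-1) ^ n * (catalan_fps $ i * (catalan_fps ^ r) $ (n - i)))"
  proof (rule sum.cong)
    fix i assume "i \<in> {0..n}"
    then have "(-1) ^ n = ((-1) ^ i * (-1) ^ (n - i) :: rat)"
      by (simp flip: power_add)
    then show "(-1) ^ i * catalan_fps $ i * ((-1) ^ (n - i) * (catalan_fps ^ r) $ (n - i)) =
        (-1) ^ n * (catalan_fps $ i * (catalan_fps ^ r) $ (n - i))" by (simp only: mult_ac)
  qed simp
  also have "\<dots> = (-1) ^ n * (catalan_fps ^ Suc r) $ n"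
    by (simp add: fps_mult_nth sum_distrib_left)
  finally show ?case .
qed (simp add: fps_one_nth)

lemma signed_catalan_quadratic: "fps_X * signed_catalan ^ 2 = 1 - signed_catalan"
proof (rule fps_ext)
  fix n
  have "catalan_fps $ n = (1 + fps_X * catalan_fps ^ 2) $ n"
    by (subst catalan_quadratic) simp
  then show "(fps_X * signed_catalan ^ 2) $ n = (1 - signed_catalan) $ n"
    by (cases n) (simp_all add: signed_catalan_power, simp_all add: signed_catalan_def)
qed

lemma signed_catalan_0 [simp]: "signed_catalan $ 0 = 1"
  by (simp add: signed_catalan_def catalan_fps_def)

text \<open>
  The functional that is called L in the comments; its moment of order n is the coefficient [x^n] c.
\<close>

definition moment :: "rat poly \<Rightarrow> rat" where
  "moment p = (\<Sum>k\<le>degree p. coeff p k * signed_catalan $ k)"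

lemma moment_eq:
  assumes "degree p < n"
  shows "moment p = (\<Sum>k<n. coeff p k * signed_catalan $ k)"
  unfolding moment_def
  by (rule sum.mono_neutral_left) (use assms in \<open>auto intro: coeff_eq_0\<close>)

lemma moment_add: "moment (p + q) = moment p + moment q"
proof -
  let ?n = "Suc (max (degree p) (degree q))"
  have "degree (p + q) < ?n" by (simp add: degree_add_le_max less_Suc_eq_le)
  then show ?thesis
    by (simp add: moment_eq[of _ ?n] less_Suc_eq_le distrib_right sum.distrib)
qed

lemma moment_smult: "moment (smult c p) = c * moment p"
  using moment_eq[of "smult c p" "Suc (degree p)"]
  by (simp add: moment_eq[of p "Suc (degree p)"] sum_distrib_left mult.assoc less_Suc_eq_le degree_smult_le del: sum.lessThan_Suc)

lemma moment_sum: "moment (sum f A) = (\<Sum>i\<in>A. moment (f i))"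
  by (induction A rule: infinite_finite_induct) (auto simp: moment_add, simp_all add: moment_def)

lemma moment_diff: "moment (p - q) = moment p - moment q"
  using moment_add[of p "smult (-1) q"] moment_smult[of "-1" q] by simp

lemma moment_monom: "moment (monom 1 n) = signed_catalan $ n"
  by (subst moment_eq[of _ "Suc n"]) (auto simp: degree_monom_eq if_distrib[of "\<lambda>x. x * _"] cong: if_cong)

definition moment_fps :: "rat poly \<Rightarrow> rat fps" where
  "moment_fps p = Abs_fps (\<lambda>n. moment (monom 1 n * p))"

lemma moment_fps_add: "moment_fps (p + q) = moment_fps p + moment_fps q"
  by (rule fps_ext) (simp add: moment_fps_def moment_add algebra_simps)

lemma moment_fps_diff: "moment_fps (p - q) = moment_fps p - moment_fps q"
  by (rule fps_ext) (simp add: moment_fps_def moment_diff algebra_simps)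

lemma moment_fps_1: "moment_fps 1 = signed_catalan"
  by (rule fps_ext) (simp add: moment_fps_def moment_monom)

lemma moment_fps_pCons:
  "fps_X * moment_fps (pCons 0 p) = moment_fps p - fps_const (moment_fps p $ 0)"
proof (rule fps_ext)
  fix n
  have "monom 1 m * pCons 0 p = monom 1 (Suc m) * p" for m
    by (simp add: monom_Suc)
  then show "(fps_X * moment_fps (pCons 0 p)) $ n = (moment_fps p - fps_const (moment_fps p $ 0)) $ n"
    by (cases n) (simp_all add: moment_fps_def)
qed

text \<open>
  The generating function inherits the three-term recurrence, up to division by x. The geometric
  solution works because x c^2 = 1 - c turns the characteristic equation into
  c^2 + 2 x c^2 - 1 = (1 - c)^2 = (x c^2)^2. The factor x^m is the orthogonality of V_m to lower
  degrees, and the factor c^(2m+1) exhibits, up to sign, the coefficients of odd powers of C as moments of y^m V_m.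
\<close>

lemma moment_fps_cheb_V:
  "moment_fps (cheb_V (int m)) = fps_X ^ m * signed_catalan ^ (2 * m + 1)"
proof -
  define c where "c = signed_catalan"
  have Xc: "fps_X * c ^ 2 = 1 - c" unfolding c_def by (rule signed_catalan_quadratic)
  \<comment> \<open>The three-term recurrence; multiplication by y drops the constant term and divides by x.\<close>
  have step: "fps_X * moment_fps (cheb_V (k + 1)) =
      moment_fps (cheb_V k) - fps_const (moment_fps (cheb_V k) $ 0) +
      2 * fps_X * moment_fps (cheb_V k) - fps_X * moment_fps (cheb_V (k - 1))" for k
  proof -
    have "cheb_V (k + 1) = [:2, 1:] * cheb_V k - cheb_V (k - 1)"
      using cheb_recurrence_V unfolding cheb_recurrence_def by blast
    also have "[:2, 1:] * cheb_V k = pCons 0 (cheb_V k) + (cheb_V k + cheb_V k)"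
      by (simp add: numeral_mult_poly[symmetric])
    finally have "moment_fps (cheb_V (k + 1)) = moment_fps (pCons 0 (cheb_V k)) +
        (moment_fps (cheb_V k) + moment_fps (cheb_V k)) - moment_fps (cheb_V (k - 1))"
      by (simp only: moment_fps_add moment_fps_diff)
    note * = this
    have "fps_X * moment_fps (cheb_V (k + 1)) = fps_X * moment_fps (pCons 0 (cheb_V k)) +
        2 * fps_X * moment_fps (cheb_V k) - fps_X * moment_fps (cheb_V (k - 1))"
      unfolding * by (simp add: algebra_simps)
    then show ?thesis by (simp only: moment_fps_pCons)
  qed
  have "moment_fps (cheb_V (int m)) = fps_X ^ m * c ^ (2 * m + 1) \<and>
      moment_fps (cheb_V (int (Suc m))) = fps_X ^ Suc m * c ^ (2 * Suc m + 1)"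
  proof (induction m)
    case 0
    have c0: "c $ 0 = 1" by (simp add: c_def signed_catalan_def catalan_fps_def)
    have "fps_X * moment_fps (cheb_V 1) = c - 1 + 2 * fps_X * c - fps_X * c"
      using step[of 0] c0 by (simp add: cheb_initial_values moment_fps_1 flip: c_def)
    also have "\<dots> = fps_X * c * (1 - c)"
      using Xc by (simp add: algebra_simps power2_eq_square)
    also have "\<dots> = fps_X * (fps_X * c ^ 3)"
      unfolding Xc[symmetric] by (simp add: algebra_simps power2_eq_square power3_eq_cube)
    finally have "moment_fps (cheb_V 1) = fps_X * c ^ 3"
      by simp
    then show ?case
      by (simp add: cheb_initial_values moment_fps_1 flip: c_def)
  next
    case (Suc m)
    define d where "d = fps_X ^ Suc m * c ^ (2 * m + 1)"
    have v1: "moment_fps (cheb_V (int (Suc m))) = d * c ^ 2"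
      using Suc by (simp add: d_def algebra_simps power2_eq_square)
    have v0: "fps_X * moment_fps (cheb_V (int m)) = d"
      using Suc by (simp add: d_def mult.assoc)
    have z: "moment_fps (cheb_V (int (Suc m))) $ 0 = 0"
      using Suc by simp
    have "fps_X * moment_fps (cheb_V (int (Suc (Suc m)))) =
        moment_fps (cheb_V (int (Suc m))) + 2 * fps_X * moment_fps (cheb_V (int (Suc m))) -
        fps_X * moment_fps (cheb_V (int m))"
      using step[of "int (Suc m)"] z by (simp add: add.commute)
    also have "\<dots> = d * (c ^ 2 + 2 * (fps_X * c ^ 2) - 1)"
      unfolding v0 unfolding v1 by (simp add: algebra_simps)
    also have "c ^ 2 + 2 * (fps_X * c ^ 2) - 1 = (1 - c) ^ 2"
      unfolding Xc by (simp add: algebra_simps power2_eq_square)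
    also have "\<dots> = (fps_X * c ^ 2) ^ 2"
      by (simp only: Xc)
    also have "d * (fps_X * c ^ 2) ^ 2 = fps_X * (fps_X ^ Suc (Suc m) * c ^ (2 * Suc (Suc m) + 1))"
      by (simp add: d_def algebra_simps power2_eq_square)
    finally have "moment_fps (cheb_V (int (Suc (Suc m)))) = fps_X ^ Suc (Suc m) * c ^ (2 * Suc (Suc m) + 1)"
      by simp
    then show ?case using Suc by blast
  qed
  then show ?thesis unfolding c_def by blast
qed

text \<open>
  From the previous result, because S_(m+1) = S_m + V_m. From degree one on, this
  generating function exhibits, up to sign, the coefficients of even powers of C as moments of y^m S_m.
\<close>

lemma moment_fps_cheb_S:
  "moment_fps (cheb_S (int (Suc m))) = 1 - fps_X ^ Suc m * signed_catalan ^ (2 * Suc m)"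
proof (induction m)
  case 0
  then show ?case
    using signed_catalan_quadratic by (simp add: moment_fps_1)
next
  case (Suc m)
  have Xc: "fps_X * signed_catalan ^ 2 = 1 - signed_catalan" by (rule signed_catalan_quadratic)
  let ?d = "fps_X ^ Suc m * signed_catalan ^ (2 * Suc m)"
  have "cheb_S (int (Suc (Suc m))) = cheb_S (int (Suc m)) + cheb_V (int (Suc m))"
    by (simp add: cheb_V_def add.commute)
  then have "moment_fps (cheb_S (int (Suc (Suc m)))) = 1 - ?d + ?d * signed_catalan"
    by (simp only: moment_fps_add Suc moment_fps_cheb_V) (simp add: mult.assoc)
  also have "1 - ?d + ?d * signed_catalan = 1 - ?d * (1 - signed_catalan)"
  proof -
    have "1 - d + d * s = 1 - d * (1 - s)" for d s :: "rat fps"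
      by (simp add: algebra_simps)
    then show ?thesis .
  qed
  also have "\<dots> = 1 - ?d * (fps_X * signed_catalan ^ 2)"
    by (simp only: Xc)
  also have "?d * (fps_X * signed_catalan ^ 2) = fps_X ^ Suc (Suc m) * signed_catalan ^ (2 * Suc (Suc m))"
    by (simp add: algebra_simps power2_eq_square)
  finally show ?case .
qed

lemma moment_monom_cheb_V:
  "moment (monom 1 k * cheb_V (int j)) = (if k < j then 0 else (signed_catalan ^ (2 * j + 1)) $ (k - j))"
  using moment_fps_cheb_V[of j, THEN arg_cong, of "\<lambda>f. f $ k"]
  by (simp add: moment_fps_def fps_X_power_mult_nth)

lemma moment_mult_eq:
  assumes "degree p < n"
  shows "moment (p * q) = (\<Sum>k<n. coeff p k * moment (monom 1 k * q))"
proof -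
  have "p = (\<Sum>k<n. smult (coeff p k) (monom 1 k))"
    by (rule poly_eq_sum_monom) (use assms in \<open>auto intro: coeff_eq_0\<close>)
  then have "moment (p * q) = moment ((\<Sum>k<n. smult (coeff p k) (monom 1 k)) * q)"
    by (rule arg_cong)
  also have "\<dots> = (\<Sum>k<n. coeff p k * moment (monom 1 k * q))"
    by (simp add: sum_distrib_right moment_sum moment_smult)
  finally show ?thesis .
qed

lemma moment_cheb_V_orthonormal:
  "moment (cheb_V (int i) * cheb_V (int j)) = (if i = j then 1 else 0)"
proof -
  have *: "moment (cheb_V (int i) * cheb_V (int j)) = (if i = j then 1 else 0)" if "i \<le> j" for i j
  proof -
    have "moment (cheb_V (int i) * cheb_V (int j)) =
        (\<Sum>k<Suc i. coeff (cheb_V (int i)) k * moment (monom 1 k * cheb_V (int j)))"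
      by (rule moment_mult_eq) (use cheb_V_monic[of i] in simp)
    also have "\<dots> = coeff (cheb_V (int i)) i * moment (monom 1 i * cheb_V (int j))"
      using that by (simp add: moment_monom_cheb_V)
    also have "\<dots> = (if i = j then 1 else 0)"
      using that cheb_V_monic[of i]
      by (auto simp: moment_monom_cheb_V fps_power_zeroth)
    finally show ?thesis .
  qed
  show ?thesis
    using *[of i j] *[of j i] by (cases "i \<le> j") (auto simp: mult.commute)
qed

section \<open>Christoffel's formula\<close>

definition residue_det :: "'a::field poly \<Rightarrow> 'a poly list \<Rightarrow> 'a" where
  "residue_det q ps = coeff_det (map (\<lambda>p. p mod q) ps)"

text \<open>
  The lists that occur in Christoffel's formula. The start is an integer, so that windows
  can be reflected to negative indices.
\<close>

definition V_window :: "int \<Rightarrow> nat \<Rightarrow> rat poly list" where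
  "V_window x p = map (\<lambda>i. cheb_V (x + int i)) [0..<p]"

text \<open>
  Christoffel's formula for the modified functional p \<mapsto> L (q p), in a form that does not mention
  the roots of q. Expand the list q, q y, ..., q y^(n-1), V_n, ..., V_(n+d-1) in the orthonormal basis
  V_0, V_1, ...: the last d members are basis vectors, and the rest is the Hankel matrix. On the other
  hand, the multiples of q can be split off.
\<close>

lemma hankel_christoffel:
  assumes q: "degree q = d" "coeff q d = 1"
  shows "det (mat n n (\<lambda>(i, j). moment (monom 1 (i + j) * q))) =
    (-1) ^ (n * d) * residue_det q (V_window (int n) d)"
proof -
  define m where "m = n + d"
  define ps where "ps = shifts q n @ map (\<lambda>i. cheb_V (int (n + i))) [0..<d]"
  have q0: "q \<noteq> 0" using q by auto
  have len: "length ps = m" by (simp add: ps_def m_def)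
  have degp: "degree (ps ! i) < m" if "i < m" for i
    using that q q0 cheb_V_monic
    by (auto simp: ps_def m_def nth_append degree_mult_eq degree_monom_eq monom_eq_0_iff)
  let ?X = "mat m m (\<lambda>(i, j). coeff (ps ! i) j)"
  let ?P = "mat m m (\<lambda>(k, j). moment (monom 1 k * cheb_V (int j)))"
  \<comment> \<open>The matrix P is unitriangular by orthogonality, and X P contains the expansions in the basis V.\<close>
  have "coeff_det ps = det ?X * det ?P"
  proof -
    have "det ?P = 1"
      by (rule det_unitriangular_lower)
        (auto simp: moment_monom_cheb_V fps_power_zeroth)
    then show ?thesis by (simp add: coeff_det_def len)
  qed
  also have "\<dots> = det (?X * ?P)"
    by (rule det_mult[symmetric]) auto
  also have "?X * ?P = mat (n + d) (n + d) (\<lambda>(i, j). moment (ps ! i * cheb_V (int j)))"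
    by (rule eq_matI)
      (auto simp: scalar_prod_def moment_mult_eq[OF degp] lessThan_atLeast0 simp flip: m_def)
  also have "det \<dots> = det (mat n n (\<lambda>(i, j). moment (ps ! i * cheb_V (int j)))) *
      det (mat d d (\<lambda>(i, j). moment (ps ! (n + i) * cheb_V (int (n + j)))))"
    by (rule det_block_lower_left_zero)
      (auto simp: ps_def nth_append moment_cheb_V_orthonormal simp flip: of_nat_add)
  also have "det (mat d d (\<lambda>(i, j). moment (ps ! (n + i) * cheb_V (int (n + j))))) = 1"
    by (rule det_unitriangular_lower)
      (auto simp: ps_def nth_append moment_cheb_V_orthonormal simp flip: of_nat_add)
  also have "det (mat n n (\<lambda>(i, j). moment (ps ! i * cheb_V (int j)))) =
      det (mat n n (\<lambda>(i, j). moment (monom 1 (i + j) * q)))"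
  proof -
    let ?H = "mat n n (\<lambda>(i, j). moment (monom 1 (i + j) * q))"
    let ?U = "mat n n (\<lambda>(i, j). coeff (cheb_V (int i)) j)"
    have U: "det (transpose_mat ?U) = 1"
    proof -
      have "det ?U = 1"
        by (rule det_unitriangular_lower) (use cheb_V_monic in \<open>auto intro!: coeff_eq_0\<close>)
      then show ?thesis by (simp add: det_transpose[of _ n])
    qed
    have "mat n n (\<lambda>(i, j). moment (ps ! i * cheb_V (int j))) = ?H * transpose_mat ?U"
    proof (rule eq_matI)
      fix i j assume "i < dim_row (?H * transpose_mat ?U)" "j < dim_col (?H * transpose_mat ?U)"
      then have ij: "i < n" "j < n" by auto
      have "moment (ps ! i * cheb_V (int j)) = moment (cheb_V (int j) * (monom 1 i * q))"
        using ij by (simp add: ps_def nth_append mult_ac)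
      also have "\<dots> = (\<Sum>k<n. coeff (cheb_V (int j)) k * moment (monom 1 k * (monom 1 i * q)))"
        by (rule moment_mult_eq) (use ij cheb_V_monic[of j] in simp)
      also have "\<dots> = (\<Sum>k<n. moment (monom 1 (i + k) * q) * coeff (cheb_V (int j)) k)"
      proof -
        have "monom 1 k * (monom 1 i * q) = monom 1 (i + k) * q" for k
          by (simp only: mult.assoc[symmetric] mult_monom) (simp add: add.commute)
        then show ?thesis by (simp only: mult.commute[of "coeff _ _"])
      qed
      finally show "mat n n (\<lambda>(i, j). moment (ps ! i * cheb_V (int j))) $$ (i, j) =
          (?H * transpose_mat ?U) $$ (i, j)"
        using ij by (simp add: scalar_prod_def lessThan_atLeast0)
    qed auto
    then show ?thesis
      using U by (simp add: det_mult[of _ n])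
  qed
  finally have "det (mat n n (\<lambda>(i, j). moment (monom 1 (i + j) * q))) = coeff_det ps"
    by simp
  also have "\<dots> = (-1) ^ (n * d) * coeff_det (map (\<lambda>p. p mod q) (map (\<lambda>i. cheb_V (int (n + i))) [0..<d]))"
    unfolding ps_def
  proof (rule coeff_det_multiples[OF q])
    fix w assume "w \<in> set (map (\<lambda>i. cheb_V (int (n + i))) [0..<d])"
    then show "degree w < n + d" using cheb_V_monic by (auto simp flip: of_nat_add)
  qed simp
  finally show ?thesis by (simp add: comp_def residue_det_def V_window_def)
qed

lemma det_leibniz:
  "det (mat n n (\<lambda>(i, j). f i j)) = (\<Sum>p | p permutes {0..<n}. signof p * (\<Prod>i=0..<n. f i (p i)))"
  unfolding det_def by (auto intro!: sum.cong prod.cong simp: permutes_in_image[of _ "{0..<n}"])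

text \<open>
  Every product in the Leibniz expansion contains each (-1)^i twice, once for the row and once for the
  column.
\<close>

lemma det_sign_conjugate:
  "det (mat n n (\<lambda>(i, j). c * (-1) ^ (i + j) * f i j)) = c ^ n * det (mat n n (\<lambda>(i, j). f i j :: 'a :: comm_ring_1))"
proof -
  have "mat n n (\<lambda>(i, j). c * (-1) ^ (i + j) * f i j) =
      c \<cdot>\<^sub>m mat n n (\<lambda>(i, j). (-1) ^ (i + j) * f i j)"
    by (rule eq_matI) (auto simp: mult.assoc)
  moreover have "det (mat n n (\<lambda>(i, j). (-1) ^ (i + j) * f i j)) = det (mat n n (\<lambda>(i, j). f i j))"
  proof -
    have "det (mat n n (\<lambda>(i, j). (-1) ^ (i + j) * f i j)) =
        (\<Sum>p | p permutes {0..<n}. signof p * (\<Prod>i=0..<n. (-1) ^ (i + p i) * f i (p i)))"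
      by (rule det_leibniz)
    also have "\<dots> = (\<Sum>p | p permutes {0..<n}. signof p * (\<Prod>i=0..<n. f i (p i)))"
    proof (rule sum.cong)
      fix p assume "p \<in> {p. p permutes {0..<n}}"
      then have p: "p permutes {0..<n}" by simp
      have "(\<Prod>i=0..<n. (-1 :: 'a) ^ p i) = (\<Prod>i=0..<n. (-1) ^ i)"
        by (rule prod.permute[OF p, symmetric, unfolded comp_def])
      then have "(\<Prod>i=0..<n. (-1 :: 'a) ^ (i + p i)) = (\<Prod>i=0..<n. (-1) ^ i * (-1) ^ i)"
        by (simp only: power_add prod.distrib)
      also have "\<dots> = 1"
        by (simp flip: power_mult_distrib)
      finally show "signof p * (\<Prod>i=0..<n. (-1) ^ (i + p i) * f i (p i)) =
          signof p * (\<Prod>i=0..<n. f i (p i))"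
        by (simp add: prod.distrib)
    qed simp
    also have "\<dots> = det (mat n n (\<lambda>(i, j). f i j))"
      by (rule det_leibniz[symmetric])
    finally show ?thesis .
  qed
  ultimately show ?thesis by simp
qed

text \<open>
  The sign in Christoffel's formula is trivial because the degree 2 t is even.
\<close>

lemma hankel_odd_christoffel:
  "hankel n (catalan_power (2 * t + 1)) =
    residue_det (monom 1 t * cheb_V (int t)) (V_window (int n) (2 * t))"
proof -
  let ?q = "monom 1 t * cheb_V (int t)"
  have V0: "cheb_V (int t) \<noteq> 0" using cheb_V_monic[of t] by auto
  have q: "degree ?q = 2 * t" "coeff ?q (2 * t) = 1"
    using V0 cheb_V_monic[of t]
    by (simp_all add: degree_mult_eq degree_monom_eq monom_eq_0_iff coeff_monom_mult)
  have "moment (monom 1 k * ?q) = (-1) ^ k * catalan_power (2 * t + 1) $ k" for k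
  proof -
    have "monom 1 k * ?q = monom 1 (k + t) * cheb_V (int t)"
      by (simp add: mult.assoc[symmetric] mult_monom)
    then show ?thesis
      by (simp only: moment_monom_cheb_V) (simp only: signed_catalan_power catalan_power_def, simp)
  qed
  then have "det (mat n n (\<lambda>(i, j). moment (monom 1 (i + j) * ?q))) = hankel n (catalan_power (2 * t + 1))"
    using det_sign_conjugate[of n 1 "\<lambda>i j. catalan_power (2 * t + 1) $ (i + j)"]
    by (simp add: hankel_def)
  then show ?thesis
    using hankel_christoffel[OF q, of n] by simp
qed

text \<open>
  The degree 2 t - 1 is odd, and the sign (-1)^n in Christoffel's formula cancels against
  the sign in L (y^(t+k) S_t) = - [x^k] c^(2t).
\<close>

lemma hankel_even_christoffel:
  assumes "t \<ge> 1"
  shows "hankel n (catalan_power (2 * t)) =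
    residue_det (monom 1 t * cheb_S (int t)) (V_window (int n) (2 * t - 1))"
proof -
  let ?q = "monom 1 t * cheb_S (int t)"
  obtain s where s: "t = Suc s" using assms by (cases t) auto
  have S0: "cheb_S (int t) \<noteq> 0" using cheb_S_monic[of s] s by auto
  have q: "degree ?q = 2 * t - 1" "coeff ?q (2 * t - 1) = 1"
    using S0 cheb_S_monic[of s]
    by (simp_all add: degree_mult_eq degree_monom_eq monom_eq_0_iff coeff_monom_mult s)
  have "moment (monom 1 k * ?q) = - 1 * (-1) ^ k * catalan_power (2 * t) $ k" for k
  proof -
    have "monom 1 k * ?q = monom 1 (k + t) * cheb_S (int (Suc s))"
      by (simp add: mult.assoc[symmetric] mult_monom s)
    also have "moment \<dots> = moment_fps (cheb_S (int (Suc s))) $ (k + t)"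
      by (simp add: moment_fps_def)
    also have "\<dots> = - ((signed_catalan ^ (2 * t)) $ k)"
      unfolding moment_fps_cheb_S by (simp add: fps_X_power_mult_nth s[symmetric] fps_one_nth) (simp add: s)
    finally show ?thesis
      by (simp only: signed_catalan_power catalan_power_def mult_minus1 mult_minus_left)
  qed
  then have *: "det (mat n n (\<lambda>(i, j). moment (monom 1 (i + j) * ?q))) =
      (-1) ^ n * hankel n (catalan_power (2 * t))"
    using det_sign_conjugate[of n "-1" "\<lambda>i j. catalan_power (2 * t) $ (i + j)"]
    by (simp add: hankel_def)
  have "even (n + n * (2 * t - 1))" using assms by (cases t) auto
  then have "(-1) ^ (n * (2 * t - 1)) = ((-1) ^ n :: rat)"
    by (simp add: minus_one_power_iff)
  then show ?thesis
    using hankel_christoffel[OF q, of n] * by simp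
qed

section \<open>Folding windows of Chebyshev polynomials\<close>

lemma minus_one_power_eqI: "even (x + y) \<Longrightarrow> (-1) ^ x = ((-1) ^ y :: 'a :: ring_1)"
  by (simp add: minus_one_power_iff)

lemma choose_two_add: "(x + y) choose 2 = (x choose 2) + (y choose 2) + x * y"
  by (induction x) (simp_all add: numeral_2_eq_2)

lemma length_V_window [simp]: "length (V_window x p) = p"
  by (simp add: V_window_def)

lemma nth_V_window [simp]: "i < p \<Longrightarrow> V_window x p ! i = cheb_V (x + int i)"
  by (simp add: V_window_def)

lemma V_window_append: "V_window x (p + q) = V_window x p @ V_window (x + int p) q"
  by (rule nth_equalityI) (auto simp: nth_append algebra_simps of_nat_diff)

lemma V_window_1: "V_window x (Suc 0) = [cheb_V x]"
  by (simp add: V_window_def)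

lemma in_V_window: "x \<le> k \<Longrightarrow> k < x + int p \<Longrightarrow> cheb_V k \<in> set (V_window x p)"
  by (auto simp: V_window_def intro!: image_eqI[of _ _ "nat (k - x)"])

lemma residue_det_cong:
  assumes "list_all2 (\<lambda>p p'. q dvd p - p') ps ps'"
  shows "residue_det q ps = residue_det q ps'"
proof -
  have "map (\<lambda>p. p mod q) ps = map (\<lambda>p. p mod q) ps'"
    using assms by (induction rule: list_all2_induct) (auto simp: mod_eq_dvd_iff)
  then show ?thesis by (simp add: residue_det_def)
qed

lemma residue_det_replace:
  assumes "length ys = length ys'"
    and "\<And>i. i < length ys \<Longrightarrow> ys' ! i = ys ! i \<or>
      (\<exists>c. \<exists>e \<in> set xs \<union> set zs. ys' ! i = ys ! i + smult c e)"
  shows "residue_det q (xs @ ys' @ zs) = residue_det q (xs @ ys @ zs)"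
  unfolding residue_det_def map_append
proof (rule coeff_det_replace)
  fix i assume i: "i < length (map (\<lambda>p. p mod q) ys)"
  then consider "ys' ! i = ys ! i" | c e where "e \<in> set xs \<union> set zs" "ys' ! i = ys ! i + smult c e"
    using assms(2)[of i] by auto
  then show "map (\<lambda>p. p mod q) ys' ! i = map (\<lambda>p. p mod q) ys ! i \<or>
      (\<exists>c. \<exists>e \<in> set (map (\<lambda>p. p mod q) xs) \<union> set (map (\<lambda>p. p mod q) zs).
        map (\<lambda>p. p mod q) ys' ! i = map (\<lambda>p. p mod q) ys ! i + smult c e)"
  proof cases
    case (2 c e)
    then have "map (\<lambda>p. p mod q) ys' ! i = map (\<lambda>p. p mod q) ys ! i + smult c (e mod q)"
      using i assms(1) by (simp add: poly_mod_add_left mod_smult_left)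
    then show ?thesis using 2(1) by auto
  qed (use i assms(1) in simp)
qed (use assms in simp)

lemma residue_det_add_dependent:
  assumes "finite I" and "\<And>i. i \<in> I \<Longrightarrow> f i \<in> set xs \<union> set ys"
  shows "residue_det q (xs @ (p + (\<Sum>i\<in>I. smult (c i) (f i))) # ys) = residue_det q (xs @ p # ys)"
proof -
  have "(\<Sum>i\<in>I. smult (c i) (f i)) mod q = (\<Sum>i\<in>I. smult (c i) (f i mod q))"
    using assms(1) by (induction rule: finite_induct) (auto simp: poly_mod_add_left mod_smult_left)
  then have m: "(p + (\<Sum>i\<in>I. smult (c i) (f i))) mod q = p mod q + (\<Sum>i\<in>I. smult (c i) (f i mod q))"
    by (simp add: poly_mod_add_left)
  show ?thesis
    unfolding residue_det_def map_append list.map m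
    by (rule coeff_det_add_dependent) (use assms(2) in auto)
qed

lemma residue_det_swap_blocks:
  "residue_det q (xs @ ys @ zs @ ws) = (-1) ^ (length ys * length zs) * residue_det q (xs @ zs @ ys @ ws)"
  unfolding residue_det_def map_append by (subst coeff_det_swap_blocks) simp

lemma residue_det_rev:
  "residue_det q (xs @ rev ys @ zs) = (-1) ^ (length ys choose 2) * residue_det q (xs @ ys @ zs)"
  unfolding residue_det_def map_append rev_map[symmetric] by (subst coeff_det_rev) simp

lemma residue_det_smult_map:
  "residue_det q (xs @ map (smult c) ys @ zs) = c ^ length ys * residue_det q (xs @ ys @ zs)"
  using coeff_det_smult_map[of "map (\<lambda>p. p mod q) xs" c "map (\<lambda>p. p mod q) ys" "map (\<lambda>p. p mod q) zs"]
  by (simp add: residue_det_def comp_def mod_smult_left)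

text \<open>
  As soon as a window has been rearranged into degree v arbitrary members and t multiples of v,
  its determinant modulo y^t v factors. The power of the constant coefficient of v arises because the
  multiples themselves, rather than their quotients by v, are used modulo y^t.
\<close>

lemma residue_det_eval:
  assumes v: "degree v = e" "coeff v e = 1" and len: "length es = e" "length ks = t"
    and dvd: "\<And>k. k \<in> set ks \<Longrightarrow> v dvd k"
  shows "coeff v 0 ^ t * residue_det (monom 1 t * v) (es @ ks) = residue_det v es * coeff_det ks"
proof -
  let ?ks = "map (\<lambda>k. k div v) ks"
  have ks: "ks = map ((*) v) ?ks"
    using dvd by (auto intro!: nth_equalityI)
  have "residue_det (monom 1 t * v) (es @ ks) = residue_det v es * coeff_det ?ks"
    unfolding residue_det_def by (subst ks) (rule coeff_det_mod_split[OF v], use len in simp_all)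
  moreover have "coeff_det ks = coeff v 0 ^ t * coeff_det ?ks"
    by (subst ks, subst coeff_det_mult_poly) (simp add: len)
  ultimately show ?thesis by simp
qed

lemma residue_det_V_window:
  assumes "degree v = e" "v \<noteq> 0"
  shows "residue_det v (V_window 0 e) = 1"
proof -
  have "map (\<lambda>p. p mod v) (V_window 0 e) = map (\<lambda>i. cheb_V (int i)) [0..<e]"
    using cheb_V_monic assms by (auto simp: V_window_def intro!: mod_poly_less)
  then show ?thesis
    unfolding residue_det_def using coeff_det_monic[of e "\<lambda>i. cheb_V (int i)"] cheb_V_monic by simp
qed

text \<open>
  The sums V_(N+i) + V_(N-i) = V_N T_i, which result from folding a window at the index N.
  As T_0 = 2, the member with i = 0 is V_N itself and not the sum.
\<close>

definition T_block :: "int \<Rightarrow> nat \<Rightarrow> rat poly list" where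
  "T_block N a = map (\<lambda>i. cheb_V N * (if i = 0 then 1 else cheb_T (int i))) [0..<a]"

text \<open>
  The differences V_(N+i) - V_(N-1-i) = y S_N W_i, which result from folding a window at the
  half-integral index N - 1/2.
\<close>

definition W_block :: "int \<Rightarrow> nat \<Rightarrow> rat poly list" where
  "W_block N b = map (\<lambda>i. pCons 0 (cheb_S N) * cheb_W (int i)) [0..<b]"

lemma length_blocks [simp]: "length (T_block N a) = a" "length (W_block N b) = b"
  by (simp_all add: T_block_def W_block_def)

lemma T_block_replace:
  assumes "V_window (N - int a) a = ws" "set ws \<subseteq> set xs \<union> set zs"
  shows "residue_det q (xs @ V_window N (Suc a) @ zs) = residue_det q (xs @ T_block N (Suc a) @ zs)"
proof (rule residue_det_replace[symmetric])
  fix i assume "i < length (V_window N (Suc a))"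
  then have i: "i \<le> a" by simp
  have "cheb_V (N - int i) \<in> set xs \<union> set zs" if "i > 0"
    using assms in_V_window[of "N - int a" "N - int i" a] that i by auto
  then show "T_block N (Suc a) ! i = V_window N (Suc a) ! i \<or>
      (\<exists>c. \<exists>e\<in>set xs \<union> set zs. T_block N (Suc a) ! i = V_window N (Suc a) ! i + smult c e)"
    using i cheb_V_T[of N "int i"]
    by (cases "i = 0") (auto simp: T_block_def nth_append simp del: upt_Suc intro!: exI[of _ 1] bexI[of _ "cheb_V (N - int i)"])
qed simp

lemma W_block_replace:
  assumes "set (V_window (N - int b) b) \<subseteq> set xs \<union> set zs"
  shows "residue_det q (xs @ V_window N b @ zs) = residue_det q (xs @ W_block N b @ zs)"
proof (rule residue_det_replace[symmetric])
  fix i assume "i < length (V_window N b)"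
  then have i: "i < b" by simp
  have "cheb_V (N - 1 - int i) \<in> set xs \<union> set zs"
    using assms in_V_window[of "N - int b" "N - 1 - int i" b] i by auto
  moreover have "W_block N b ! i = V_window N b ! i + smult (-1) (cheb_V (N - 1 - int i))"
    using i cheb_V_W[of N "int i"] by (simp add: W_block_def)
  ultimately show "W_block N b ! i = V_window N b ! i \<or>
      (\<exists>c. \<exists>e\<in>set xs \<union> set zs. W_block N b ! i = V_window N b ! i + smult c e)"
    by blast
qed simp

lemma coeff_det_T_block:
  "coeff_det (xs @ T_block N a @ zs) = coeff_det (xs @ shifts (cheb_V N) a @ zs)"
  unfolding T_block_def
proof (rule coeff_det_monic_multiples)
  fix i
  show "degree (if i = 0 then 1 else cheb_T (int i)) = i \<and> coeff (if i = 0 then 1 else cheb_T (int i)) i = 1"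
    using cheb_T_monic[of "i - 1"] by (cases i) auto
qed

lemma coeff_det_W_block:
  "coeff_det (xs @ W_block N a @ zs) = coeff_det (xs @ map (pCons 0) (shifts (cheb_S N) a) @ zs)"
proof -
  have "map (pCons 0) (shifts (cheb_S N) a) = shifts (pCons 0 (cheb_S N)) a"
    by simp
  then show ?thesis
    unfolding W_block_def by (simp only:) (rule coeff_det_monic_multiples, rule cheb_W_monic)
qed

text \<open>
  The members of the two blocks lack a constant coefficient, so only p contributes to the lowest one,
  and a factor y can be removed from the blocks.
\<close>

lemma coeff_det_W_block_W_block:
  "coeff_det ([p] @ W_block M a @ W_block N b) = coeff p 0 * sylvester_det (cheb_S M) (cheb_S N) a b"
proof -
  have "coeff_det ([p] @ W_block M a @ W_block N b) =
      coeff_det ([p] @ map (pCons 0) (shifts (cheb_S M) a) @ W_block N b)"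
    by (rule coeff_det_W_block)
  also have "\<dots> = coeff_det (([p] @ map (pCons 0) (shifts (cheb_S M) a)) @ W_block N b @ [])"
    by simp
  also have "\<dots> = coeff_det (p # map (pCons 0)
      (shifts (cheb_S M) a @ shifts (cheb_S N) b))"
    by (subst coeff_det_W_block) simp
  finally show ?thesis by (simp only: coeff_det_pCons sylvester_det_def)
qed

text \<open>
  Here V_M alone contributes to the lowest coefficient.
\<close>

lemma coeff_det_T_block_W_block:
  "coeff_det (T_block M (Suc a) @ W_block N b) =
    coeff (cheb_V M) 0 * sylvester_det (cheb_V M) (cheb_S N) a b"
proof -
  have "coeff_det (T_block M (Suc a) @ W_block N b) =
      coeff_det ([] @ T_block M (Suc a) @ W_block N b)" by simp
  also have "\<dots> = coeff_det (shifts (cheb_V M) (Suc a) @ W_block N b @ [])"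
    by (subst coeff_det_T_block) simp
  also have "\<dots> = coeff_det (shifts (cheb_V M) (Suc a) @
      map (pCons 0) (shifts (cheb_S N) b) @ [])"
    by (rule coeff_det_W_block)
  also have "shifts (cheb_V M) (Suc a) =
      cheb_V M # map (pCons 0) (shifts (cheb_V M) a)"
    by (simp add: upt_conv_Cons map_Suc_upt[symmetric] monom_Suc monom_0 comp_def del: upt_Suc)
  also have "(cheb_V M # map (pCons 0) (shifts (cheb_V M) a)) @
      map (pCons 0) (shifts (cheb_S N) b) @ [] =
      cheb_V M # map (pCons 0) (shifts (cheb_V M) a @ shifts (cheb_S N) b)"
    by simp
  finally show ?thesis by (simp only: coeff_det_pCons sylvester_det_def)
qed

lemma coeff_cheb_V_0 [simp]: "coeff (cheb_V (int m)) 0 = 1"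
  by (simp add: coeff_cheb_V)

lemma coeff_cheb_S_0 [simp]: "coeff (cheb_S (int m)) 0 = of_nat m"
  by (simp add: coeff_cheb_S)

section \<open>Hankel determinants of odd powers\<close>

text \<open>
  The roots of V_t satisfy w^(2t+1) = -1. Without roots: V_(m+2t+1) + V_m is the
  folded pair V_(t+i) + V_(t-i) with i = m + t + 1.
\<close>

lemma cheb_V_dvd_shift: "cheb_V (int t) dvd cheb_V (int ((2 * t + 1) * n) + x) - smult ((-1) ^ n) (cheb_V x)"
proof (induction n)
  case (Suc n)
  let ?k = "int ((2 * t + 1) * n) + x"
  have "cheb_V (int t + (?k + int t + 1)) + cheb_V (int t - (?k + int t + 1)) =
      cheb_V (int t) * cheb_T (?k + int t + 1)"
    by (rule cheb_V_T)
  moreover have "int t + (?k + int t + 1) = int ((2 * t + 1) * Suc n) + x"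
    by (simp add: algebra_simps)
  moreover have "cheb_V (int t - (?k + int t + 1)) = cheb_V ?k"
  proof -
    have "int t - (?k + int t + 1) = - 1 - ?k" by simp
    then show ?thesis by (simp only: cheb_V_reflect)
  qed
  ultimately have 1: "cheb_V (int t) dvd cheb_V (int ((2 * t + 1) * Suc n) + x) + cheb_V ?k"
    by (metis dvd_triv_left)
  have "cheb_V (int t) dvd (cheb_V (int ((2 * t + 1) * Suc n) + x) + cheb_V ?k) -
      (cheb_V ?k - smult ((-1) ^ n) (cheb_V x))"
    using 1 Suc by (rule dvd_diff)
  then show ?case by simp
qed simp

lemma cheb_V_dvd_V: "cheb_V (int t) dvd cheb_V (int ((2 * t + 1) * n + t))"
proof -
  have "cheb_V (int t) dvd (cheb_V (int ((2 * t + 1) * n) + int t) - smult ((-1) ^ n) (cheb_V (int t))) +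
      smult ((-1) ^ n) (cheb_V (int t))"
    by (intro dvd_add cheb_V_dvd_shift dvd_smult dvd_refl)
  then show ?thesis by simp
qed

lemma cheb_V_dvd_S: "cheb_V (int t) dvd pCons 0 (cheb_S (int ((2 * t + 1) * n))) * cheb_W (int i)"
proof -
  let ?M = "int ((2 * t + 1) * n)"
  have "cheb_V (int t) dvd (cheb_V (?M + int i) - smult ((-1) ^ n) (cheb_V (int i))) -
      (cheb_V (?M + (-1 - int i)) - smult ((-1) ^ n) (cheb_V (-1 - int i)))"
    by (intro dvd_diff cheb_V_dvd_shift)
  also have "\<dots> = cheb_V (?M + int i) - cheb_V (?M - 1 - int i)"
    by (simp add: cheb_V_reflect algebra_simps)
  finally show ?thesis by (simp add: cheb_V_W)
qed

lemma cheb_V_dvd_T_block: "k \<in> set (T_block (int ((2 * t + 1) * n + t)) a) \<Longrightarrow> cheb_V (int t) dvd k"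
  unfolding T_block_def using cheb_V_dvd_V by (auto intro: dvd_mult2 simp del: of_nat_add of_nat_mult of_nat_Suc)

lemma cheb_V_dvd_W_block: "k \<in> set (W_block (int ((2 * t + 1) * n)) a) \<Longrightarrow> cheb_V (int t) dvd k"
  unfolding W_block_def using cheb_V_dvd_S by (auto simp del: of_nat_add of_nat_mult of_nat_Suc mult_pCons_left)

lemma residue_det_shift:
  "residue_det (cheb_V (int t)) (xs @ V_window (int ((2 * t + 1) * n) + x) p @ zs) =
    (-1) ^ (n * p) * residue_det (cheb_V (int t)) (xs @ V_window x p @ zs)"
proof -
  have "residue_det (cheb_V (int t)) (xs @ V_window (int ((2 * t + 1) * n) + x) p @ zs) =
      residue_det (cheb_V (int t)) (xs @ map (smult ((-1) ^ n)) (V_window x p) @ zs)"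
  proof (intro residue_det_cong list_all2_appendI)
    show "list_all2 (\<lambda>p p'. cheb_V (int t) dvd p - p') (V_window (int ((2 * t + 1) * n) + x) p)
        (map (smult ((-1) ^ n)) (V_window x p))"
      using cheb_V_dvd_shift[of t n]
      by (auto intro!: list_all2_all_nthI simp: add.assoc simp del: of_nat_add of_nat_mult)
  qed (simp_all add: list_all2_same)
  then show ?thesis
    by (simp add: residue_det_smult_map power_mult)
qed

lemma V_window_reflect: "V_window (- int p) p = rev (V_window 0 p)"
proof (rule nth_equalityI)
  fix i assume "i < length (V_window (- int p) p)"
  then have i: "i < p" by simp
  have "- int p + int i = - 1 - int (p - Suc i)"
    using i by (simp add: of_nat_diff)
  then have "V_window (- int p) p ! i = cheb_V (- 1 - int (p - Suc i))"
    using i by (simp only: nth_V_window)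
  also have "\<dots> = rev (V_window 0 p) ! i"
    using i unfolding cheb_V_reflect by (simp add: rev_nth)
  finally show "V_window (- int p) p ! i = rev (V_window 0 p) ! i" .
qed simp

lemma residue_det_eval_odd:
  assumes "length es = t" "length ks = t" "\<And>k. k \<in> set ks \<Longrightarrow> cheb_V (int t) dvd k"
  shows "residue_det (monom 1 t * cheb_V (int t)) (es @ ks) = residue_det (cheb_V (int t)) es * coeff_det ks"
  using residue_det_eval[of "cheb_V (int t)" t es ks t] cheb_V_monic[of t] assms by simp

lemma residue_det_odd_normal: "residue_det (cheb_V (int t)) (V_window 0 t) = 1"
  by (rule residue_det_V_window) (use cheb_V_monic[of t] in auto)

text \<open>
  The window runs from r n + b + 1 to r n + b + 2 t. It contains the index N = r n + t, at which it
  can be folded onto the a members before N, and the half-integral centre just below N' = r (n + 1), at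
  which its last b members can be folded onto earlier ones. Both centres produce multiples of
  V_t. The unfolded members are, modulo V_t and up to sign, V_0, ..., V_(t-1), so they contribute a sign only.
\<close>

lemma hankel_odd_lower:
  assumes t: "t = a + b + 1" and r: "r = 2 * t + 1"
  shows "hankel (r * n + (b + 1)) (catalan_power r) = (-1) ^ (n * t + ((b + 1) choose 2)) *
    sylvester_det (cheb_V (int (r * n + t))) (cheb_S (int (r * (n + 1)))) a b"
proof -
  let ?q = "monom 1 t * cheb_V (int t)" and ?v = "cheb_V (int t)"
  define x where "x = int (r * n)"
  define N where "N = int (r * n + t)"
  define N' where "N' = int (r * (n + 1))"
  define E1 where "E1 = V_window (x + int (b + 1)) a"
  define E2 where "E2 = V_window (N' - int (b + 1)) (b + 1)"
  have dvd: "?v dvd k" if "k \<in> set (T_block N (Suc a)) \<or> k \<in> set (W_block N' b)" for k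
    using that cheb_V_dvd_T_block[of k t n "Suc a"] cheb_V_dvd_W_block[of k t "n + 1" b]
    unfolding N_def N'_def r by blast
  \<comment> \<open>E1 and E2 remain; the block between them is folded at N, the last block just below the index N'.\<close>
  have win: "V_window (int (r * n + (b + 1))) (2 * t) = E1 @ V_window N (Suc a) @ E2 @ V_window N' b"
  proof -
    have "2 * t = a + (Suc a + (Suc b + b))" using t by simp
    then show ?thesis
      by (simp only: V_window_append)
        (simp add: E1_def E2_def x_def N_def N'_def t r algebra_simps)
  qed
  have "hankel (r * n + (b + 1)) (catalan_power r) = residue_det ?q (E1 @ V_window N (Suc a) @ E2 @ V_window N' b)"
    unfolding r hankel_odd_christoffel win[unfolded r] ..
  also have "\<dots> = residue_det ?q (E1 @ T_block N (Suc a) @ E2 @ V_window N' b)"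
  proof (rule T_block_replace)
    have "N - int a = x + int (b + 1)" by (simp add: N_def x_def t)
    then show "V_window (N - int a) a = E1" by (simp only: E1_def)
  qed auto
  also have "\<dots> = residue_det ?q ((E1 @ T_block N (Suc a) @ E2) @ V_window N' b @ [])"
    by simp
  also have "\<dots> = residue_det ?q ((E1 @ T_block N (Suc a) @ E2) @ W_block N' b @ [])"
  proof (rule W_block_replace)
    have "E2 = V_window (N' - int (b + 1)) 1 @ V_window (N' - int b) b"
      unfolding E2_def add.commute[of b 1] V_window_append by simp
    then show "set (V_window (N' - int b) b) \<subseteq> set (E1 @ T_block N (Suc a) @ E2) \<union> set []"
      by auto
  qed
  also have "\<dots> = residue_det ?q (E1 @ T_block N (Suc a) @ E2 @ W_block N' b)"
    by simp
  also have "\<dots> = (-1) ^ (Suc a * (b + 1)) * residue_det ?q ((E1 @ E2) @ (T_block N (Suc a) @ W_block N' b))"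
    by (subst residue_det_swap_blocks) (simp add: E2_def)
  also have "residue_det ?q ((E1 @ E2) @ (T_block N (Suc a) @ W_block N' b)) =
      residue_det ?v (E1 @ E2) * coeff_det (T_block N (Suc a) @ W_block N' b)"
    by (rule residue_det_eval_odd)
      (auto simp: E1_def E2_def t[symmetric] intro: dvd, simp_all add: t)
  also have "coeff_det (T_block N (Suc a) @ W_block N' b) = sylvester_det (cheb_V N) (cheb_S N') a b"
    by (subst coeff_det_T_block_W_block) (simp add: N_def del: of_nat_add of_nat_mult)
  also have "residue_det ?v (E1 @ E2) = (-1) ^ (n * a + (n + 1) * (b + 1) + ((b + 1) choose 2) + a * (b + 1))"
  proof -
    have e2: "E2 = V_window (int ((2 * t + 1) * (n + 1)) + (- int (b + 1))) (b + 1)"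
      by (simp add: E2_def N'_def r algebra_simps)
    have "residue_det ?v (E1 @ E2) = (-1) ^ (n * a) * residue_det ?v (V_window (int (b + 1)) a @ E2 @ [])"
      using residue_det_shift[of t "[]" n "int (b + 1)" a E2]
      by (simp add: E1_def x_def r del: of_nat_add of_nat_mult)
    also have "residue_det ?v (V_window (int (b + 1)) a @ E2 @ []) =
        (-1) ^ ((n + 1) * (b + 1)) * residue_det ?v (V_window (int (b + 1)) a @ V_window (- int (b + 1)) (b + 1) @ [])"
      unfolding e2 by (rule residue_det_shift)
    also have "residue_det ?v (V_window (int (b + 1)) a @ V_window (- int (b + 1)) (b + 1) @ []) =
        (-1) ^ ((b + 1) choose 2) * residue_det ?v ([] @ V_window (int (b + 1)) a @ V_window 0 (b + 1) @ [])"
      unfolding V_window_reflect by (subst residue_det_rev) simp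
    also have "residue_det ?v ([] @ V_window (int (b + 1)) a @ V_window 0 (b + 1) @ []) =
        (-1) ^ (a * (b + 1)) * residue_det ?v ([] @ V_window 0 (b + 1) @ V_window (int (b + 1)) a @ [])"
      by (subst residue_det_swap_blocks) simp
    also have "[] @ V_window 0 (b + 1) @ V_window (int (b + 1)) a @ [] = V_window 0 t"
      using V_window_append[of 0 "b + 1" a] by (simp add: t algebra_simps)
    finally show ?thesis
      by (simp add: residue_det_odd_normal power_add)
  qed
  finally have "hankel (r * n + (b + 1)) (catalan_power r) =
      (-1) ^ (Suc a * (b + 1) + (n * a + (n + 1) * (b + 1) + ((b + 1) choose 2) + a * (b + 1))) *
      sylvester_det (cheb_V N) (cheb_S N') a b"
    by (simp add: power_add)
  also have "(-1) ^ (Suc a * (b + 1) + (n * a + (n + 1) * (b + 1) + ((b + 1) choose 2) + a * (b + 1))) =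
      ((-1) ^ (n * t + ((b + 1) choose 2)) :: rat)"
    by (rule minus_one_power_eqI) (simp add: t, blast)
  finally show ?thesis by (simp only: N_def N'_def)
qed

text \<open>
  As before, but the window is now folded first just below N' = r (n + 1) and then at N = N' + t.
\<close>

lemma hankel_odd_upper:
  assumes t: "t = a + b + 1" and r: "r = 2 * t + 1"
  shows "hankel (r * (n + 1) - b) (catalan_power r) = (-1) ^ (n * t + t + (b choose 2)) *
    sylvester_det (cheb_V (int (r * (n + 1) + t))) (cheb_S (int (r * (n + 1)))) a b"
proof -
  let ?q = "monom 1 t * cheb_V (int t)" and ?v = "cheb_V (int t)"
  define N' where "N' = int (r * (n + 1))"
  define N where "N = int (r * (n + 1) + t)"
  define E1 where "E1 = V_window (N' - int b) b"
  define E2 where "E2 = V_window (N' + int b) (Suc a)"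
  have le: "b \<le> r * (n + 1)" using t r by simp
  have dvd: "?v dvd k" if "k \<in> set (T_block N (Suc a)) \<or> k \<in> set (W_block N' b)" for k
    using that cheb_V_dvd_T_block[of k t "n + 1" "Suc a"] cheb_V_dvd_W_block[of k t "n + 1" b]
    unfolding N_def N'_def r by blast
  \<comment> \<open>E1 and E2 remain; the block between them is folded just below the index N', the last block at N.\<close>
  have win: "V_window (int (r * (n + 1) - b)) (2 * t) = E1 @ V_window N' b @ E2 @ V_window N (Suc a)"
  proof -
    have "2 * t = b + (b + (Suc a + Suc a))" using t by simp
    then show ?thesis
      by (simp only: V_window_append of_nat_diff[OF le])
        (simp add: E1_def E2_def N_def N'_def t algebra_simps)
  qed
  have "hankel (r * (n + 1) - b) (catalan_power r) = residue_det ?q (E1 @ V_window N' b @ E2 @ V_window N (Suc a))"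
    unfolding r hankel_odd_christoffel win[unfolded r] ..
  also have "\<dots> = residue_det ?q (E1 @ W_block N' b @ E2 @ V_window N (Suc a))"
    by (rule W_block_replace) (auto simp: E1_def)
  also have "\<dots> = residue_det ?q ((E1 @ W_block N' b @ E2) @ V_window N (Suc a) @ [])"
    by simp
  also have "\<dots> = residue_det ?q ((E1 @ W_block N' b @ E2) @ T_block N (Suc a) @ [])"
  proof (rule T_block_replace)
    have "E2 = V_window (N' + int b) 1 @ V_window (N - int a) a"
      unfolding E2_def Suc_eq_plus1_left V_window_append by (simp add: N_def N'_def t algebra_simps)
    then show "set (V_window (N - int a) a) \<subseteq> set (E1 @ W_block N' b @ E2) \<union> set []"
      by auto
  qed simp
  also have "\<dots> = residue_det ?q (E1 @ W_block N' b @ E2 @ T_block N (Suc a))"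
    by simp
  also have "\<dots> = (-1) ^ (b * Suc a) * residue_det ?q (E1 @ E2 @ W_block N' b @ T_block N (Suc a))"
    by (subst residue_det_swap_blocks) (simp add: E2_def)
  also have "residue_det ?q (E1 @ E2 @ W_block N' b @ T_block N (Suc a)) = 
      (-1) ^ (b * Suc a) * residue_det ?q ((E1 @ E2) @ (T_block N (Suc a) @ W_block N' b))"
    using residue_det_swap_blocks[of ?q "E1 @ E2" "W_block N' b" "T_block N (Suc a)" "[]"] by simp
  also have "residue_det ?q ((E1 @ E2) @ (T_block N (Suc a) @ W_block N' b)) =
      residue_det ?v (E1 @ E2) * coeff_det (T_block N (Suc a) @ W_block N' b)"
    by (rule residue_det_eval_odd)
      (auto simp: E1_def E2_def t[symmetric] intro: dvd, simp_all add: t)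
  also have "coeff_det (T_block N (Suc a) @ W_block N' b) = sylvester_det (cheb_V N) (cheb_S N') a b"
    by (subst coeff_det_T_block_W_block) (simp add: N_def del: of_nat_add of_nat_mult)
  also have "residue_det ?v (E1 @ E2) = (-1) ^ ((n + 1) * b + (n + 1) * Suc a + (b choose 2))"
  proof -
    have e2: "E2 = V_window (int ((2 * t + 1) * (n + 1)) + int b) (Suc a)"
      by (simp add: E2_def N'_def r)
    have "residue_det ?v (E1 @ E2) = (-1) ^ ((n + 1) * b) * residue_det ?v (V_window (- int b) b @ E2 @ [])"
      using residue_det_shift[of t "[]" "n + 1" "- int b" b E2]
      by (simp add: E1_def N'_def r del: of_nat_add of_nat_mult)
    also have "residue_det ?v (V_window (- int b) b @ E2 @ []) =
        (-1) ^ ((n + 1) * Suc a) * residue_det ?v ([] @ V_window (- int b) b @ V_window (int b) (Suc a))"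
      unfolding e2 by (subst residue_det_shift) simp
    also have "residue_det ?v ([] @ V_window (- int b) b @ V_window (int b) (Suc a)) =
        (-1) ^ (b choose 2) * residue_det ?v ([] @ V_window 0 b @ V_window (int b) (Suc a))"
      unfolding V_window_reflect by (subst residue_det_rev) simp
    also have "[] @ V_window 0 b @ V_window (int b) (Suc a) = V_window 0 t"
      using V_window_append[of 0 b "Suc a"] by (simp add: t algebra_simps)
    finally show ?thesis
      by (simp add: residue_det_odd_normal power_add)
  qed
  finally have "hankel (r * (n + 1) - b) (catalan_power r) =
      (-1) ^ (b * Suc a + (b * Suc a + ((n + 1) * b + (n + 1) * Suc a + (b choose 2)))) *
      sylvester_det (cheb_V N) (cheb_S N') a b"
    by (simp add: power_add)
  also have "(-1) ^ (b * Suc a + (b * Suc a + ((n + 1) * b + (n + 1) * Suc a + (b choose 2)))) =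
      ((-1) ^ (n * t + t + (b choose 2)) :: rat)"
    by (rule minus_one_power_eqI) (simp add: t, blast)
  finally show ?thesis by (simp only: N_def N'_def)
qed

text \<open>
  The window starts right after a half-integral centre, so that all folding takes place at r n + t.
\<close>

lemma hankel_odd_multiple:
  assumes r: "r = 2 * t + 1"
  shows "hankel (r * n) (catalan_power r) = (-1) ^ (n * t)"
proof (cases t)
  case 0
  then show ?thesis
    using residue_det_eval_odd[of "[]" 0 "[]"]
    by (simp add: r hankel_odd_christoffel[of _ 0, simplified] V_window_def residue_det_def)
next
  case (Suc a)
  let ?q = "monom 1 t * cheb_V (int t)" and ?v = "cheb_V (int t)"
  define N where "N = int (r * n + t)"
  define E where "E = V_window (int (r * n)) t"
  have "V_window (int (r * n)) (2 * t) = E @ V_window N t"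
    using V_window_append[of "int (r * n)" t t] by (simp add: E_def N_def mult_2)
  then have "hankel (r * n) (catalan_power r) = residue_det ?q (E @ V_window N (Suc a) @ [])"
    unfolding r hankel_odd_christoffel by (simp add: Suc)
  also have "\<dots> = residue_det ?q (E @ T_block N (Suc a) @ [])"
  proof (rule T_block_replace)
    have "E = V_window (int (r * n)) 1 @ V_window (N - int a) a"
      unfolding E_def Suc Suc_eq_plus1_left V_window_append by (simp add: N_def Suc algebra_simps)
    then show "set (V_window (N - int a) a) \<subseteq> set E \<union> set []"
      by auto
  qed simp
  also have "\<dots> = residue_det ?v E * coeff_det (T_block N (Suc a) @ [])"
    by (rule residue_det_eval_odd)
      (use cheb_V_dvd_T_block[of _ t n "Suc a"] in \<open>simp_all add: E_def N_def r Suc del: of_nat_add of_nat_mult of_nat_Suc\<close>)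
  also have "residue_det ?v E = (-1) ^ (n * t)"
    using residue_det_shift[of t "[]" n 0 t "[]"]
    by (simp add: E_def r residue_det_odd_normal del: of_nat_add of_nat_mult)
  also have "coeff_det (T_block N (Suc a) @ []) = 1"
    using coeff_det_T_block_W_block[of N a 0 0]
    by (simp add: W_block_def sylvester_det_zero_right N_def del: of_nat_add of_nat_mult)
  finally show ?thesis by simp
qed

text \<open>
  All folding takes place at the half-integral centre, so that every multiple of V_t that arises is also
  divisible by y.
\<close>

lemma hankel_odd_zero:
  assumes r: "r = 2 * t + 1" and t: "t \<ge> 1"
  shows "hankel (r * n + t + 1) (catalan_power r) = 0"
proof -
  let ?q = "monom 1 t * cheb_V (int t)" and ?v = "cheb_V (int t)"
  define N' where "N' = int (r * (n + 1))"
  define E where "E = V_window (int (r * n + t + 1)) t"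
  have N': "int (r * n + t + 1) + int t = N'"
    by (simp add: N'_def r algebra_simps)
  have "V_window (int (r * n + t + 1)) (2 * t) = E @ V_window N' t"
    unfolding mult_2 V_window_append N' E_def ..
  then have "hankel (r * n + t + 1) (catalan_power r) = residue_det ?q (E @ V_window N' t @ [])"
    unfolding r hankel_odd_christoffel by simp
  also have "\<dots> = residue_det ?q (E @ W_block N' t @ [])"
    by (rule W_block_replace) (auto simp: E_def N'_def r algebra_simps)
  also have "\<dots> = residue_det ?v E * coeff_det (W_block N' t @ [])"
    by (rule residue_det_eval_odd)
      (use cheb_V_dvd_W_block[of _ t "n + 1" t] in \<open>simp_all add: E_def N'_def r del: of_nat_add of_nat_mult of_nat_Suc\<close>)
  also have "coeff_det (W_block N' t @ []) = 0"
  proof -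
    obtain s where s: "t = Suc s" using t by (cases t) auto
    have "coeff_det (W_block N' t @ []) = coeff_det ([] @ W_block N' t @ [])" by simp
    also have "\<dots> = coeff_det (map (pCons 0) (shifts (cheb_S N') (Suc s)))"
      by (subst coeff_det_W_block) (simp add: s)
    also have "map (pCons 0) (map f [0..<Suc s]) = pCons 0 (f 0) # map (pCons 0) (map f [1..<Suc s])"
      for f :: "nat \<Rightarrow> rat poly"
      by (simp add: upt_conv_Cons del: upt_Suc)
    finally show ?thesis by (simp only: coeff_det_pCons) simp
  qed
  finally show ?thesis by simp
qed

section \<open>Hankel determinants of even powers\<close>

lemma cheb_S_dvd_multiple: "cheb_S (int t) dvd cheb_S (int (t * k))"
proof -
  have "cheb_S (int t) dvd cheb_S (int (t * k)) \<and> cheb_S (int t) dvd cheb_S (int (t * Suc k))"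
  proof (induction k)
    case (Suc k)
    let ?M = "int (t * Suc k)"
    have "cheb_S (?M + int t) + cheb_S (?M - int t) = cheb_S ?M * cheb_T (int t)"
      by (rule cheb_S_T)
    moreover have "?M + int t = int (t * Suc (Suc k))" "?M - int t = int (t * k)"
      by (simp_all add: algebra_simps)
    ultimately have "cheb_S (int (t * Suc (Suc k))) = cheb_S ?M * cheb_T (int t) - cheb_S (int (t * k))"
      by (simp add: algebra_simps)
    then show ?case using Suc by (metis dvd_diff dvd_mult2)
  qed simp
  then show ?thesis ..
qed

text \<open>
  The roots of S_t satisfy w^(2t) = 1. So there is a centre of reflection just below every multiple of t.
\<close>

lemma cheb_S_dvd_reflect: "cheb_S (int t) dvd cheb_V (int (t * k) + x) - cheb_V (int (t * k) - 1 - x)"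
proof -
  have "cheb_V (int (t * k) + x) - cheb_V (int (t * k) - 1 - x) = cheb_S (int (t * k)) * pCons 0 (cheb_W x)"
    by (simp add: cheb_V_W del: of_nat_mult)
  then show ?thesis using cheb_S_dvd_multiple by (metis dvd_mult2)
qed

lemma cheb_S_dvd_W_block: "k \<in> set (W_block (int (t * m)) a) \<Longrightarrow> cheb_S (int t) dvd k"
proof -
  assume "k \<in> set (W_block (int (t * m)) a)"
  then obtain i where "k = cheb_S (int (t * m)) * pCons 0 (cheb_W (int i))"
    by (auto simp: W_block_def simp del: of_nat_mult)
  then show ?thesis using cheb_S_dvd_multiple by (metis dvd_mult2)
qed

lemma sum_cheb_V: "(\<Sum>i<t. cheb_V (x + int i)) = cheb_S (x + int t) - cheb_S x"
  by (induction t) (simp_all add: cheb_V_def algebra_simps)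

lemma residue_det_reflect:
  "residue_det (cheb_S (int t)) (xs @ V_window (int (t * k) + x) p @ zs) =
    (-1) ^ (p choose 2) * residue_det (cheb_S (int t)) (xs @ V_window (int (t * k) - x - int p) p @ zs)"
proof -
  have "residue_det (cheb_S (int t)) (xs @ V_window (int (t * k) + x) p @ zs) =
      residue_det (cheb_S (int t)) (xs @ rev (V_window (int (t * k) - x - int p) p) @ zs)"
  proof (intro residue_det_cong list_all2_appendI list_all2_all_nthI)
    fix i assume "i < length (V_window (int (t * k) + x) p)"
    then have i: "i < p" by simp
    have "int (t * k) - x - int p + int (p - Suc i) = int (t * k) - 1 - (x + int i)"
      using i by (simp add: of_nat_diff)
    moreover have "rev (V_window (int (t * k) - x - int p) p) ! i =
        cheb_V (int (t * k) - x - int p + int (p - Suc i))"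
      using i by (simp only: rev_nth length_V_window nth_V_window diff_less)
    ultimately have "rev (V_window (int (t * k) - x - int p) p) ! i = cheb_V (int (t * k) - 1 - (x + int i))"
      by (simp only:)
    moreover have "V_window (int (t * k) + x) p ! i = cheb_V (int (t * k) + (x + int i))"
      using i by (simp add: add.assoc)
    ultimately show "cheb_S (int t) dvd V_window (int (t * k) + x) p ! i - rev (V_window (int (t * k) - x - int p) p) ! i"
      by (simp only: cheb_S_dvd_reflect)
  qed (simp_all add: list_all2_same)
  then show ?thesis by (simp only: residue_det_rev length_V_window)
qed

lemma cheb_S_neq_0: "cheb_S (int (Suc m)) \<noteq> 0"
  using cheb_S_monic[of m] by (metis coeff_0 zero_neq_one)

text \<open>
  One more polynomial than fits modulo S_t is available, with the single relation
  V_0 + ... + V_(t-1) = S_t. It expresses V_(t-1) by the others, which changes the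
  omitted member from V_a to V_(t-1).
\<close>

lemma residue_det_even_omit_0:
  assumes "t = a + b + 1"
  shows "residue_det (cheb_S (int t)) (V_window 0 a @ V_window (int a + 1) b) = (-1) ^ b"
proof (cases b)
  case 0
  then have t: "t = Suc a" and w: "V_window (int a + 1) b = []"
    using assms by (simp_all add: V_window_def)
  show ?thesis
    unfolding t w using residue_det_V_window[of "cheb_S (int (Suc a))" a] cheb_S_monic[of a] cheb_S_neq_0[of a]
    by (simp add: 0 del: of_nat_Suc)
next
  case (Suc b')
  let ?v = "cheb_S (int t)"
  let ?xs = "V_window 0 a @ V_window (int a + 1) b'"
  let ?I = "{..<t - 1} - {a}"
  let ?s = "smult (-1) (cheb_V (int a)) + (\<Sum>i\<in>?I. smult (-1) (cheb_V (int i)))"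
  have t: "t = Suc (a + Suc b')" using assms Suc by simp
  have "cheb_V (int (t - 1)) - ?s = (\<Sum>i<t. cheb_V (int i))"
  proof -
    have "(\<Sum>i<t. cheb_V (int i)) = (\<Sum>i<t - 1. cheb_V (int i)) + cheb_V (int (t - 1))"
      by (simp add: t)
    also have "(\<Sum>i<t - 1. cheb_V (int i)) = cheb_V (int a) + (\<Sum>i\<in>?I. cheb_V (int i))"
      by (rule sum.remove) (auto simp: t)
    finally show ?thesis by (simp add: sum_negf)
  qed
  also have "\<dots> = ?v"
    using sum_cheb_V[of 0 t] by simp
  finally have dvd: "?v dvd cheb_V (int (t - 1)) - ?s" by simp
  have "V_window (int a + 1) b = V_window (int a + 1) b' @ [cheb_V (int (t - 1))]"
    using V_window_append[of "int a + 1" b' 1] by (simp add: Suc V_window_1 t algebra_simps)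
  then have "residue_det ?v (V_window 0 a @ V_window (int a + 1) b) = residue_det ?v (?xs @ [cheb_V (int (t - 1))])"
    by simp
  also have "\<dots> = residue_det ?v (?xs @ [?s])"
    by (rule residue_det_cong, rule list_all2_appendI) (use dvd in \<open>simp_all add: list_all2_same\<close>)
  also have "\<dots> = residue_det ?v (?xs @ [smult (-1) (cheb_V (int a))])"
  proof (rule residue_det_add_dependent)
    fix i assume i: "i \<in> ?I"
    show "cheb_V (int i) \<in> set ?xs \<union> set []"
      using i in_V_window[of 0 "int i" a] in_V_window[of "int a + 1" "int i" b']
      by (cases "i < a") (auto simp: t)
  qed simp
  also have "\<dots> = - residue_det ?v (?xs @ [cheb_V (int a)])"
    using residue_det_smult_map[of ?v ?xs "-1" "[cheb_V (int a)]" "[]"] by simp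
  also have "residue_det ?v (?xs @ [cheb_V (int a)]) =
      (-1) ^ b' * residue_det ?v (V_window 0 a @ [cheb_V (int a)] @ V_window (int a + 1) b' @ [])"
    using residue_det_swap_blocks[of ?v "V_window 0 a" "V_window (int a + 1) b'" "[cheb_V (int a)]" "[]"] by simp
  also have "V_window 0 a @ [cheb_V (int a)] @ V_window (int a + 1) b' @ [] = V_window 0 (t - 1)"
  proof -
    have "t - 1 = a + (1 + b')" by (simp add: t)
    then show ?thesis by (simp only: V_window_append) (simp add: V_window_1)
  qed
  also have "residue_det ?v (V_window 0 (t - 1)) = 1"
    using residue_det_V_window[of ?v "t - 1"] cheb_S_monic[of "t - 1"] cheb_S_neq_0[of "t - 1"]
    by (simp add: t)
  finally show ?thesis by (simp add: Suc)
qed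

text \<open>
  Reflection moves the windows down by t and interchanges the roles of a and b.
\<close>

lemma residue_det_even_omit:
  assumes "t = a + b + 1"
  shows "residue_det (cheb_S (int t)) (V_window (int (t * n)) a @ V_window (int (t * n) + int a + 1) b) =
    (-1) ^ (n * (t choose 2) + b)"
  using assms
proof (induction n arbitrary: a b)
  case 0
  then show ?case using residue_det_even_omit_0[of t a b] by simp
next
  case (Suc n)
  let ?v = "cheb_S (int t)" and ?M = "int (t * Suc n)"
  have "residue_det ?v (V_window ?M a @ V_window (?M + int a + 1) b) =
      (-1) ^ (a choose 2) * residue_det ?v (V_window (?M - int a) a @ V_window (?M + (int a + 1)) b @ [])"
    using residue_det_reflect[of t "[]" "Suc n" 0 a "V_window (?M + int a + 1) b"]
    by (simp add: add.assoc del: of_nat_mult)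
  also have "residue_det ?v (V_window (?M - int a) a @ V_window (?M + (int a + 1)) b @ []) =
      (-1) ^ (b choose 2) * residue_det ?v ([] @ V_window (?M - int a) a @ V_window (?M - (int a + 1) - int b) b @ [])"
    by (subst residue_det_reflect) simp
  also have "residue_det ?v ([] @ V_window (?M - int a) a @ V_window (?M - (int a + 1) - int b) b @ []) =
      (-1) ^ (a * b) * residue_det ?v (V_window (?M - (int a + 1) - int b) b @ V_window (?M - int a) a)"
    by (subst residue_det_swap_blocks) simp
  also have "?M - (int a + 1) - int b = int (t * n)"
    using Suc.prems by (simp add: algebra_simps)
  also have "?M - int a = int (t * n) + int b + 1"
    using Suc.prems by (simp add: algebra_simps)
  also have "residue_det ?v (V_window (int (t * n)) b @ V_window (int (t * n) + int b + 1) a) =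
      (-1) ^ (n * (t choose 2) + a)"
    by (rule Suc.IH) (use Suc.prems in simp)
  finally have "residue_det ?v (V_window ?M a @ V_window (?M + int a + 1) b) =
      (-1) ^ ((a choose 2) + ((b choose 2) + (a * b + (n * (t choose 2) + a))))"
    by (simp add: power_add)
  also have "(-1) ^ ((a choose 2) + ((b choose 2) + (a * b + (n * (t choose 2) + a)))) =
      ((-1) ^ (Suc n * (t choose 2) + b) :: rat)"
  proof (rule minus_one_power_eqI)
    have "t choose 2 = (a choose 2) + (b choose 2) + a * b + a + b"
      using choose_two_add[of "a + b" 1] choose_two_add[of a b] Suc.prems
      by (simp add: numeral_2_eq_2)
    then show "even ((a choose 2) + ((b choose 2) + (a * b + (n * (t choose 2) + a))) + (Suc n * (t choose 2) + b))"
      by (cases "even a"; cases "even b"; cases "even n"; cases "even (a choose 2)"; simp)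
  qed
  finally show ?case .
qed

lemma residue_det_eval_even:
  assumes "t \<ge> 1" "length es = t - 1" "length ks = t" "\<And>k. k \<in> set ks \<Longrightarrow> cheb_S (int t) dvd k"
  shows "of_nat t ^ t * residue_det (monom 1 t * cheb_S (int t)) (es @ ks) =
    residue_det (cheb_S (int t)) es * coeff_det ks"
  using residue_det_eval[of "cheb_S (int t)" "t - 1" es ks t] cheb_S_monic[of "t - 1"] assms by simp

text \<open>
  The window of 2 t - 1 members contains the two half-integral centres just below M = t (n + 1) and
  N = t (n + 2). Folding there uses all members but V_(M+a), and yields a + b = t - 1 multiples of S_t. The missing one is
  the sum of all V_(M+i) with i < t, which equals S_N - S_M.
\<close>

lemma hankel_even_shift:
  assumes t: "t = a + b + 1"
  shows "of_nat t ^ (t - 1) * hankel (t * n + (b + 1)) (catalan_power (2 * t)) =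
    (-1) ^ (n * (t choose 2) + ((b + 1) choose 2)) *
    sylvester_det (cheb_S (int (t * (n + 1)))) (cheb_S (int (t * (n + 2)))) a b"
proof -
  let ?q = "monom 1 t * cheb_S (int t)" and ?v = "cheb_S (int t)"
  define M where "M = int (t * (n + 1))"
  define N where "N = int (t * (n + 2))"
  define E1 where "E1 = V_window (M - int a) a"
  define E2 where "E2 = V_window (M + int a + 1) b"
  define X where "X = cheb_V (M + int a)"
  define Y where "Y = cheb_S N - cheb_S M"
  define K1 where "K1 = V_window M a"
  define K2 where "K2 = V_window N b"
  let ?I = "{..<t} - {a}"
  have MN: "M + int t = N" by (simp add: M_def N_def algebra_simps)
  have Y: "Y = X + (\<Sum>i\<in>?I. smult 1 (cheb_V (M + int i)))"
  proof -
    have "Y = (\<Sum>i<t. cheb_V (M + int i))"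
      unfolding sum_cheb_V Y_def MN ..
    also have "\<dots> = cheb_V (M + int a) + (\<Sum>i\<in>?I. cheb_V (M + int i))"
      by (rule sum.remove) (auto simp: t)
    finally show ?thesis by (simp add: X_def)
  qed
  have dvd: "?v dvd k" if "k \<in> set (W_block M a @ [Y] @ W_block N b)" for k
    using that cheb_S_dvd_W_block[of k t "n + 1" a] cheb_S_dvd_W_block[of k t "n + 2" b]
      cheb_S_dvd_multiple[of t "n + 1"] cheb_S_dvd_multiple[of t "n + 2"]
    unfolding M_def N_def Y_def by (auto simp del: of_nat_mult of_nat_add intro: dvd_diff)
  \<comment> \<open>E1 and E2 remain; K1 and K2 are folded just below M and N, and X takes no part in the folding.\<close>
  have win: "V_window (int (t * n + (b + 1))) (2 * t - 1) = E1 @ K1 @ X # (E2 @ K2)"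
  proof -
    have "2 * t - 1 = a + (a + (Suc 0 + (b + b)))" using t by simp
    then show ?thesis
      by (simp only: V_window_append)
        (simp add: V_window_1 E1_def E2_def K1_def K2_def X_def M_def N_def t algebra_simps)
  qed
  have "hankel (t * n + (b + 1)) (catalan_power (2 * t)) = residue_det ?q ((E1 @ K1) @ X # (E2 @ K2))"
    using hankel_even_christoffel[of t "t * n + (b + 1)"] t unfolding win by simp
  also have "\<dots> = residue_det ?q ((E1 @ K1) @ Y # (E2 @ K2))"
    unfolding Y
  proof (rule residue_det_add_dependent[symmetric])
    fix i assume i: "i \<in> ?I"
    then show "cheb_V (M + int i) \<in> set (E1 @ K1) \<union> set (E2 @ K2)"
      using in_V_window[of M "M + int i" a] in_V_window[of "M + int a + 1" "M + int i" b]
      by (cases "i < a") (auto simp: t K1_def E2_def)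
  qed simp
  also have "\<dots> = residue_det ?q (E1 @ V_window M a @ ([Y] @ E2 @ K2))"
    by (simp add: K1_def)
  also have "\<dots> = residue_det ?q (E1 @ W_block M a @ ([Y] @ E2 @ K2))"
    by (rule W_block_replace) (auto simp: E1_def)
  also have "\<dots> = residue_det ?q ((E1 @ W_block M a @ [Y] @ E2) @ V_window N b @ [])"
    by (simp add: K2_def)
  also have "\<dots> = residue_det ?q ((E1 @ W_block M a @ [Y] @ E2) @ W_block N b @ [])"
  proof (rule W_block_replace)
    have "N - int b = M + int a + 1" by (simp add: t flip: MN)
    then have "V_window (N - int b) b = E2" by (simp only: E2_def)
    then show "set (V_window (N - int b) b) \<subseteq> set (E1 @ W_block M a @ [Y] @ E2) \<union> set []" by auto
  qed
  also have "\<dots> = residue_det ?q (E1 @ (W_block M a @ [Y]) @ E2 @ W_block N b)"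
    by simp
  also have "\<dots> = (-1) ^ (Suc a * b) * residue_det ?q ((E1 @ E2) @ (W_block M a @ [Y] @ W_block N b))"
    by (subst residue_det_swap_blocks) (simp add: E2_def)
  finally have "of_nat t ^ t * hankel (t * n + (b + 1)) (catalan_power (2 * t)) =
      (-1) ^ (Suc a * b) * (of_nat t ^ t * residue_det ?q ((E1 @ E2) @ (W_block M a @ [Y] @ W_block N b)))"
    by simp
  also have "of_nat t ^ t * residue_det ?q ((E1 @ E2) @ (W_block M a @ [Y] @ W_block N b)) =
      residue_det ?v (E1 @ E2) * coeff_det (W_block M a @ [Y] @ W_block N b)"
    by (rule residue_det_eval_even) (use dvd t in \<open>auto simp: E1_def E2_def\<close>)
  also have "coeff_det (W_block M a @ [Y] @ W_block N b) =
      (-1) ^ a * (of_nat t * sylvester_det (cheb_S M) (cheb_S N) a b)"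
  proof -
    have "coeff_det (W_block M a @ [Y] @ W_block N b) = (-1) ^ a * coeff_det ([Y] @ W_block M a @ W_block N b)"
      using coeff_det_swap_blocks[of "[]" "W_block M a" "[Y]" "W_block N b"] by simp
    moreover have "coeff Y 0 = of_nat t"
      unfolding Y_def M_def N_def coeff_diff coeff_cheb_S_0 by (simp add: algebra_simps)
    ultimately show ?thesis by (simp add: coeff_det_W_block_W_block del: append_Cons append_Nil)
  qed
  also have "residue_det ?v (E1 @ E2) = (-1) ^ ((a choose 2) + ((n + 1) * (t choose 2) + b))"
  proof -
    have "residue_det ?v (E1 @ E2) = (-1) ^ (a choose 2) * residue_det ?v (V_window M a @ E2)"
      using residue_det_reflect[of t "[]" "n + 1" "- int a" a E2]
      by (simp add: E1_def M_def del: of_nat_mult of_nat_add)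
    also have "residue_det ?v (V_window M a @ E2) = (-1) ^ ((n + 1) * (t choose 2) + b)"
      unfolding E2_def M_def by (rule residue_det_even_omit[OF t])
    finally show ?thesis by (simp add: power_add)
  qed
  finally have "of_nat t ^ t * hankel (t * n + (b + 1)) (catalan_power (2 * t)) =
      (-1) ^ (Suc a * b + ((a choose 2) + ((n + 1) * (t choose 2) + b) + a)) *
      (of_nat t * sylvester_det (cheb_S M) (cheb_S N) a b)"
    by (simp only: power_add mult_ac)
  also have "(-1) ^ (Suc a * b + ((a choose 2) + ((n + 1) * (t choose 2) + b) + a)) =
      ((-1) ^ (n * (t choose 2) + ((b + 1) choose 2)) :: rat)"
  proof (rule minus_one_power_eqI)
    have "t choose 2 = (a choose 2) + ((b + 1) choose 2) + a * (b + 1)"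
      using choose_two_add[of a "b + 1"] t by simp
    then show "even (Suc a * b + ((a choose 2) + ((n + 1) * (t choose 2) + b) + a) +
        (n * (t choose 2) + ((b + 1) choose 2)))"
      by simp blast
  qed
  finally have "of_nat t * (of_nat t ^ (t - 1) * hankel (t * n + (b + 1)) (catalan_power (2 * t))) =
      of_nat t * ((-1) ^ (n * (t choose 2) + ((b + 1) choose 2)) * sylvester_det (cheb_S M) (cheb_S N) a b)"
    using power_Suc[of "of_nat t :: rat" "t - 1"] t by (simp add: mult_ac)
  then show ?thesis unfolding M_def N_def using t by simp
qed

text \<open>
  Here the missing multiple of S_t comes from the sum that starts at the first member of the window.
\<close>

lemma hankel_even_multiple:
  assumes t: "t \<ge> 1"
  shows "hankel (t * n) (catalan_power (2 * t)) = (-1) ^ (n * (t choose 2)) * of_nat (n + 1) ^ (t - 1)"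
proof -
  let ?q = "monom 1 t * cheb_S (int t)" and ?v = "cheb_S (int t)"
  define M where "M = int (t * n)"
  define N where "N = int (t * (n + 1))"
  define E where "E = V_window (M + 1) (t - 1)"
  define K where "K = V_window N (t - 1)"
  define Y where "Y = cheb_S N - cheb_S M"
  let ?I = "{..<t} - {0}"
  have MN: "M + int t = N" by (simp add: M_def N_def algebra_simps)
  have Y: "Y = cheb_V M + (\<Sum>i\<in>?I. smult 1 (cheb_V (M + int i)))"
  proof -
    have "Y = (\<Sum>i<t. cheb_V (M + int i))"
      unfolding sum_cheb_V Y_def MN ..
    also have "\<dots> = cheb_V (M + int 0) + (\<Sum>i\<in>?I. cheb_V (M + int i))"
      by (rule sum.remove) (use t in auto)
    finally show ?thesis by simp
  qed
  have dvd: "?v dvd k" if "k \<in> set ([Y] @ W_block N (t - 1))" for k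
    using that cheb_S_dvd_W_block[of k t "n + 1" "t - 1"]
      cheb_S_dvd_multiple[of t "n + 1"] cheb_S_dvd_multiple[of t n]
    unfolding M_def N_def Y_def by (auto simp del: of_nat_mult of_nat_add intro: dvd_diff)
  have win: "V_window M (2 * t - 1) = [] @ cheb_V M # (E @ K)"
  proof -
    have e: "2 * t - 1 = Suc 0 + ((t - 1) + (t - 1))" using t by simp
    have "M + int (Suc 0) + int (t - 1) = N" using t by (simp flip: MN)
    then show ?thesis
      unfolding e V_window_append by (simp add: V_window_1 E_def K_def)
  qed
  have "hankel (t * n) (catalan_power (2 * t)) = residue_det ?q ([] @ cheb_V M # (E @ K))"
    by (subst hankel_even_christoffel[OF t]) (simp only: win flip: M_def)
  also have "\<dots> = residue_det ?q ([] @ Y # (E @ K))"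
    unfolding Y
  proof (rule residue_det_add_dependent[symmetric])
    fix i assume i: "i \<in> ?I"
    then show "cheb_V (M + int i) \<in> set [] \<union> set (E @ K)"
      using in_V_window[of "M + 1" "M + int i" "t - 1"] by (auto simp: E_def)
  qed simp
  also have "\<dots> = residue_det ?q ((Y # E) @ V_window N (t - 1) @ [])"
    by (simp add: K_def)
  also have "\<dots> = residue_det ?q ((Y # E) @ W_block N (t - 1) @ [])"
  proof (rule W_block_replace)
    have "N - int (t - 1) = M + 1" using t by (simp flip: MN)
    then have "V_window (N - int (t - 1)) (t - 1) = E" by (simp only: E_def)
    then show "set (V_window (N - int (t - 1)) (t - 1)) \<subseteq> set (Y # E) \<union> set []" by auto
  qed
  also have "\<dots> = (-1) ^ (t - 1) * residue_det ?q (E @ ([Y] @ W_block N (t - 1)))"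
    using residue_det_swap_blocks[of ?q "[]" "[Y]" E "W_block N (t - 1)"] by (simp add: E_def)
  finally have "of_nat t ^ t * hankel (t * n) (catalan_power (2 * t)) =
      (-1) ^ (t - 1) * (of_nat t ^ t * residue_det ?q (E @ ([Y] @ W_block N (t - 1))))"
    by simp
  also have "of_nat t ^ t * residue_det ?q (E @ ([Y] @ W_block N (t - 1))) =
      residue_det ?v E * coeff_det ([Y] @ W_block N (t - 1))"
    by (rule residue_det_eval_even) (use dvd t in \<open>auto simp: E_def\<close>)
  also have "residue_det ?v E = (-1) ^ (n * (t choose 2) + (t - 1))"
    using residue_det_even_omit[of t 0 "t - 1" n] t
    by (simp add: E_def M_def V_window_def[of _ 0] del: of_nat_mult)
  also have "coeff_det ([Y] @ W_block N (t - 1)) = of_nat t * (of_nat t * of_nat (n + 1)) ^ (t - 1)"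
  proof -
    have "coeff_det ([Y] @ W_block N (t - 1)) = coeff Y 0 * sylvester_det (cheb_S N) (cheb_S 0) (t - 1) 0"
      using coeff_det_W_block_W_block[of Y N "t - 1" 0 0] by (simp add: W_block_def)
    also have "coeff Y 0 = of_nat t"
      unfolding Y_def M_def N_def coeff_diff coeff_cheb_S_0 by (simp add: algebra_simps)
    also have "sylvester_det (cheb_S N) (cheb_S 0) (t - 1) 0 = (of_nat t * of_nat (n + 1)) ^ (t - 1)"
      unfolding sylvester_det_zero_right N_def coeff_cheb_S_0 by (simp only: of_nat_mult)
    finally show ?thesis .
  qed
  also have "of_nat t * (of_nat t * of_nat (n + 1)) ^ (t - 1) = (of_nat t ^ t * of_nat (n + 1) ^ (t - 1) :: rat)"
    using power_Suc[of "of_nat t :: rat" "t - 1"] t by (simp add: power_mult_distrib)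
  finally have "of_nat t ^ t * hankel (t * n) (catalan_power (2 * t)) =
      of_nat t ^ t * ((-1) ^ ((t - 1) + (n * (t choose 2) + (t - 1))) * of_nat (n + 1) ^ (t - 1))"
    by (simp only: power_add mult_ac)
  also have "(-1) ^ ((t - 1) + (n * (t choose 2) + (t - 1))) = ((-1) ^ (n * (t choose 2)) :: rat)"
    by (rule minus_one_power_eqI) (simp, blast)
  finally show ?thesis using t by simp
qed

section \<open>Leading terms in the index\<close>

text \<open>
  The function is polynomial of degree at most d, with c as its coefficient at d. Allowing c = 0
  makes the notion closed under sums and determinants.
\<close>

definition has_leading_term :: "nat \<Rightarrow> rat \<Rightarrow> (nat \<Rightarrow> rat) \<Rightarrow> bool" where
  "has_leading_term d c f \<longleftrightarrow> (\<exists>p. degree p \<le> d \<and> coeff p d = c \<and> (\<forall>n. f n = poly p (of_nat n)))"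

lemma has_leading_term_const: "has_leading_term 0 c (\<lambda>_. c)"
  unfolding has_leading_term_def by (rule exI[of _ "[:c:]"]) simp

lemma has_leading_term_zero: "has_leading_term d 0 (\<lambda>_. 0)"
  unfolding has_leading_term_def by (rule exI[of _ 0]) simp

lemma has_leading_term_linear: "has_leading_term 1 (of_nat r) (\<lambda>n. of_nat (r * n + s) - c)"
  unfolding has_leading_term_def by (rule exI[of _ "[:of_nat s - c, of_nat r:]"]) (simp add: algebra_simps)

lemma has_leading_term_add:
  assumes "has_leading_term d c f" "has_leading_term d c' g"
  shows "has_leading_term d (c + c') (\<lambda>n. f n + g n)"
proof -
  obtain p q where "degree p \<le> d \<and> coeff p d = c \<and> (\<forall>n. f n = poly p (of_nat n))"
    "degree q \<le> d \<and> coeff q d = c' \<and> (\<forall>n. g n = poly q (of_nat n))"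
    using assms unfolding has_leading_term_def by blast
  then show ?thesis
    unfolding has_leading_term_def by (intro exI[of _ "p + q"]) (auto intro: degree_add_le)
qed

lemma has_leading_term_mult:
  assumes "has_leading_term d c f" "has_leading_term d' c' g"
  shows "has_leading_term (d + d') (c * c') (\<lambda>n. f n * g n)"
proof -
  obtain p q where p: "degree p \<le> d \<and> coeff p d = c \<and> (\<forall>n. f n = poly p (of_nat n))"
    and q: "degree q \<le> d' \<and> coeff q d' = c' \<and> (\<forall>n. g n = poly q (of_nat n))"
    using assms unfolding has_leading_term_def by blast
  have "coeff (p * q) (d + d') = (\<Sum>i\<le>d + d'. coeff p i * coeff q (d + d' - i))"
    by (rule coeff_mult)
  also have "\<dots> = (\<Sum>i\<in>{d}. coeff p i * coeff q (d + d' - i))"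
  proof (rule sum.mono_neutral_right)
    show "\<forall>i\<in>{..d + d'} - {d}. coeff p i * coeff q (d + d' - i) = 0"
    proof
      fix i assume i: "i \<in> {..d + d'} - {d}"
      then consider "i > d" | "d + d' - i > d'" by force
      then show "coeff p i * coeff q (d + d' - i) = 0"
        using p q by cases (auto simp: coeff_eq_0)
    qed
  qed auto
  finally have "coeff (p * q) (d + d') = c * c'" using p q by simp
  moreover have "degree (p * q) \<le> d + d'"
    using p q degree_mult_le[of p q] by linarith
  ultimately show ?thesis
    unfolding has_leading_term_def using p q by (intro exI[of _ "p * q"]) auto
qed

lemma has_leading_term_cmult: "has_leading_term d c f \<Longrightarrow> has_leading_term d (k * c) (\<lambda>n. k * f n)"
  using has_leading_term_mult[OF has_leading_term_const[of k], of d c f] by simp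

lemma has_leading_term_sum:
  assumes "\<And>i. i \<in> I \<Longrightarrow> has_leading_term d (c i) (\<lambda>n. f n i)"
  shows "has_leading_term d (\<Sum>i\<in>I. c i) (\<lambda>n. \<Sum>i\<in>I. f n i)"
  using assms
  by (induction I rule: infinite_finite_induct)
    (auto intro: has_leading_term_add simp: has_leading_term_zero)

lemma has_leading_term_prod:
  assumes "finite I" "\<And>i. i \<in> I \<Longrightarrow> has_leading_term (d i) (c i) (\<lambda>n. f n i)"
  shows "has_leading_term (\<Sum>i\<in>I. d i) (\<Prod>i\<in>I. c i) (\<lambda>n. \<Prod>i\<in>I. f n i)"
  using assms
  by (induction I rule: finite_induct) (auto intro: has_leading_term_mult simp: has_leading_term_const)

text \<open>
  If the entries have degrees w j - v i, then all products in the Leibniz expansion have the same degree. The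
  entries with w j < v i must vanish, since the subtraction is truncated.
\<close>

lemma has_leading_term_det:
  assumes deg: "\<And>i j. i < m \<Longrightarrow> j < m \<Longrightarrow> v i \<le> w j \<Longrightarrow> has_leading_term (w j - v i) (c i j) (\<lambda>n. f n i j)"
    and zero: "\<And>i j n. i < m \<Longrightarrow> j < m \<Longrightarrow> w j < v i \<Longrightarrow> f n i j = 0 \<and> c i j = 0"
  shows "has_leading_term ((\<Sum>j<m. w j) - (\<Sum>i<m. v i)) (det (mat m m (\<lambda>(i, j). c i j)))
    (\<lambda>n. det (mat m m (\<lambda>(i, j). f n i j)))"
proof -
  show ?thesis
    unfolding det_leibniz
  proof (rule has_leading_term_sum)
    fix p assume "p \<in> {p. p permutes {0..<m}}"
    then have p: "p permutes {0..<m}" by simp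
    have pm: "p i < m" if "i < m" for i
      using permutes_in_image[OF p, of i] that by simp
    have "has_leading_term ((\<Sum>j<m. w j) - (\<Sum>i<m. v i)) (\<Prod>i=0..<m. c i (p i)) (\<lambda>n. \<Prod>i=0..<m. f n i (p i))"
    proof (cases "\<forall>i<m. v i \<le> w (p i)")
      case True
      have "has_leading_term (\<Sum>i\<in>{0..<m}. w (p i) - v i) (\<Prod>i=0..<m. c i (p i)) (\<lambda>n. \<Prod>i=0..<m. f n i (p i))"
        by (rule has_leading_term_prod) (use True deg pm in auto)
      also have "(\<Sum>i\<in>{0..<m}. w (p i) - v i) = (\<Sum>i\<in>{0..<m}. w (p i)) - (\<Sum>i\<in>{0..<m}. v i)"
        by (rule sum_subtractf_nat) (use True in auto)
      also have "(\<Sum>i\<in>{0..<m}. w (p i)) = (\<Sum>i\<in>{0..<m}. w i)"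
        using sum.permute[OF p, of w] by (simp add: comp_def)
      finally show ?thesis by (simp add: lessThan_atLeast0)
    next
      case False
      then obtain i where i: "i < m" "w (p i) < v i" by (auto simp: not_le)
      have "(\<Prod>i=0..<m. c i (p i)) = 0"
        by (rule prod_zero[OF _ bexI[of _ i]]) (use zero[of i "p i"] i pm in auto)
      moreover have "(\<Prod>i=0..<m. f n i (p i)) = 0" for n
        by (rule prod_zero[OF _ bexI[of _ i]]) (use zero[of i "p i"] i pm in auto)
      ultimately show ?thesis by (simp only: has_leading_term_zero)
    qed
    then show "has_leading_term ((\<Sum>j<m. w j) - (\<Sum>i<m. v i)) (signof p * (\<Prod>i=0..<m. c i (p i)))
        (\<lambda>n. signof p * (\<Prod>i=0..<m. f n i (p i)))"
      by (rule has_leading_term_cmult)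
  qed
qed

lemma polynomial_of_degreeI: "has_leading_term d c f \<Longrightarrow> c \<noteq> 0 \<Longrightarrow> polynomial_of_degree d f"
  unfolding has_leading_term_def polynomial_of_degree_def by (metis coeff_0 le_antisym le_degree)

lemma has_leading_term_choose:
  "has_leading_term k (of_nat r ^ k / fact k) (\<lambda>n. of_nat ((r * n + s) choose k))"
proof -
  have "has_leading_term (\<Sum>i\<in>{0..<k}. 1) (\<Prod>i\<in>{0..<k}. of_nat r) (\<lambda>n. \<Prod>i\<in>{0..<k}. of_nat (r * n + s) - of_nat i)"
    by (rule has_leading_term_prod) (auto intro: has_leading_term_linear[unfolded One_nat_def] simp del: of_nat_add of_nat_mult)
  from has_leading_term_cmult[OF this, of "1 / fact k"]
  show ?thesis
    by (simp add: binomial_gbinomial gbinomial_prod_rev del: of_nat_add of_nat_mult)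
qed

lemma has_leading_term_coeff_cheb_V:
  "has_leading_term (2 * i) (of_nat r ^ (2 * i) / fact (2 * i)) (\<lambda>n. coeff (cheb_V (int (r * n + s))) i)"
  unfolding coeff_cheb_V add.assoc by (rule has_leading_term_choose)

lemma has_leading_term_coeff_cheb_S:
  "has_leading_term (2 * i + 1) (of_nat r ^ (2 * i + 1) / fact (2 * i + 1)) (\<lambda>n. coeff (cheb_S (int (r * n + s))) i)"
  unfolding coeff_cheb_S add.assoc by (rule has_leading_term_choose)

text \<open>
  The difference is a sum of t polynomials V_k, so its coefficients lose one degree in n.
\<close>

lemma has_leading_term_coeff_cheb_S_diff:
  "has_leading_term (2 * i) (of_nat t * (of_nat r ^ (2 * i) / fact (2 * i)))
    (\<lambda>n. coeff (cheb_S (int (r * n + s + t)) - cheb_S (int (r * n + s))) i)"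
proof -
  have "has_leading_term (2 * i) (\<Sum>l<t. of_nat r ^ (2 * i) / fact (2 * i))
      (\<lambda>n. \<Sum>l<t. coeff (cheb_V (int (r * n + (s + l)))) i)"
    by (intro has_leading_term_sum has_leading_term_coeff_cheb_V)
  moreover have "(\<Sum>l<t. coeff (cheb_V (int (r * n + (s + l)))) i) =
      coeff (cheb_S (int (r * n + s + t)) - cheb_S (int (r * n + s))) i" for n
    using sum_cheb_V[of "int (r * n + s)" t] by (simp add: coeff_sum[symmetric] add.assoc)
  ultimately show ?thesis by simp
qed

section \<open>Definite Hankel matrices of hyperbolic quotients\<close>

definition antideriv :: "real poly \<Rightarrow> real poly" where
  "antideriv p = (\<Sum>k\<le>degree p. monom (coeff p k / of_nat (Suc k)) (Suc k))"

lemma coeff_antideriv_0 [simp]: "coeff (antideriv p) 0 = 0"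
  by (simp add: antideriv_def coeff_sum)

lemma coeff_antideriv_Suc [simp]: "coeff (antideriv p) (Suc k) = coeff p k / of_nat (Suc k)"
  by (cases "k \<le> degree p") (auto simp: antideriv_def coeff_sum coeff_eq_0)

lemma antideriv_eqI:
  assumes "coeff q 0 = 0" "pderiv q = p"
  shows "antideriv p = q"
proof (rule poly_eqI)
  fix n show "coeff (antideriv p) n = coeff q n"
    using assms(1) by (cases n) (auto simp: coeff_pderiv simp flip: assms(2))
qed

lemma pderiv_antideriv: "pderiv (antideriv p) = p"
  by (rule poly_eqI) (simp add: coeff_pderiv)

lemma antideriv_add: "antideriv (p + q) = antideriv p + antideriv q"
  by (rule antideriv_eqI) (simp_all add: pderiv_add pderiv_antideriv)

lemma antideriv_smult: "antideriv (smult c p) = smult c (antideriv p)"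
  by (rule antideriv_eqI) (simp_all add: pderiv_smult pderiv_antideriv)

definition integral_to :: "real \<Rightarrow> real poly \<Rightarrow> real" where
  "integral_to \<rho> p = poly (antideriv p) \<rho>"

lemma integral_to_add: "integral_to \<rho> (p + q) = integral_to \<rho> p + integral_to \<rho> q"
  by (simp add: integral_to_def antideriv_add)

lemma integral_to_smult: "integral_to \<rho> (smult c p) = c * integral_to \<rho> p"
  by (simp add: integral_to_def antideriv_smult)

lemma integral_to_diff: "integral_to \<rho> (p - q) = integral_to \<rho> p - integral_to \<rho> q"
  using integral_to_add[of \<rho> p "smult (-1) q"] integral_to_smult[of \<rho> "-1" q] by simp

lemma integral_to_zero [simp]: "integral_to \<rho> 0 = 0"
  using integral_to_smult[of \<rho> 0 0] by simp

lemma integral_to_sum: "integral_to \<rho> (\<Sum>i\<in>I. f i) = (\<Sum>i\<in>I. integral_to \<rho> (f i))"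
  by (induction I rule: infinite_finite_induct) (simp_all add: integral_to_add)

lemma integral_to_pderiv: "coeff p 0 = 0 \<Longrightarrow> integral_to \<rho> (pderiv p) = poly p \<rho>"
  by (simp add: integral_to_def antideriv_eqI[of p])

lemma integral_to_square_eq_0:
  assumes "\<rho> > 0" "integral_to \<rho> (p * p) = 0"
  shows "p = 0"
proof -
  define Q where "Q = antideriv (p * p)"
  have Q': "pderiv Q = p * p" by (simp add: Q_def pderiv_antideriv)
  have Q0: "poly Q 0 = 0" by (simp add: poly_0_coeff_0 Q_def)
  have Q1: "poly Q \<rho> = 0" using assms(2) by (simp add: Q_def integral_to_def)
  \<comment> \<open>The antiderivative of a square is monotone, so equal values at both ends make it constant.\<close>
  have mono: "poly Q x \<le> poly Q y" if "x \<le> y" for x y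
    by (rule DERIV_nonneg_imp_nondecreasing[OF that]) (metis Q' poly_DERIV poly_mult zero_le_square)
  have "poly Q x = 0" if "x \<in> {0..\<rho>}" for x
    using mono[of 0 x] mono[of x \<rho>] Q0 Q1 that by simp
  then have "{0..\<rho>} \<subseteq> {x. poly Q x = 0}" by auto
  moreover have "infinite {0..\<rho>}" using assms(1) by (simp add: infinite_Icc)
  ultimately have "Q = 0" using poly_roots_finite[of Q] finite_subset by blast
  then show ?thesis using Q' by simp
qed

lemma linear_independent_degrees:
  fixes g :: "nat \<Rightarrow> 'a :: idom poly"
  assumes "strict_mono (\<lambda>m. degree (g m))" "\<And>m. g m \<noteq> 0"
    and "(\<Sum>k<b. smult (x k) (g (k + d))) = 0"
  shows "\<forall>k<b. x k = 0"
  using assms(3)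
proof (induction b)
  case (Suc b)
  have "coeff (g (k + d)) (degree (g (b + d))) = 0" if "k < b" for k
    using that strict_monoD[OF assms(1), of "k + d" "b + d"] by (intro coeff_eq_0) simp
  then have "coeff (\<Sum>k<Suc b. smult (x k) (g (k + d))) (degree (g (b + d))) = x b * lead_coeff (g (b + d))"
    by (simp add: coeff_sum)
  moreover have "coeff (\<Sum>k<Suc b. smult (x k) (g (k + d))) (degree (g (b + d))) = 0"
    unfolding Suc.prems by simp
  ultimately have "x b = 0" using assms(2)[of "b + d"] by simp
  then show ?case using Suc by (auto simp: less_Suc_eq)
qed simp

text \<open>
  A Hankel matrix whose entries are, up to a fixed factor, inner products of linearly independent
  polynomials is definite, and so is the one shifted by 2 d, which is a submatrix of a larger one.
\<close>

lemma gram_nonsingular: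
  fixes h x :: "nat \<Rightarrow> real" and d :: nat
  assumes "\<rho> > 0" and g: "strict_mono (\<lambda>m. degree (g m))" "\<And>m. g m \<noteq> 0"
    and gram: "\<And>i j. integral_to \<rho> (g i * g j) = \<sigma> * h (i + j)"
    and ker: "\<And>i. i < b \<Longrightarrow> (\<Sum>k<b. x k * h (2 * d + i + k)) = 0"
  shows "\<forall>k<b. x k = 0"
proof -
  define G where "G = (\<Sum>k<b. smult (x k) (g (k + d)))"
  have "integral_to \<rho> (G * G) = (\<Sum>i<b. x i * (\<Sum>k<b. x k * integral_to \<rho> (g (i + d) * g (k + d))))"
    by (simp add: G_def sum_product integral_to_sum integral_to_smult sum_distrib_left mult_ac)
  also have "\<dots> = (\<Sum>i<b. x i * (\<sigma> * (\<Sum>k<b. x k * h (2 * d + i + k))))"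
  proof -
    have "(i + d) + (k + d) = 2 * d + i + k" for i k by simp
    then show ?thesis by (simp only: gram sum_distrib_left mult.left_commute[of _ \<sigma>])
  qed
  also have "\<dots> = 0"
    by (simp add: ker)
  finally have "G = 0" using integral_to_square_eq_0 assms(1) by blast
  then show ?thesis unfolding G_def by (rule linear_independent_degrees[OF g])
qed

text \<open>
  Even shifts of the Hankel matrix are treated with g and odd ones with g', since a Gram matrix can
  only be shifted by even amounts.
\<close>

lemma hankel_nonsingular_of_gram:
  fixes h x :: "nat \<Rightarrow> real"
  assumes \<rho>: "\<rho> > 0"
    and g: "\<And>m. degree (g m) = 2 * m + e" "\<And>m. g m \<noteq> 0"
      "\<And>i j. integral_to \<rho> (g i * g j) = \<sigma> * h (i + j)"
    and g': "\<And>m. degree (g' m) = 2 * m + e'" "\<And>m. g' m \<noteq> 0"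
      "\<And>i j. integral_to \<rho> (g' i * g' j) = \<sigma>' * h (Suc (i + j))"
    and ker: "\<And>i. i < b \<Longrightarrow> (\<Sum>k<b. x k * h (d + i + k)) = 0"
  shows "\<forall>k<b. x k = 0"
proof (cases "even d")
  case True
  then obtain d' where d: "d = 2 * d'" by (elim evenE)
  show ?thesis
    by (rule gram_nonsingular[where g = g and h = h, OF \<rho> _ g(2,3), where d = d'])
      (use ker in \<open>auto intro: strict_monoI simp: g(1) d\<close>)
next
  case False
  then obtain d' where d: "d = 2 * d' + 1" by (elim oddE)
  show ?thesis
    by (rule gram_nonsingular[where g = g' and h = "\<lambda>m. h (Suc m)", OF \<rho> _ g'(2,3), where d = d'])
      (use ker in \<open>auto intro: strict_monoI simp: g'(1) d\<close>)
qed

text \<open>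
  The Taylor series of cosh (\<rho> \<surd>y) in y.
\<close>

definition cosh_series :: "real \<Rightarrow> real fps" where
  "cosh_series \<rho> = Abs_fps (\<lambda>i. \<rho> ^ (2 * i) / fact (2 * i))"

text \<open>
  The Taylor series of sinh (\<rho> \<surd>y) / \<surd>y in y.
\<close>

definition sinh_series :: "real \<Rightarrow> real fps" where
  "sinh_series \<rho> = Abs_fps (\<lambda>i. \<rho> ^ (2 * i + 1) / fact (2 * i + 1))"

text \<open>
  The coefficient of y^m in Q(y) sinh (x \<surd>y) / \<surd>y, as a polynomial in x. The function
  sinh (x \<surd>y) / \<surd>y solves u'' = y u with u(0) = 0, so each profile is the second derivative of the next.
  The series Q is available to prescribe a boundary condition at x = \<rho>.
\<close>

definition profile :: "real fps \<Rightarrow> nat \<Rightarrow> real poly" where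
  "profile Q m = (\<Sum>k\<le>m. monom (fps_nth Q (m - k) / fact (2 * k + 1)) (2 * k + 1))"

lemma pderiv_sum: "pderiv (\<Sum>i\<in>I. f i) = (\<Sum>i\<in>I. pderiv (f i))"
  by (induction I rule: infinite_finite_induct) (simp_all add: pderiv_add)

lemma pderiv_profile:
  "pderiv (profile Q m) = (\<Sum>k\<le>m. monom (fps_nth Q (m - k) / fact (2 * k)) (2 * k))"
  unfolding profile_def pderiv_sum
proof (rule sum.cong)
  fix k assume "k \<in> {..m}"
  have "fact (2 * k + 1) = (of_nat (2 * k + 1) * fact (2 * k) :: real)"
    by simp
  then show "pderiv (monom (fps_nth Q (m - k) / fact (2 * k + 1)) (2 * k + 1)) =
      monom (fps_nth Q (m - k) / fact (2 * k)) (2 * k)"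
    unfolding pderiv_monom by (simp only: times_divide_eq_right) simp
qed simp

lemma pderiv2_profile:
  "pderiv (pderiv (profile Q 0)) = 0" "pderiv (pderiv (profile Q (Suc m))) = profile Q m"
proof -
  show "pderiv (pderiv (profile Q 0)) = 0"
    by (simp add: pderiv_profile pderiv_monom)
  have "pderiv (pderiv (profile Q (Suc m))) =
      (\<Sum>k\<le>Suc m. pderiv (monom (fps_nth Q (Suc m - k) / fact (2 * k)) (2 * k)))"
    unfolding pderiv_profile pderiv_sum ..
  also have "\<dots> = (\<Sum>k\<le>m. pderiv (monom (fps_nth Q (Suc m - Suc k) / fact (2 * Suc k)) (2 * Suc k)))"
    by (subst sum.atMost_Suc_shift) (simp add: pderiv_monom)
  also have "\<dots> = profile Q m"
    unfolding profile_def
  proof (rule sum.cong)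
    fix k assume "k \<in> {..m}"
    have "fact (2 * Suc k) = (of_nat (2 * Suc k) * fact (2 * k + 1) :: real)"
      by simp
    then show "pderiv (monom (fps_nth Q (Suc m - Suc k) / fact (2 * Suc k)) (2 * Suc k)) =
        monom (fps_nth Q (m - k) / fact (2 * k + 1)) (2 * k + 1)"
      unfolding pderiv_monom by (simp only: times_divide_eq_right) simp
  qed simp
  finally show "pderiv (pderiv (profile Q (Suc m))) = profile Q m" .
qed

lemma coeff_profile_0 [simp]: "coeff (profile Q m) 0 = 0"
  by (simp add: profile_def coeff_sum)

lemma poly_profile: "poly (profile Q m) \<rho> = fps_nth (Q * sinh_series \<rho>) m"
proof -
  have "fps_nth (sinh_series \<rho> * Q) m = (\<Sum>k=0..m. \<rho> ^ (2 * k + 1) / fact (2 * k + 1) * fps_nth Q (m - k))"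
    by (simp add: fps_mult_nth sinh_series_def)
  moreover have "poly (profile Q m) \<rho> = (\<Sum>k=0..m. \<rho> ^ (2 * k + 1) / fact (2 * k + 1) * fps_nth Q (m - k))"
    unfolding profile_def poly_sum poly_monom atMost_atLeast0 by (rule sum.cong) simp_all
  ultimately show ?thesis
    by (simp only: mult.commute[of Q "sinh_series \<rho>"])
qed

lemma poly_pderiv_profile: "poly (pderiv (profile Q m)) \<rho> = fps_nth (Q * cosh_series \<rho>) m"
proof -
  have "fps_nth (cosh_series \<rho> * Q) m = (\<Sum>k=0..m. \<rho> ^ (2 * k) / fact (2 * k) * fps_nth Q (m - k))"
    by (simp add: fps_mult_nth cosh_series_def)
  moreover have "poly (pderiv (profile Q m)) \<rho> = (\<Sum>k=0..m. \<rho> ^ (2 * k) / fact (2 * k) * fps_nth Q (m - k))"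
    unfolding pderiv_profile poly_sum poly_monom atMost_atLeast0 by (rule sum.cong) simp_all
  ultimately show ?thesis
    by (simp only: mult.commute[of Q "cosh_series \<rho>"])
qed

lemma degree_profile:
  assumes "fps_nth Q 0 \<noteq> 0"
  shows "degree (profile Q m) = 2 * m + 1" 
proof (rule antisym)
  show "degree (profile Q m) \<le> 2 * m + 1"
    unfolding profile_def by (rule degree_sum_le) (auto intro: order_trans[OF degree_monom_le])
  have "coeff (profile Q m) (2 * m + 1) = fps_nth Q 0 / fact (2 * m + 1)"
    by (simp add: profile_def coeff_sum)
  then show "2 * m + 1 \<le> degree (profile Q m)"
    using assms by (intro le_degree) simp
qed

text \<open>
  Green's identity; the hypothesis says that the boundary terms at \<rho> cancel.
\<close>

lemma integral_profile_shift:
  assumes "poly (profile Q (Suc i)) \<rho> * poly (pderiv (profile Q (Suc j))) \<rho> =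
    poly (pderiv (profile Q (Suc i))) \<rho> * poly (profile Q (Suc j)) \<rho>"
  shows "integral_to \<rho> (profile Q (Suc i) * profile Q j) = integral_to \<rho> (profile Q i * profile Q (Suc j))"
proof -
  let ?w = "profile Q (Suc i) * pderiv (profile Q (Suc j)) - pderiv (profile Q (Suc i)) * profile Q (Suc j)"
  have "pderiv ?w = profile Q (Suc i) * profile Q j - profile Q i * profile Q (Suc j)"
    by (simp add: pderiv_diff pderiv_mult pderiv2_profile algebra_simps)
  moreover have "integral_to \<rho> (pderiv ?w) = poly ?w \<rho>"
    by (rule integral_to_pderiv) (simp add: coeff_mult)
  ultimately show ?thesis
    using assms by (simp add: integral_to_diff)
qed

text \<open>
  Repeated shifting shows that the Gram matrix of the profiles is a Hankel matrix.
\<close>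

lemma integral_profile:
  assumes shift: "\<And>i j. poly (profile Q (Suc i)) \<rho> * poly (pderiv (profile Q (Suc j))) \<rho> =
    poly (pderiv (profile Q (Suc i))) \<rho> * poly (profile Q (Suc j)) \<rho>"
  shows "integral_to \<rho> (profile Q i * profile Q j) =
    poly (profile Q 0) \<rho> * poly (pderiv (profile Q (Suc (i + j)))) \<rho> -
    poly (pderiv (profile Q 0)) \<rho> * poly (profile Q (Suc (i + j))) \<rho>"
proof -
  have "integral_to \<rho> (profile Q i * profile Q j) = integral_to \<rho> (profile Q 0 * profile Q (i + j))"
  proof (induction i arbitrary: j)
    case (Suc i)
    then show ?case using integral_profile_shift[OF shift, of i j] by simp
  qed simp
  also have "\<dots> = integral_to \<rho> (pderiv (profile Q 0 * pderiv (profile Q (Suc (i + j))) -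
      pderiv (profile Q 0) * profile Q (Suc (i + j))))"
    by (simp add: pderiv_diff pderiv_mult pderiv2_profile algebra_simps)
  also have "\<dots> = poly (profile Q 0 * pderiv (profile Q (Suc (i + j))) -
      pderiv (profile Q 0) * profile Q (Suc (i + j))) \<rho>"
    by (rule integral_to_pderiv) (simp add: coeff_mult)
  finally show ?thesis by simp
qed

lemma integral_pderiv_profile:
  "integral_to \<rho> (pderiv (profile Q i) * pderiv (profile Q j)) =
    poly (pderiv (profile Q i)) \<rho> * poly (profile Q j) \<rho> -
    integral_to \<rho> (pderiv (pderiv (profile Q i)) * profile Q j)"
proof -
  have "integral_to \<rho> (pderiv (pderiv (profile Q i) * profile Q j)) = poly (pderiv (profile Q i) * profile Q j) \<rho>"
    by (rule integral_to_pderiv) (simp add: coeff_mult)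
  moreover have "pderiv (pderiv (profile Q i) * profile Q j) =
      pderiv (profile Q i) * pderiv (profile Q j) + pderiv (pderiv (profile Q i)) * profile Q j"
    by (simp add: pderiv_mult algebra_simps)
  ultimately show ?thesis by (simp add: integral_to_add)
qed

lemma series_constant_terms: "fps_nth (cosh_series \<rho>) 0 = 1" "fps_nth (sinh_series \<rho>) 0 = \<rho>"
  by (simp_all add: cosh_series_def sinh_series_def)

text \<open>
  For Q = 1 / cosh (\<rho> \<surd>y) all profiles but the first have derivative zero at \<rho>, and their values there are the
  coefficients of the quotient series. Inner products of the profiles, and of their derivatives, are
  therefore coefficients of that quotient.
\<close>

lemma tanh_hankel_nonsingular:
  fixes x :: "nat \<Rightarrow> real"
  assumes \<rho>: "\<rho> > 0"
    and ker: "\<And>i. i < b \<Longrightarrow> (\<Sum>k<b. x k * fps_nth (inverse (cosh_series \<rho>) * sinh_series \<rho>) (d + i + k)) = 0"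
  shows "\<forall>k<b. x k = 0"
proof -
  let ?Q = "inverse (cosh_series \<rho>)"
  define T where "T = ?Q * sinh_series \<rho>"
  have Q0: "fps_nth ?Q 0 \<noteq> 0" by (simp add: series_constant_terms)
  have Q1: "?Q * cosh_series \<rho> = 1" by (rule inverse_mult_eq_1) (simp add: series_constant_terms)
  have e: "poly (profile ?Q m) \<rho> = fps_nth T m" and
    e': "poly (pderiv (profile ?Q m)) \<rho> = (if m = 0 then 1 else 0)" for m
    by (simp_all add: poly_profile poly_pderiv_profile T_def Q1)
  have gram: "integral_to \<rho> (profile ?Q i * profile ?Q j) = - 1 * fps_nth T (Suc (i + j))" for i j
    by (subst integral_profile) (simp_all add: e e')
  have gram': "integral_to \<rho> (pderiv (profile ?Q i) * pderiv (profile ?Q j)) = 1 * fps_nth T (i + j)" for i j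
    by (subst integral_pderiv_profile, cases i) (simp_all add: e e' pderiv2_profile gram)
  have deg: "degree (profile ?Q m) = 2 * m + 1" for m by (rule degree_profile[OF Q0])
  show ?thesis
  proof (rule hankel_nonsingular_of_gram[OF \<rho> _ _ gram' deg _ gram])
    show "degree (pderiv (profile ?Q m)) = 2 * m + 0" "pderiv (profile ?Q m) \<noteq> 0" "profile ?Q m \<noteq> 0" for m
      using deg[of m] by (auto simp: degree_pderiv pderiv_eq_0_iff)
  qed (use ker in \<open>simp add: T_def\<close>)
qed

text \<open>
  For Q = \<surd>y / sinh (\<rho> \<surd>y) the profiles but the first vanish at \<rho>, and their derivatives there are the
  coefficients of the quotient series. The first profile violates the boundary condition, so the
  derivatives are used from the second profile on.
\<close>

lemma coth_hankel_nonsingular: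
  fixes x :: "nat \<Rightarrow> real"
  assumes \<rho>: "\<rho> > 0"
    and ker: "\<And>i. i < b \<Longrightarrow> (\<Sum>k<b. x k * fps_nth (inverse (sinh_series \<rho>) * cosh_series \<rho>) (Suc d + i + k)) = 0"
  shows "\<forall>k<b. x k = 0"
proof -
  let ?Q = "inverse (sinh_series \<rho>)"
  define K where "K = ?Q * cosh_series \<rho>"
  have Q0: "fps_nth ?Q 0 \<noteq> 0" using \<rho> by (simp add: series_constant_terms)
  have Q1: "?Q * sinh_series \<rho> = 1" by (rule inverse_mult_eq_1) (use \<rho> in \<open>simp add: series_constant_terms\<close>)
  have e: "poly (profile ?Q m) \<rho> = (if m = 0 then 1 else 0)" and
    e': "poly (pderiv (profile ?Q m)) \<rho> = fps_nth K m" for m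
    by (simp_all add: poly_profile poly_pderiv_profile K_def Q1)
  have gram: "integral_to \<rho> (profile ?Q i * profile ?Q j) = 1 * fps_nth K (Suc (i + j))" for i j
    by (subst integral_profile) (simp_all add: e e')
  have gram': "integral_to \<rho> (pderiv (profile ?Q (Suc i)) * pderiv (profile ?Q (Suc j))) =
      - 1 * fps_nth K (Suc (Suc (i + j)))" for i j
    by (subst integral_pderiv_profile) (simp_all add: e e' pderiv2_profile gram)
  have deg: "degree (profile ?Q m) = 2 * m + 1" for m by (rule degree_profile[OF Q0])
  show ?thesis
  proof (rule hankel_nonsingular_of_gram[where h = "\<lambda>m. fps_nth K (Suc m)", OF \<rho> deg _ gram _ _ gram'])
    show "degree (pderiv (profile ?Q (Suc m))) = 2 * m + 2" "pderiv (profile ?Q (Suc m)) \<noteq> 0" for m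
      by (auto simp: degree_pderiv pderiv_eq_0_iff deg)
    show "profile ?Q m \<noteq> 0" for m
      using deg[of m] by auto
  qed (use ker in \<open>simp add: K_def\<close>)
qed

section \<open>The leading coefficient does not vanish\<close>

lemma hankel_system_of_pade:
  fixes F G H :: "'a :: comm_ring_1 fps"
  assumes F: "\<And>i. p \<le> i \<Longrightarrow> F $ i = 0" and G: "\<And>i. q \<le> i \<Longrightarrow> G $ i = 0" and "p \<le> q"
    and zero: "\<And>j. j < q + p \<Longrightarrow> (F * H + G) $ j = 0"
    and i: "i < p"
  shows "(\<Sum>k<p. F $ (p - Suc k) * H $ (Suc (q - p) + i + k)) = 0"
proof -
  have "(\<Sum>k<p. F $ (p - Suc k) * H $ (Suc (q - p) + i + k)) =
      (\<Sum>k<p. F $ (p - Suc k) * H $ (q + i - (p - Suc k)))"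
  proof (intro sum.cong refl)
    fix k assume "k \<in> {..<p}"
    then have "Suc (q - p) + i + k = q + i - (p - Suc k)" using \<open>p \<le> q\<close> by auto
    then show "F $ (p - Suc k) * H $ (Suc (q - p) + i + k) = F $ (p - Suc k) * H $ (q + i - (p - Suc k))"
      by (simp only:)
  qed
  also have "\<dots> = (\<Sum>k<p. F $ k * H $ (q + i - k))"
    by (rule sum.nat_diff_reindex)
  also have "\<dots> = (\<Sum>k=0..q + i. F $ k * H $ (q + i - k))"
    using \<open>p \<le> q\<close> F by (intro sum.mono_neutral_left) (auto simp: not_less)
  also have "\<dots> = (F * H + G) $ (q + i)"
    by (simp add: fps_mult_nth G)
  also have "\<dots> = 0" by (rule zero) (use i in simp)
  finally show ?thesis .
qed

lemma fps_mult_nth_vanish: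
  assumes "\<And>j. j < n \<Longrightarrow> F $ j = (0 :: 'a :: comm_ring_1)" "j < n"
  shows "(G * F) $ j = 0"
  unfolding fps_mult_nth by (rule sum.neutral) (use assms in auto)

text \<open>
  Normality of a Pade table: no nontrivial combination A cosh + B sinh of the two series vanishes to
  the order given by the number of its free coefficients. Division by the cosh series or by the sinh series
  leads to a Hankel system for the quotient. Which one is used depends on whether B or A has fewer
  coefficients, since otherwise coefficients of negative index would enter the system.
\<close>

lemma cosh_sinh_pade_trivial:
  fixes A B :: "real fps"
  assumes \<rho>: "\<rho> > 0" and A: "\<And>i. a \<le> i \<Longrightarrow> A $ i = 0" and B: "\<And>i. b \<le> i \<Longrightarrow> B $ i = 0"
    and zero: "\<And>j. j < a + b \<Longrightarrow> (A * cosh_series \<rho> + B * sinh_series \<rho>) $ j = 0"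
  shows "A = 0 \<and> B = 0"
proof -
  let ?C = "cosh_series \<rho>" and ?S = "sinh_series \<rho>"
  have C1: "inverse ?C * ?C = 1" by (rule inverse_mult_eq_1) (simp add: series_constant_terms)
  have S1: "inverse ?S * ?S = 1" by (rule inverse_mult_eq_1) (use \<rho> in \<open>simp add: series_constant_terms\<close>)
  have zC: "(B * (inverse ?C * ?S) + A) $ j = 0" if "j < a + b" for j
  proof -
    have "inverse ?C * (A * ?C + B * ?S) = A * (inverse ?C * ?C) + B * (inverse ?C * ?S)"
      by (simp only: algebra_simps)
    then have "B * (inverse ?C * ?S) + A = inverse ?C * (A * ?C + B * ?S)"
      unfolding C1 by simp
    then show ?thesis using fps_mult_nth_vanish[OF zero that] by simp
  qed
  have zS: "(A * (inverse ?S * ?C) + B) $ j = 0" if "j < a + b" for j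
  proof -
    have "inverse ?S * (A * ?C + B * ?S) = A * (inverse ?S * ?C) + B * (inverse ?S * ?S)"
      by (simp only: algebra_simps)
    then have "A * (inverse ?S * ?C) + B = inverse ?S * (A * ?C + B * ?S)"
      unfolding S1 by simp
    then show ?thesis using fps_mult_nth_vanish[OF zero that] by simp
  qed
  show ?thesis
  proof (cases "b \<le> a")
    case True
    have "\<forall>k<b. B $ (b - Suc k) = 0"
      by (rule tanh_hankel_nonsingular[OF \<rho>, of b "\<lambda>k. B $ (b - Suc k)" "Suc (a - b)"])
        (rule hankel_system_of_pade[where G = A, OF B A True zC], simp_all)
    then have "B $ k = 0" for k
      using B[of k] by (cases "k < b") (auto dest: spec[of _ "b - Suc k"])
    then have B0: "B = 0" by (intro fps_ext) simp
    have "A $ j = 0" for j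
      using zC[of j] A[of j] B0 by (cases "j < a") auto
    then have "A = 0" by (intro fps_ext) simp
    with B0 show ?thesis by simp
  next
    case False
    have "\<forall>k<a. A $ (a - Suc k) = 0"
      by (rule coth_hankel_nonsingular[OF \<rho>, of a "\<lambda>k. A $ (a - Suc k)" "b - a"])
        (rule hankel_system_of_pade[where G = B, OF A B _ zS], use False in simp_all)
    then have "A $ k = 0" for k
      using A[of k] by (cases "k < a") (auto dest: spec[of _ "a - Suc k"])
    then have A0: "A = 0" by (intro fps_ext) simp
    have "B $ j = 0" for j
      using zS[of j] B[of j] A0 by (cases "j < b") auto
    then have "B = 0" by (intro fps_ext) simp
    with A0 show ?thesis by simp
  qed
qed

text \<open>
  The leading coefficients, as polynomials in n, of the entries of the Sylvester-type matrix.
\<close>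

definition leading_entry :: "rat \<Rightarrow> nat \<Rightarrow> nat \<Rightarrow> nat \<Rightarrow> nat \<Rightarrow> rat" where
  "leading_entry \<alpha> r a i j =
    (if i < a then if i \<le> j then \<alpha> * (of_nat r ^ (2 * (j - i)) / fact (2 * (j - i))) else 0
     else if i - a \<le> j then of_nat r ^ (2 * (j - (i - a)) + 1) / fact (2 * (j - (i - a)) + 1) else 0)"

lemma of_rat_fact: "of_rat (fact n) = (fact n :: real)"
  by (metis of_nat_fact of_rat_of_nat_eq)

text \<open>
  A vector in the kernel of the transposed matrix is a pair of polynomials that combine the cosh and sinh series
  to a series without terms below y^(a + b).
\<close>

lemma det_leading_nonzero:
  assumes "r > 0" "\<alpha> \<noteq> 0"
  shows "det (mat (a + b) (a + b) (\<lambda>(i, j). leading_entry \<alpha> r a i j)) \<noteq> 0"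
proof
  let ?n = "a + b"
  let ?M = "mat ?n ?n (\<lambda>(i, j). leading_entry \<alpha> r a i j)"
  let ?\<rho> = "of_nat r :: real"
  assume "det ?M = 0"
  then have "det (transpose_mat ?M) = 0" by (simp add: det_transpose[of _ ?n])
  then obtain v where v: "v \<in> carrier_vec ?n" "v \<noteq> 0\<^sub>v ?n" "transpose_mat ?M *\<^sub>v v = 0\<^sub>v ?n"
    using det_0_iff_vec_prod_zero_field[of "transpose_mat ?M" ?n] by auto
  define x where "x i = (of_rat (vec_index v i) :: real)" for i
  define A where "A = Abs_fps (\<lambda>i. if i < a then of_rat \<alpha> * x i else 0)"
  define B where "B = Abs_fps (\<lambda>k. if k < b then x (a + k) else 0)"
  have sum0: "(\<Sum>i<?n. leading_entry \<alpha> r a i j * vec_index v i) = 0" if "j < ?n" for j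
  proof -
    have "vec_index (transpose_mat ?M *\<^sub>v v) j = (\<Sum>i<?n. leading_entry \<alpha> r a i j * vec_index v i)"
      using that v(1) by (simp add: scalar_prod_def lessThan_atLeast0)
    then show ?thesis using v(3) that by simp
  qed
  have "(A * cosh_series ?\<rho> + B * sinh_series ?\<rho>) $ j = 0" if j: "j < ?n" for j
  proof -
    have "0 = (of_rat (\<Sum>i<?n. leading_entry \<alpha> r a i j * vec_index v i) :: real)"
      using sum0[OF j] by simp
    also have "\<dots> = (\<Sum>i<?n. of_rat (leading_entry \<alpha> r a i j) * x i)"
      by (simp add: of_rat_sum of_rat_mult x_def)
    also have "\<dots> = (\<Sum>i<a. of_rat (leading_entry \<alpha> r a i j) * x i) +
        (\<Sum>k<b. of_rat (leading_entry \<alpha> r a (a + k) j) * x (a + k))"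
      using sum.atLeastLessThan_concat[of 0 a "a + b" "\<lambda>i. of_rat (leading_entry \<alpha> r a i j) * x i"]
        sum.shift_bounds_nat_ivl[of "\<lambda>i. of_rat (leading_entry \<alpha> r a i j) * x i" 0 a b]
      by (simp add: lessThan_atLeast0 add.commute)
    also have "(\<Sum>i<a. of_rat (leading_entry \<alpha> r a i j) * x i) = (\<Sum>i=0..j. A $ i * cosh_series ?\<rho> $ (j - i))"
      by (rule sum.mono_neutral_cong)
        (auto simp: A_def leading_entry_def cosh_series_def of_rat_mult of_rat_divide of_rat_power of_rat_fact simp del: fact_Suc)
    also have "(\<Sum>k<b. of_rat (leading_entry \<alpha> r a (a + k) j) * x (a + k)) =
        (\<Sum>i=0..j. B $ i * sinh_series ?\<rho> $ (j - i))"
      by (rule sum.mono_neutral_cong)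
        (auto simp: B_def leading_entry_def sinh_series_def of_rat_mult of_rat_divide of_rat_power of_rat_fact simp del: fact_Suc)
    finally show ?thesis by (simp add: fps_mult_nth)
  qed
  then have "A = 0 \<and> B = 0"
    by (intro cosh_sinh_pade_trivial[of ?\<rho> a A b B]) (use assms in \<open>auto simp: A_def B_def\<close>)
  then have z: "A $ i = 0" "B $ i = 0" for i by simp_all
  have "vec_index v i = 0" if "i < ?n" for i
  proof (cases "i < a")
    case True
    then show ?thesis using z(1)[of i] assms(2) by (simp add: A_def x_def)
  next
    case False
    then show ?thesis using z(2)[of "i - a"] that by (simp add: B_def x_def split: if_splits)
  qed
  then have "v = 0\<^sub>v ?n" using v(1) by (intro eq_vecI) auto
  then show False using v(2) by simp
qed

lemma sylvester_det_entries:
  "sylvester_det f g a b = det (mat (a + b) (a + b) (\<lambda>(i, j).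
    if i < a then if i \<le> j then coeff f (j - i) else 0
    else if i - a \<le> j then coeff g (j - (i - a)) else 0))"
  unfolding sylvester_det_def coeff_det_def
  by (intro arg_cong[where f = det] eq_matI)
    (auto simp: nth_append mult.commute[of _ "monom 1 _"] coeff_monom_mult)

text \<open>
  The row of y^k f has degree 2 (j - k) and that of y^k g has degree 2 (j - k) + 1 in column j. With
  column weights 2 j + 1, the row weights are 2 k + 1 and 2 k.
\<close>

lemma has_leading_term_sylvester:
  assumes "r > 0" "\<alpha> \<noteq> 0"
    and f: "\<And>i. has_leading_term (2 * i) (\<alpha> * (of_nat r ^ (2 * i) / fact (2 * i))) (\<lambda>n. coeff (f n) i)"
    and g: "\<And>i. has_leading_term (2 * i + 1) (of_nat r ^ (2 * i + 1) / fact (2 * i + 1)) (\<lambda>n. coeff (g n) i)"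
  shows "\<exists>c. c \<noteq> 0 \<and> has_leading_term (b * (2 * a + 1)) c (\<lambda>n. sylvester_det (f n) (g n) a b)"
proof (intro exI conjI)
  define w :: "nat \<Rightarrow> nat" where "w j = 2 * j + 1" for j
  define v where "v i = (if i < a then 2 * i + 1 else 2 * (i - a))" for i
  have "has_leading_term ((\<Sum>j<a + b. w j) - (\<Sum>i<a + b. v i))
      (det (mat (a + b) (a + b) (\<lambda>(i, j). leading_entry \<alpha> r a i j)))
      (\<lambda>n. sylvester_det (f n) (g n) a b)"
    unfolding sylvester_det_entries
  proof (rule has_leading_term_det)
    fix i j assume le: "v i \<le> w j"
    show "has_leading_term (w j - v i) (leading_entry \<alpha> r a i j)
      (\<lambda>n. if i < a then if i \<le> j then coeff (f n) (j - i) else 0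
        else if i - a \<le> j then coeff (g n) (j - (i - a)) else 0)"
    proof (cases "i < a")
      case True
      then have "i \<le> j" "w j - v i = 2 * (j - i)" using le by (auto simp: v_def w_def)
      then show ?thesis using True f[of "j - i"] by (simp add: leading_entry_def)
    next
      case False
      then have "i - a \<le> j" "w j - v i = 2 * (j - (i - a)) + 1" using le by (auto simp: v_def w_def)
      then show ?thesis using False g[of "j - (i - a)"] by (simp add: leading_entry_def)
    qed
  qed (auto simp: v_def w_def leading_entry_def)
  moreover have "(\<Sum>j<a + b. w j) - (\<Sum>i<a + b. v i) = b * (2 * a + 1)"
  proof -
    have w: "(\<Sum>j<m. 2 * j + 1) = m * m" for m :: nat
      by (induction m) auto
    have e: "(\<Sum>j<m. 2 * j) + m = m * m" for m :: nat
      by (induction m) auto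
    have "(\<Sum>i<a + b. v i) = (\<Sum>i<a. v i) + (\<Sum>k<b. v (a + k))"
      using sum.atLeastLessThan_concat[of 0 a "a + b" v] sum.shift_bounds_nat_ivl[of v 0 a b]
      by (simp add: lessThan_atLeast0 add.commute)
    also have "\<dots> = a * a + (\<Sum>k<b. 2 * k)"
      using w[of a] by (simp add: v_def)
    finally have "(\<Sum>i<a + b. v i) + b = a * a + b * b" using e[of b] by simp
    moreover have "(\<Sum>j<a + b. w j) = (a + b) * (a + b)"
      unfolding w_def by (rule w)
    ultimately show ?thesis by (simp add: algebra_simps)
  qed
  ultimately show "has_leading_term (b * (2 * a + 1)) (det (mat (a + b) (a + b) (\<lambda>(i, j). leading_entry \<alpha> r a i j)))
      (\<lambda>n. sylvester_det (f n) (g n) a b)"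
    by simp
  show "det (mat (a + b) (a + b) (\<lambda>(i, j). leading_entry \<alpha> r a i j)) \<noteq> 0"
    by (rule det_leading_nonzero[OF assms(1,2)])
qed

lemma polynomial_of_degree_multiple:
  assumes "\<exists>c. c \<noteq> 0 \<and> has_leading_term d c f" "k \<noteq> 0" "\<And>n. g n = k * f n"
  shows "polynomial_of_degree d g"
proof -
  obtain c where c: "c \<noteq> 0" "has_leading_term d c f" using assms(1) by blast
  have "g = (\<lambda>n. k * f n)" using assms(3) by blast
  then show ?thesis
    using has_leading_term_cmult[OF c(2), of k] polynomial_of_degreeI[of d "k * c" g] c(1) assms(2) by simp
qed

section \<open>Values, sum rules and degrees\<close>

lemma sylvester_det_zero_left: "sylvester_det f g 0 b = coeff g 0 ^ b"
  using sylvester_det_swap[of f g 0 b] by (simp add: sylvester_det_zero_right)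

lemma one_choose_two: "(0 + 1) choose 2 = 0" "1 choose 2 = (0 :: nat)"
  by (simp_all add: numeral_2_eq_2)

lemma sign_cancel: "(-1) ^ k * ((-1) ^ (k + l) * x) = ((-1) ^ l * x :: 'a :: comm_ring_1)"
proof -
  have "(-1) ^ k * ((-1) ^ k :: 'a) = 1" by (simp flip: power_mult_distrib)
  then show ?thesis by (simp add: power_add mult.assoc[symmetric])
qed

text \<open>
  The second value is the case b = 0 of the lower formula, where only V with constant coefficient 1 occurs;
  for t = 0 it is the first value for n + 1.
\<close>

lemma hankel_odd_values:
  assumes r: "r = 2 * t + 1"
  shows "hankel (r * n) (catalan_power r) = (-1) ^ (t * n)"
    and "hankel (r * n + 1) (catalan_power r) = (-1) ^ (t * n)"
proof -
  show "hankel (r * n) (catalan_power r) = (-1) ^ (t * n)"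
    using hankel_odd_multiple[OF r, of n] by (simp add: mult.commute)
  show "hankel (r * n + 1) (catalan_power r) = (-1) ^ (t * n)"
  proof (cases t)
    case 0
    then show ?thesis using hankel_odd_multiple[OF r, of "n + 1"] r by simp
  next
    case (Suc a)
    have "hankel (r * n + (0 + 1)) (catalan_power r) = (-1) ^ (n * t + ((0 + 1) choose 2)) *
        sylvester_det (cheb_V (int (r * n + t))) (cheb_S (int (r * (n + 1)))) a 0"
      by (rule hankel_odd_lower) (use Suc r in simp_all)
    then show ?thesis
      unfolding sylvester_det_zero_right coeff_cheb_V_0 one_choose_two by (simp add: mult.commute)
  qed
qed

text \<open>
  The case a = 0, where only the polynomial S with index and constant coefficient r (n + 1) occurs.
\<close>

lemma hankel_odd_middle_values:
  assumes r: "r = 2 * t + 1" and t: "t \<ge> 1"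
  shows "hankel (r * n + t) (catalan_power r) = (-1) ^ (t * n + (t choose 2)) * of_nat (r * (n + 1)) ^ (t - 1)"
    and "- hankel (r * n + t + 2) (catalan_power r) = (-1) ^ (t * n + (t choose 2)) * of_nat (r * (n + 1)) ^ (t - 1)"
proof -
  obtain b where b: "t = Suc b" using t by (cases t) auto
  have "hankel (r * n + (b + 1)) (catalan_power r) = (-1) ^ (n * t + ((b + 1) choose 2)) *
      sylvester_det (cheb_V (int (r * n + t))) (cheb_S (int (r * (n + 1)))) 0 b"
    by (rule hankel_odd_lower) (use b r in simp_all)
  then show "hankel (r * n + t) (catalan_power r) = (-1) ^ (t * n + (t choose 2)) * of_nat (r * (n + 1)) ^ (t - 1)"
    unfolding sylvester_det_zero_left coeff_cheb_S_0 by (simp only: b mult.commute[of n] Suc_eq_plus1 diff_add_inverse2)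
  have "hankel (r * (n + 1) - b) (catalan_power r) = (-1) ^ (n * t + t + (b choose 2)) *
      sylvester_det (cheb_V (int (r * (n + 1) + t))) (cheb_S (int (r * (n + 1)))) 0 b"
    by (rule hankel_odd_upper) (use b r in simp_all)
  moreover have "r * (n + 1) - b = r * n + t + 2" using b r by simp
  moreover have "(-1) ^ (n * t + t + (b choose 2)) = (- ((-1) ^ (t * n + (t choose 2))) :: rat)"
  proof -
    have "(-1) ^ (n * t + t + (b choose 2)) = ((-1) ^ (t * n + (t choose 2) + 1) :: rat)"
    proof (rule minus_one_power_eqI)
      have "t choose 2 = (b choose 2) + b" by (simp add: b numeral_2_eq_2)
      then show "even (n * t + t + (b choose 2) + (t * n + (t choose 2) + 1))" by (simp add: b) blast
    qed
    then show ?thesis by simp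
  qed
  ultimately show "- hankel (r * n + t + 2) (catalan_power r) =
      (-1) ^ (t * n + (t choose 2)) * of_nat (r * (n + 1)) ^ (t - 1)"
    unfolding sylvester_det_zero_left coeff_cheb_S_0 by (simp add: b)
qed

text \<open>
  For t \<ge> 2 both determinants involve the same V_(r n + t) and a single row with S_(r n) or
  S_(r n + r). By linearity only the difference of the latter matters, and it is the multiple
  V_(r n + t) W_t.
\<close>

lemma hankel_odd_sum:
  assumes r: "r = 2 * t + 1" and t: "t \<ge> 1" and n: "n \<ge> 1"
  shows "hankel (r * n - 1) (catalan_power r) + hankel (r * n + 2) (catalan_power r) =
    (-1) ^ (t * n + 1) * (of_nat t - 1) * of_nat r"
proof (cases "t = 1")
  case True
  obtain m where m: "n = Suc m" using n by (cases n) auto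
  have "hankel (r * m + t + 1) (catalan_power r) = 0" "hankel (r * n + t + 1) (catalan_power r) = 0"
    by (rule hankel_odd_zero[OF r t])+
  moreover have "r * n - 1 = r * m + t + 1" "r * n + 2 = r * n + t + 1" using True r m by auto
  ultimately show ?thesis using True by simp
next
  case False
  then obtain s where s: "t = s + 2" using t by (metis One_nat_def Suc_leI le_neq_implies_less add.commute le_Suc_ex numeral_2_eq_2)
  obtain m where m: "n = m + 1" using n by (metis add.commute le_Suc_ex One_nat_def plus_1_eq_Suc)
  let ?V = "cheb_V (int (r * n + t))"
  have low: "hankel (r * n + (1 + 1)) (catalan_power r) = (-1) ^ (n * t + ((1 + 1) choose 2)) *
      sylvester_det ?V (cheb_S (int (r * (n + 1)))) s 1"
    by (rule hankel_odd_lower) (use s r in simp_all)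
  have up: "hankel (r * (m + 1) - 1) (catalan_power r) = (-1) ^ (m * t + t + (1 choose 2)) *
      sylvester_det (cheb_V (int (r * (m + 1) + t))) (cheb_S (int (r * (m + 1)))) s 1"
    by (rule hankel_odd_upper) (use s r in simp_all)
  have "cheb_S (int (r * (n + 1))) = cheb_S (int (r * n)) + ?V * cheb_W (int t)"
  proof -
    have e: "int (r * n + t) + 1 + int t = int (r * (n + 1))" "int (r * n + t) - int t = int (r * n)"
      using r by (simp_all add: algebra_simps)
    show ?thesis using cheb_S_W[of "int (r * n + t)" "int t"] unfolding e
      by (simp only: diff_eq_eq add.commute)
  qed
  moreover have "coeff (cheb_W (int t)) s = (of_nat t - 1) * of_nat r"
    using coeff_cheb_W_second[of s] by (simp add: s r algebra_simps)
  ultimately have eq: "sylvester_det ?V (cheb_S (int (r * (n + 1)))) s 1 =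
      sylvester_det ?V (cheb_S (int (r * n))) s 1 + (of_nat t - 1) * of_nat r"
    by (simp only: sylvester_det_one_add sylvester_det_one_multiple coeff_cheb_V_0 power_one mult_1_left)
  have H2: "hankel (r * n + 2) (catalan_power r) =
      - ((-1) ^ (t * n) * sylvester_det ?V (cheb_S (int (r * (n + 1)))) s 1)"
  proof -
    have "(1 + 1) choose 2 = (1 :: nat)" "(1 + 1 :: nat) = 2" by (simp_all add: numeral_2_eq_2)
    then show ?thesis using low by (simp only: mult.commute[of n t]) simp
  qed
  have H1: "hankel (r * n - 1) (catalan_power r) =
      (-1) ^ (t * n) * sylvester_det ?V (cheb_S (int (r * n))) s 1"
  proof -
    have "m * t + t = t * n" by (simp add: m)
    then show ?thesis using up unfolding m[symmetric] one_choose_two by (simp only: add_0_right)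
  qed
  show ?thesis
    unfolding H1 H2 eq power_add power_one_right by (simp only: algebra_simps)
qed

lemma hankel_odd_degree:
  assumes r: "r = 2 * t + 1" and j: "1 \<le> j" "j \<le> t"
  shows "polynomial_of_degree ((j - 1) * (r - 2 * j)) (\<lambda>n. (-1) ^ (t * n) * hankel (r * n + j) (catalan_power r))"
    and "polynomial_of_degree ((j - 1) * (r - 2 * j)) (\<lambda>n. (-1) ^ (t * n) * hankel (r * n + r + 1 - j) (catalan_power r))"
proof -
  obtain b where b: "j = b + 1" using j by (metis add.commute le_Suc_ex One_nat_def plus_1_eq_Suc)
  obtain a where a: "t = a + b + 1" using j b by (metis le_Suc_ex add.commute add.assoc)
  have d: "(j - 1) * (r - 2 * j) = b * (2 * a + 1)" using a b r by simp
  have r0: "r > 0" using r by simp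
  show "polynomial_of_degree ((j - 1) * (r - 2 * j)) (\<lambda>n. (-1) ^ (t * n) * hankel (r * n + j) (catalan_power r))"
    unfolding d
  proof (rule polynomial_of_degree_multiple)
    show "\<exists>c. c \<noteq> 0 \<and> has_leading_term (b * (2 * a + 1)) c
      (\<lambda>n. sylvester_det (cheb_V (int (r * n + t))) (cheb_S (int (r * n + r))) a b)"
      by (rule has_leading_term_sylvester[OF r0, of 1])
        (simp, simp only: mult_1_left, rule has_leading_term_coeff_cheb_V, rule has_leading_term_coeff_cheb_S)
    show "(-1) ^ (t * n) * hankel (r * n + j) (catalan_power r) = (-1) ^ (j choose 2) *
      sylvester_det (cheb_V (int (r * n + t))) (cheb_S (int (r * n + r))) a b" for n
      unfolding b hankel_odd_lower[OF a r, of n] mult.commute[of n t] sign_cancel by (simp add: algebra_simps)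
  qed simp
  show "polynomial_of_degree ((j - 1) * (r - 2 * j)) (\<lambda>n. (-1) ^ (t * n) * hankel (r * n + r + 1 - j) (catalan_power r))"
    unfolding d
  proof (rule polynomial_of_degree_multiple)
    show "\<exists>c. c \<noteq> 0 \<and> has_leading_term (b * (2 * a + 1)) c
      (\<lambda>n. sylvester_det (cheb_V (int (r * n + (r + t)))) (cheb_S (int (r * n + r))) a b)"
      by (rule has_leading_term_sylvester[OF r0, of 1])
        (simp, simp only: mult_1_left, rule has_leading_term_coeff_cheb_V, rule has_leading_term_coeff_cheb_S)
    show "(-1) ^ (t * n) * hankel (r * n + r + 1 - j) (catalan_power r) = (-1) ^ (t + (b choose 2)) *
      sylvester_det (cheb_V (int (r * n + (r + t)))) (cheb_S (int (r * n + r))) a b" for n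
    proof -
      have e: "r * (n + 1) = r * n + r" "r * n + r + 1 - j = r * n + r - b" using b by simp_all
      have h: "hankel (r * n + r - b) (catalan_power r) = (-1) ^ (t * n + (t + (b choose 2))) *
          sylvester_det (cheb_V (int (r * n + (r + t)))) (cheb_S (int (r * n + r))) a b"
        using hankel_odd_upper[OF a r, of n] by (simp only: e(1) mult.commute[of n t] add.assoc)
      show ?thesis unfolding e(2) h by (rule sign_cancel)
    qed
  qed simp
qed

lemma hankel_even_values:
  assumes t: "t \<ge> 1"
  shows "hankel (t * n) (catalan_power (2 * t)) = (-1) ^ (n * (t choose 2)) * of_nat (n + 1) ^ (t - 1)"
    and "hankel (t * n + 1) (catalan_power (2 * t)) = (-1) ^ (n * (t choose 2)) * of_nat (n + 1) ^ (t - 1)"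
proof -
  show "hankel (t * n) (catalan_power (2 * t)) = (-1) ^ (n * (t choose 2)) * of_nat (n + 1) ^ (t - 1)"
    by (rule hankel_even_multiple[OF t])
  have "of_nat t ^ (t - 1) * hankel (t * n + (0 + 1)) (catalan_power (2 * t)) =
      (-1) ^ (n * (t choose 2) + ((0 + 1) choose 2)) *
      sylvester_det (cheb_S (int (t * (n + 1)))) (cheb_S (int (t * (n + 2)))) (t - 1) 0"
    by (rule hankel_even_shift) (use t in simp)
  note that = this
  have "of_nat t ^ (t - 1) * hankel (t * n + 1) (catalan_power (2 * t)) =
      of_nat t ^ (t - 1) * ((-1) ^ (n * (t choose 2)) * of_nat (n + 1) ^ (t - 1))"
  proof -
    have "of_nat (t * (n + 1)) ^ (t - 1) = (of_nat t ^ (t - 1) * of_nat (n + 1) ^ (t - 1) :: rat)"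
      by (simp only: of_nat_mult power_mult_distrib)
    with that show ?thesis
      by (simp only: sylvester_det_zero_right coeff_cheb_S_0 one_choose_two add_0 add_0_right mult_ac)
  qed
  then show "hankel (t * n + 1) (catalan_power (2 * t)) = (-1) ^ (n * (t choose 2)) * of_nat (n + 1) ^ (t - 1)"
    using t by simp
qed

text \<open>
  Both determinants involve S_M with M = t (2 n + 1) and a single row with S_(M+t) or
  S_(M-t); the sum of the latter two is the multiple S_M T_t.
\<close>

lemma hankel_even_sum:
  assumes t: "t \<ge> 2" and n: "n \<ge> 1"
  shows "hankel (2 * t * n - 1) (catalan_power (2 * t)) + hankel (2 * t * n + 2) (catalan_power (2 * t)) =
    - of_nat t * (2 * of_nat t - 3) * of_nat (2 * n + 1) ^ (t - 1)"
proof -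
  obtain s where s: "t = s + 2" using t by (metis add.commute le_Suc_ex)
  obtain m where m: "n = m + 1" using n by (metis add.commute le_Suc_ex One_nat_def plus_1_eq_Suc)
  define M where "M = t * (2 * n + 1)"
  let ?S = "cheb_S (int M)"
  let ?H1 = "hankel (2 * t * n - 1) (catalan_power (2 * t))"
  let ?H2 = "hankel (2 * t * n + 2) (catalan_power (2 * t))"
  have "of_nat t ^ (t - 1) * hankel (t * (2 * n) + (1 + 1)) (catalan_power (2 * t)) =
      (-1) ^ (2 * n * (t choose 2) + ((1 + 1) choose 2)) *
      sylvester_det (cheb_S (int (t * (2 * n + 1)))) (cheb_S (int (t * (2 * n + 2)))) s 1"
    by (rule hankel_even_shift) (use s in simp)
  moreover have "t * (2 * n) + (1 + 1) = 2 * t * n + 2" "t * (2 * n + 2) = M + t" "t * (2 * n + 1) = M"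
    by (simp_all add: M_def)
  moreover have "(-1) ^ (2 * n * (t choose 2) + ((1 + 1) choose 2)) = (-1 :: rat)"
  proof -
    have "(1 + 1) choose 2 = (1 :: nat)" by (simp add: numeral_2_eq_2)
    then show ?thesis by (simp add: minus_one_power_iff)
  qed
  ultimately have H2: "of_nat t ^ (t - 1) * ?H2 = - sylvester_det ?S (cheb_S (int (M + t))) s 1"
    by (simp only: mult_minus1)
  have "of_nat t ^ (t - 1) * hankel (t * (2 * m + 1) + (s + 1)) (catalan_power (2 * t)) =
      (-1) ^ ((2 * m + 1) * (t choose 2) + ((s + 1) choose 2)) *
      sylvester_det (cheb_S (int (t * (2 * m + 1 + 1)))) (cheb_S (int (t * (2 * m + 1 + 2)))) 1 s"
    by (rule hankel_even_shift) (use s in simp)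
  moreover have "t * (2 * m + 1) + (s + 1) = 2 * t * n - 1" by (simp add: s m algebra_simps)
  moreover have "t * (2 * m + 1 + 1) = M - t" "t * (2 * m + 1 + 2) = M" by (simp_all add: M_def m algebra_simps)
  moreover have "(-1) ^ ((2 * m + 1) * (t choose 2) + ((s + 1) choose 2)) * (-1) ^ (1 * s) = (-1 :: rat)"
  proof -
    have "t choose 2 = ((s + 1) choose 2) + s + 1" by (simp add: s numeral_2_eq_2)
    then have "odd ((2 * m + 1) * (t choose 2) + ((s + 1) choose 2) + 1 * s)" by simp
    then show ?thesis by (simp only: power_add[symmetric] minus_one_power_iff) simp
  qed
  ultimately have H1: "of_nat t ^ (t - 1) * ?H1 = - sylvester_det ?S (cheb_S (int (M - t))) s 1"
    using sylvester_det_swap[of "cheb_S (int (M - t))" ?S 1 s]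
    by (simp only: mult.assoc[symmetric] mult_minus1)
  have "cheb_S (int (M + t)) + cheb_S (int (M - t)) = ?S * cheb_T (int t)"
    using cheb_S_T[of "int M" "int t"] by (simp add: M_def of_nat_diff)
  then have "sylvester_det ?S (cheb_S (int (M + t))) s 1 + sylvester_det ?S (cheb_S (int (M - t))) s 1 =
      sylvester_det ?S (?S * cheb_T (int t)) s 1"
    by (simp only: sylvester_det_one_add[symmetric])
  also have "\<dots> = of_nat M ^ Suc s * coeff (cheb_T (int t)) s"
    unfolding sylvester_det_one_multiple coeff_cheb_S_0 ..
  also have "coeff (cheb_T (int t)) s = of_nat t * (2 * of_nat t - 3)"
    using coeff_cheb_T_second[of s] by (simp add: s algebra_simps)
  also have "of_nat M ^ Suc s = (of_nat t ^ (t - 1) * of_nat (2 * n + 1) ^ (t - 1) :: rat)"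
    unfolding M_def of_nat_mult power_mult_distrib by (simp add: s)
  finally have syl: "sylvester_det ?S (cheb_S (int (M + t))) s 1 + sylvester_det ?S (cheb_S (int (M - t))) s 1 =
      of_nat t ^ (t - 1) * of_nat (2 * n + 1) ^ (t - 1) * (of_nat t * (2 * of_nat t - 3))" .
  have "of_nat t ^ (t - 1) * (?H1 + ?H2) =
      - (sylvester_det ?S (cheb_S (int (M + t))) s 1 + sylvester_det ?S (cheb_S (int (M - t))) s 1)"
    unfolding distrib_left H1 H2 by simp
  also have "\<dots> = of_nat t ^ (t - 1) * (- (of_nat (2 * n + 1) ^ (t - 1) * (of_nat t * (2 * of_nat t - 3))))"
    unfolding syl by (simp only: mult_minus_right mult.assoc)
  finally have "of_nat t ^ (t - 1) * (?H1 + ?H2) =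
      of_nat t ^ (t - 1) * (- (of_nat (2 * n + 1) ^ (t - 1) * (of_nat t * (2 * of_nat t - 3))))" .
  then have "?H1 + ?H2 = - (of_nat (2 * n + 1) ^ (t - 1) * (of_nat t * (2 * of_nat t - 3)))"
    using t by (subst (asm) mult_cancel_left) auto
  then show ?thesis by (simp only: mult.commute[of "of_nat (2 * n + 1) ^ (t - 1)"] mult_minus_left)
qed

text \<open>
  The two polynomials S_(t n + t) and S_(t n + 2 t) have the same leading coefficients in n. One of them has
  j - 1 rows and the other t - j, which are no fewer by the assumption on j. The one with j - 1 rows is
  first replaced by its difference to the other, which lowers its degree in n.
\<close>

lemma hankel_even_degree:
  assumes r: "r = 2 * t" and j: "1 \<le> j" "2 * j \<le> t + 1"
  shows "polynomial_of_degree ((2 * j - 1) * (t - j))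
      (\<lambda>n. (-1) ^ (n * (t choose 2)) * hankel (t * n + j) (catalan_power r))"
    and "polynomial_of_degree ((2 * j - 1) * (t - j))
      (\<lambda>n. (-1) ^ (n * (t choose 2)) * hankel (t * n + t - j + 1) (catalan_power r))"
proof -
  obtain b where b: "j = b + 1" using j by (metis add.commute le_Suc_ex One_nat_def plus_1_eq_Suc)
  define a where "a = t - j"
  have a: "t = a + b + 1" "t = b + a + 1" and ba: "b \<le> a" and t0: "t > 0"
    using j b by (auto simp: a_def)
  have d: "(2 * j - 1) * (t - j) = a * (2 * b + 1)"
    using a b by simp
  define L where "L n = cheb_S (int (t * n + t))" for n
  define U where "U n = cheb_S (int (t * n + t + t))" for n
  have shift: "(-1) ^ (n * (t choose 2)) * hankel (t * n + (y + 1)) (catalan_power (2 * t)) =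
      (-1) ^ ((y + 1) choose 2) / of_nat t ^ (t - 1) * sylvester_det (L n) (U n) x y"
    if "t = x + y + 1" for x y n
  proof -
    have "of_nat t ^ (t - 1) * ((-1) ^ (n * (t choose 2)) * hankel (t * n + (y + 1)) (catalan_power (2 * t))) =
        (-1) ^ (n * (t choose 2)) * ((-1) ^ (n * (t choose 2) + ((y + 1) choose 2)) *
          sylvester_det (cheb_S (int (t * (n + 1)))) (cheb_S (int (t * (n + 2)))) x y)"
      using hankel_even_shift[OF that, of n] by (subst mult.left_commute) (simp only:)
    also have "\<dots> = (-1) ^ ((y + 1) choose 2) * sylvester_det (L n) (U n) x y"
      unfolding sign_cancel by (simp add: L_def U_def algebra_simps)
    finally show ?thesis using t0 by (simp add: field_simps)
  qed
  have diff: "has_leading_term (2 * i) (of_nat t * (of_nat t ^ (2 * i) / fact (2 * i))) (\<lambda>n. coeff (U n - L n) i)" for i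
    unfolding U_def L_def by (rule has_leading_term_coeff_cheb_S_diff)
  show "polynomial_of_degree ((2 * j - 1) * (t - j))
      (\<lambda>n. (-1) ^ (n * (t choose 2)) * hankel (t * n + j) (catalan_power r))"
    unfolding d r
  proof (rule polynomial_of_degree_multiple)
    show "\<exists>c. c \<noteq> 0 \<and> has_leading_term (a * (2 * b + 1)) c (\<lambda>n. sylvester_det (U n - L n) (L n) b a)"
      by (rule has_leading_term_sylvester[OF t0 _ diff])
        (use t0 in simp, unfold L_def, rule has_leading_term_coeff_cheb_S)
    show "(-1) ^ (n * (t choose 2)) * hankel (t * n + j) (catalan_power (2 * t)) =
        ((-1) ^ ((b + 1) choose 2) / of_nat t ^ (t - 1) * (-1) ^ (a * b)) * sylvester_det (U n - L n) (L n) b a" for n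
      unfolding b shift[OF a(1)] sylvester_det_difference[OF ba] by simp
  qed (use t0 in simp)
  show "polynomial_of_degree ((2 * j - 1) * (t - j))
      (\<lambda>n. (-1) ^ (n * (t choose 2)) * hankel (t * n + t - j + 1) (catalan_power r))"
    unfolding d r
  proof (rule polynomial_of_degree_multiple)
    have diff': "has_leading_term (2 * i) (- of_nat t * (of_nat t ^ (2 * i) / fact (2 * i))) (\<lambda>n. coeff (L n - U n) i)" for i
      using has_leading_term_cmult[OF diff[of i], of "-1"] by simp
    show "\<exists>c. c \<noteq> 0 \<and> has_leading_term (a * (2 * b + 1)) c (\<lambda>n. sylvester_det (L n - U n) (U n) b a)"
      by (rule has_leading_term_sylvester[OF t0 _ diff'])
        (use t0 in simp, unfold U_def add.assoc[of "t * _"], rule has_leading_term_coeff_cheb_S)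
    show "(-1) ^ (n * (t choose 2)) * hankel (t * n + t - j + 1) (catalan_power (2 * t)) =
        ((-1) ^ ((a + 1) choose 2) / of_nat t ^ (t - 1)) * sylvester_det (L n - U n) (U n) b a" for n
    proof -
      have "t * n + t - j + 1 = t * n + (a + 1)" using a b by simp
      moreover have "sylvester_det (L n) (U n) b a = sylvester_det (L n - U n) (U n) b a"
        using sylvester_det_swap[of "L n" "U n" b a] sylvester_det_difference[OF ba, of "U n" "L n"]
          sign_cancel[of "a * b" 0] by (simp add: mult.commute[of b a])
      ultimately show ?thesis by (simp only: shift[OF a(2)])
    qed
  qed (use t0 in simp)
qed

theorem theorem11:
  fixes r :: nat
  assumes "1 \<le> r" and "r \<le> 31"
  shows
    "(\<forall>t. r = 2 * t + 1 \<longrightarrow>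
        (\<forall>n. hankel ((2 * t + 1) * n) (catalan_power (2 * t + 1)) = (-1) ^ (t * n) \<and>
             hankel ((2 * t + 1) * n + 1) (catalan_power (2 * t + 1)) = (-1) ^ (t * n)) \<and>
        (t \<ge> 1 \<longrightarrow>
          (\<forall>n. hankel ((2 * t + 1) * n + t + 1) (catalan_power (2 * t + 1)) = 0) \<and>
          (\<forall>n. hankel ((2 * t + 1) * n + t) (catalan_power (2 * t + 1)) =
                 (-1) ^ (t * n + (t choose 2)) * of_nat ((2 * t + 1) * (n + 1)) ^ (t - 1) \<and>
               - hankel ((2 * t + 1) * n + t + 2) (catalan_power (2 * t + 1)) =
                 (-1) ^ (t * n + (t choose 2)) * of_nat ((2 * t + 1) * (n + 1)) ^ (t - 1)) \<and>
          (\<forall>n\<ge>1. hankel ((2 * t + 1) * n - 1) (catalan_power (2 * t + 1)) +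
                 hankel ((2 * t + 1) * n + 2) (catalan_power (2 * t + 1)) =
                 (-1) ^ (t * n + 1) * (of_nat t - 1) * of_nat (2 * t + 1)))) \<and>
     (\<forall>t. r = 2 * t \<longrightarrow>
        (\<forall>n. hankel (t * n) (catalan_power (2 * t)) =
               (-1) ^ (n * (t choose 2)) * of_nat (n + 1) ^ (t - 1) \<and>
             hankel (t * n + 1) (catalan_power (2 * t)) =
               (-1) ^ (n * (t choose 2)) * of_nat (n + 1) ^ (t - 1)) \<and>
        (t \<ge> 2 \<longrightarrow>
          (\<forall>n\<ge>1. hankel (2 * t * n - 1) (catalan_power (2 * t)) +
                 hankel (2 * t * n + 2) (catalan_power (2 * t)) =
                 - of_nat t * (2 * of_nat t - 3) * of_nat (2 * n + 1) ^ (t - 1)))) \<and>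
     (\<forall>t. r = 2 * t + 1 \<longrightarrow>
        (\<forall>j. 1 \<le> j \<and> j \<le> t \<longrightarrow>
           polynomial_of_degree ((j - 1) * (r - 2 * j))
             (\<lambda>n. (-1) ^ (t * n) * hankel (r * n + j) (catalan_power r)) \<and>
           polynomial_of_degree ((j - 1) * (r - 2 * j))
             (\<lambda>n. (-1) ^ (t * n) * hankel (r * n + r + 1 - j) (catalan_power r)))) \<and>
     (\<forall>t. r = 2 * t \<longrightarrow>
        (\<forall>j. 1 \<le> j \<and> 2 * j \<le> t + 1 \<longrightarrow>
           polynomial_of_degree ((2 * j - 1) * (t - j))
             (\<lambda>n. (-1) ^ (n * (t choose 2)) * hankel (t * n + j) (catalan_power r)) \<and>
           polynomial_of_degree ((2 * j - 1) * (t - j))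
             (\<lambda>n. (-1) ^ (n * (t choose 2)) * hankel (t * n + t - j + 1) (catalan_power r))))"
proof -
  have pos: "t \<ge> 1" if "r = 2 * t" for t using that assms(1) by simp
  show ?thesis
    by (intro conjI allI impI; (elim conjE)?;
      rule hankel_odd_values[OF refl] hankel_odd_zero[OF refl] hankel_odd_middle_values[OF refl]
        hankel_odd_sum[OF refl] hankel_odd_degree hankel_even_values[OF pos] hankel_even_sum hankel_even_degree; assumption)
qed

end
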